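(* Fix an integer $p\geq2$, a unit vector $\theta_1^0\in\mathbb{R}^p$, $v>0$, a bounded positive real sequence $(r_n)$, and $f\in\mathcal F$. Then, under $\mathrm{P}_{\theta_1^0,r_n,v,f}$, as $n\to\infty$, $$Q_{\rm HPV}^{(n)\dagger}\stackrel{\mathcal D}{\to}\chi^2_{p-1},$$ so that, in all regimes (i) $r_n\equiv1$, (ii) $r_n=o(1)$ with $\sqrt n\,r_n\to\infty$, (iii) $r_n=1/\sqrt n$, (iv) $r_n=o(1/\sqrt n)$, the test $\phi_{\rm HPV}^\dagger$, irrespective of the radial density $f\in\mathcal F$, has asymptotic size $\alpha$ under the null hypothesis. Moreover, under $\mathrm{P}_{\theta_1^0,r_n,v,\phi}$ (the Gaussian case, $\phi(r)=\exp(-r^2/2)$), $$Q_{\rm HPV}^{(n)\dagger}=Q_{\rm HPV}^{(n)}+o_{\rm P}(1)\quad\text{as }n\to\infty.$$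
   Context: Elliptical model: for a unit vector $\theta_1\in\mathbb{R}^p$, $v>0$, a positive sequence $(r_n)$ and a radial density $f:\mathbb{R}^+\to\mathbb{R}^+$, $\mathrm{P}_{\theta_1,r_n,v,f}$ denotes the (sequence of) hypotheses under which, for each $n$, $X_{n1},\ldots,X_{nn}$ are i.i.d. with density (with respect to Lebesgue measure on $\mathbb{R}^p$) $$x\mapsto\frac{c_{p,f}}{(\det\Sigma_n)^{1/2}}f\big(\sqrt{x'\Sigma_n^{-1}x}\big),\qquad\Sigma_n=I_p+r_nv\,\theta_1\theta_1',$$ where $c_{p,f}>0$ is a normalization factor. The radial density $f$ is required to be such that the covariance matrix of $X_{ni}$ exists and equals $\Sigma_n$. With $\mu_{\ell,f}=\int_0^\infty r^\ell f(r)\,dr$, $\mathcal F$ is the collection of such radial densities that further satisfy $\mu_{p+3,f}<\infty$ (finite fourth-order moments). The Gaussian radial density is $\phi(r)=\exp(-r^2/2)$. Prime denotes transpose. Let $\bar X_n=\frac1n\sum_{i=1}^nX_{ni}$ and $S_n=\frac1n\sum_{i=1}^n(X_{ni}-\bar X_n)(X_{ni}-\bar X_n)'$. Let $\hat\lambda_{n1}\geq\cdots\geq\hat\lambda_{np}$ be the eigenvalues of $S_n$ and $\hat\theta_{nj}$ a unit eigenvector of $S_n$ associated with $\hat\lambda_{nj}$ (almost surely unique up to sign for $n>p$; the sign is irrelevant here). Let $\tilde\theta_{n2},\ldots,\tilde\theta_{np}$ be obtained by Gram–Schmidt orthogonalization of $\theta_1^0,\hat\theta_{n2},\ldots,\hat\theta_{np}$,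 i.e. recursively for $j=2,\ldots,p$, $$\tilde\theta_{nj}=\frac{(I_p-\theta_1^0\theta_1^{0\prime}-\sum_{k=2}^{j-1}\tilde\theta_{nk}\tilde\theta_{nk}')\hat\theta_{nj}}{\|(I_p-\theta_1^0\theta_1^{0\prime}-\sum_{k=2}^{j-1}\tilde\theta_{nk}\tilde\theta_{nk}')\hat\theta_{nj}\|}.$$ Define $$Q_{\rm HPV}^{(n)}=\frac{n}{\hat\lambda_{n1}}\sum_{j=2}^p\hat\lambda_{nj}^{-1}(\tilde\theta_{nj}'S_n\theta_1^0)^2,\qquad Q_{\rm HPV}^{(n)\dagger}=\frac{Q_{\rm HPV}^{(n)}}{1+\hat\kappa_p^{(n)}},$$ $$\hat\kappa_p^{(n)}=\frac{1}{np(p+2)}\sum_{i=1}^n\big((X_{ni}-\bar X_n)'S_n^{-1}(X_{ni}-\bar X_n)\big)^2-1.$$ The test $\phi_{\rm HPV}^\dagger$ rejects $\mathcal H_0^{(n)}:\theta_1=\theta_1^0$ at asymptotic level $\alpha$ when $Q_{\rm HPV}^{(n)\dagger}>\chi^2_{p-1,1-\alpha}$, the $\alpha$-upper quantile of the $\chi^2_{p-1}$ distribution. Asymptotic size $\alpha$ under the null hypothesis means that the rejection probability under $\mathrm{P}_{\theta_1^0,r_n,v,f}$ converges to $\alpha$. $\stackrel{\mathcal D}{\to}$ denotes weak convergence. *)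

theory Defs
  imports "HOL-Probability.Probability" "HOL-Library.Landau_Symbols"
begin

text \<open>Throughout, the dimension \<open>p\<close> is \<open>CARD('p)\<close>; observations, eigenvalues and eigenvectors
  are indexed from 1.\<close>

definition outer_prod :: "real^'p \<Rightarrow> real^'p \<Rightarrow> real^'p^'p" where
  "outer_prod u w = (\<chi> i j. u $ i * w $ j)"

definition spiked_cov :: "real^'p \<Rightarrow> real \<Rightarrow> real^'p^'p" where
  "spiked_cov \<theta> a = mat 1 + a *\<^sub>R outer_prod \<theta> \<theta>"


subsection \<open>The elliptical model\<close>

text \<open>By the substitution \<open>x = \<Sigma>\<^sup>1\<^sup>/\<^sup>2 y\<close>, the normalization factor \<open>c\<^sub>p\<^sub>,\<^sub>f\<close> is the inverse of the
  integral of \<open>f (norm y)\<close> over the whole space. If that integral diverges, the value is 0.\<close>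

definition elliptical_const :: "'p::finite itself \<Rightarrow> (real \<Rightarrow> real) \<Rightarrow> real" where
  "elliptical_const _ f = 1 / (LINT y|lborel. f (norm (y :: real^'p)))"

definition elliptical_density ::
    "real^'p::finite^'p \<Rightarrow> (real \<Rightarrow> real) \<Rightarrow> real^'p \<Rightarrow> real" where
  "elliptical_density \<Sigma> f x =
     elliptical_const TYPE('p) f / sqrt (det \<Sigma>) * f (sqrt (x \<bullet> (matrix_inv \<Sigma> *v x)))"

definition has_covariance :: "(real^'p::finite) measure \<Rightarrow> real^'p^'p \<Rightarrow> bool" where
  "has_covariance N V \<longleftrightarrow>
     (\<forall>i j. integrable N (\<lambda>x. x $ i) \<and> integrable N (\<lambda>x. x $ i * x $ j) \<and>
        (LINT x|N. (x $ i - (LINT y|N. y $ i)) * (x $ j - (LINT y|N. y $ j))) = V $ i $ j)"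

text \<open>A radial density is a function on the nonnegative half-line; its values at negative arguments
  are never used. The covariance requirement is imposed at all parameter values of the spiked
  model, so that the class does not depend on them.\<close>

definition radial_density :: "'p::finite itself \<Rightarrow> (real \<Rightarrow> real) \<Rightarrow> bool" where
  "radial_density _ f \<longleftrightarrow>
     f \<in> borel_measurable (restrict_space borel {0..}) \<and>
     (\<forall>t\<ge>0. 0 \<le> f t) \<and>
     0 < elliptical_const TYPE('p) f \<and>
     (\<forall>(\<theta> :: real^'p) r v. norm \<theta> = 1 \<and> 0 < r \<and> 0 < v \<longrightarrow>
        has_covariance (density lborel (\<lambda>x. ennreal (elliptical_density (spiked_cov \<theta> (r * v)) f x)))
          (spiked_cov \<theta> (r * v)))"

definition radial_moment :: "nat \<Rightarrow> (real \<Rightarrow> real) \<Rightarrow> ennreal" where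
  "radial_moment l f = (\<integral>\<^sup>+t\<in>{0..}. ennreal (t ^ l * f t) \<partial>lborel)"

definition radial_class :: "'p::finite itself \<Rightarrow> (real \<Rightarrow> real) set" where
  "radial_class _ = {f. radial_density TYPE('p) f \<and> radial_moment (CARD('p) + 3) f < \<infinity>}"

definition gaussian_radial :: "real \<Rightarrow> real" where
  "gaussian_radial t = exp (- t\<^sup>2 / 2)"

text \<open>The triangular array: row \<open>n\<close> consists of \<open>X n 1, \<dots>, X n n\<close> and may live on its own
  probability space \<open>M n\<close>.\<close>

definition elliptical_model ::
    "(nat \<Rightarrow> 'a measure) \<Rightarrow> (nat \<Rightarrow> nat \<Rightarrow> 'a \<Rightarrow> real^'p::finite) \<Rightarrow>
     real^'p \<Rightarrow> (nat \<Rightarrow> real) \<Rightarrow> real \<Rightarrow> (real \<Rightarrow> real) \<Rightarrow> bool" where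
  "elliptical_model M X \<theta> r v f \<longleftrightarrow>
     (\<forall>n\<ge>1. prob_space (M n) \<and>
        prob_space.indep_vars (M n) (\<lambda>_. borel) (X n) {1..n} \<and>
        (\<forall>i\<in>{1..n}. distributed (M n) lborel (X n i)
           (\<lambda>x. ennreal (elliptical_density (spiked_cov \<theta> (r n * v)) f x))))"


subsection \<open>Statistics\<close>

definition sample_mean :: "nat \<Rightarrow> (nat \<Rightarrow> real^'p) \<Rightarrow> real^'p" where
  "sample_mean n x = (1 / real n) *\<^sub>R (\<Sum>i=1..n. x i)"

definition sample_cov :: "nat \<Rightarrow> (nat \<Rightarrow> real^'p) \<Rightarrow> real^'p^'p" where
  "sample_cov n x =
     (1 / real n) *\<^sub>R (\<Sum>i=1..n. outer_prod (x i - sample_mean n x) (x i - sample_mean n x))"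

text \<open>\<open>l 1 \<ge> \<dots> \<ge> l p\<close> are the eigenvalues of \<open>S\<close>, repeated according to multiplicity (the roots of
  the characteristic polynomial), and \<open>h j\<close> is a unit eigenvector for \<open>l j\<close>.\<close>

definition eigen_system ::
    "real^'p::finite^'p \<Rightarrow> (nat \<Rightarrow> real) \<Rightarrow> (nat \<Rightarrow> real^'p) \<Rightarrow> bool" where
  "eigen_system S l h \<longleftrightarrow>
     (\<forall>j k. 1 \<le> j \<and> j \<le> k \<and> k \<le> CARD('p) \<longrightarrow> l k \<le> l j) \<and>
     (\<forall>t. det (mat t - S) = (\<Prod>j=1..CARD('p). t - l j)) \<and>
     (\<forall>j\<in>{1..CARD('p)}. norm (h j) = 1 \<and> S *v h j = l j *\<^sub>R h j)"

text \<open>The eigenvectors are random vectors, i.e. chosen measurably; signs and, for multiple eigenvalues,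
  the choice within the eigenspace are otherwise arbitrary.\<close>

definition eigen_estimators ::
    "(nat \<Rightarrow> 'a measure) \<Rightarrow> (nat \<Rightarrow> nat \<Rightarrow> 'a \<Rightarrow> real^'p::finite) \<Rightarrow>
     (nat \<Rightarrow> nat \<Rightarrow> 'a \<Rightarrow> real) \<Rightarrow> (nat \<Rightarrow> nat \<Rightarrow> 'a \<Rightarrow> real^'p) \<Rightarrow> bool" where
  "eigen_estimators M X lam th \<longleftrightarrow>
     (\<forall>n\<ge>1. (\<forall>j\<in>{1..CARD('p)}. th n j \<in> borel_measurable (M n)) \<and>
        (\<forall>\<omega>\<in>space (M n).
           eigen_system (sample_cov n (\<lambda>i. X n i \<omega>)) (\<lambda>j. lam n j \<omega>) (\<lambda>j. th n j \<omega>)))"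

fun gram_schmidt :: "real^'p::finite \<Rightarrow> (nat \<Rightarrow> real^'p) \<Rightarrow> nat \<Rightarrow> real^'p" where
  "gram_schmidt \<theta> h j =
     (let w = (mat 1 - outer_prod \<theta> \<theta>
                 - (\<Sum>k\<in>{2..<j}. outer_prod (gram_schmidt \<theta> h k) (gram_schmidt \<theta> h k))) *v h j
      in (1 / norm w) *\<^sub>R w)"

declare gram_schmidt.simps [simp del]

definition Q_HPV ::
    "real^'p::finite \<Rightarrow> nat \<Rightarrow> (nat \<Rightarrow> real^'p) \<Rightarrow> (nat \<Rightarrow> real) \<Rightarrow> (nat \<Rightarrow> real^'p) \<Rightarrow> real" where
  "Q_HPV \<theta> n x l h =
     real n / l 1 *
     (\<Sum>j=2..CARD('p). inverse (l j) * (gram_schmidt \<theta> h j \<bullet> (sample_cov n x *v \<theta>))\<^sup>2)"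

definition kurtosis_est :: "nat \<Rightarrow> (nat \<Rightarrow> real^'p::finite) \<Rightarrow> real" where
  "kurtosis_est n x =
     1 / (real n * real CARD('p) * (real CARD('p) + 2)) *
     (\<Sum>i=1..n. ((x i - sample_mean n x) \<bullet>
        (matrix_inv (sample_cov n x) *v (x i - sample_mean n x)))\<^sup>2) - 1"

definition Q_HPV_dagger ::
    "real^'p::finite \<Rightarrow> nat \<Rightarrow> (nat \<Rightarrow> real^'p) \<Rightarrow> (nat \<Rightarrow> real) \<Rightarrow> (nat \<Rightarrow> real^'p) \<Rightarrow> real" where
  "Q_HPV_dagger \<theta> n x l h = Q_HPV \<theta> n x l h / (1 + kurtosis_est n x)"


subsection \<open>Limits\<close>

text \<open>The \<open>\<chi>\<^sup>2\<close> distribution with \<open>k\<close> degrees of freedom: the law of the sum of squares of \<open>k\<close>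
  independent standard normal variables.\<close>

definition chi_square :: "nat \<Rightarrow> real measure" where
  "chi_square k =
     distr (PiM {..<k} (\<lambda>_. density lborel (\<lambda>x. ennreal (std_normal_density x)))) borel
       (\<lambda>z. \<Sum>i<k. (z i)\<^sup>2)"

definition upper_quantile :: "real measure \<Rightarrow> real \<Rightarrow> real" where
  "upper_quantile N \<alpha> = Inf {q. 1 - \<alpha> \<le> cdf N q}"

definition rejects_HPV_dagger ::
    "real \<Rightarrow> real^'p::finite \<Rightarrow> nat \<Rightarrow> (nat \<Rightarrow> real^'p) \<Rightarrow> (nat \<Rightarrow> real) \<Rightarrow> (nat \<Rightarrow> real^'p) \<Rightarrow> bool" where
  "rejects_HPV_dagger \<alpha> \<theta> n x l h \<longleftrightarrow>
     Q_HPV_dagger \<theta> n x l h > upper_quantile (chi_square (CARD('p) - 1)) \<alpha>"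

definition negligible_in_prob :: "(nat \<Rightarrow> 'a measure) \<Rightarrow> (nat \<Rightarrow> 'a \<Rightarrow> real) \<Rightarrow> bool" where
  "negligible_in_prob M Y \<longleftrightarrow>
     (\<forall>\<epsilon>>0. (\<lambda>n. measure (M n) {\<omega> \<in> space (M n). \<bar>Y n \<omega>\<bar> > \<epsilon>}) \<longlonglongrightarrow> 0)"

definition HPV_regime :: "(nat \<Rightarrow> real) \<Rightarrow> bool" where
  "HPV_regime r \<longleftrightarrow>
     (\<forall>n\<ge>1. r n = 1) \<or>
     (r \<in> o(\<lambda>_. 1) \<and> filterlim (\<lambda>n. sqrt (real n) * r n) at_top sequentially) \<or>
     (\<forall>n\<ge>1. r n = 1 / sqrt (real n)) \<or>
     r \<in> o(\<lambda>n. 1 / sqrt (real n))"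

end

theory Submission
  imports Defs
begin

text \<open>Write \<open>X = \<Sigma>\<^sub>n\<^sup>1\<^sup>/\<^sup>2 Y\<close>. The rows of \<open>Y\<close> are i.i.d. with a spherical law that does not depend
  on \<open>n\<close>, and \<open>\<theta>\<close> is an eigenvector of \<open>\<Sigma>\<^sub>n\<^sup>1\<^sup>/\<^sup>2\<close>. The law of large numbers for \<open>Y\<close> bounds the sample
  covariance of \<open>X\<close> by multiples \<open>1 \<plusminus> \<delta>\<close> of \<open>\<Sigma>\<^sub>n\<close> in the sense of quadratic forms, so that
  \<open>\<lambda>\<^sub>1 / (1 + r\<^sub>n v)\<close> and \<open>\<lambda>\<^sub>2, \<dots>, \<lambda>\<^sub>p\<close> tend to 1 whatever the rate of \<open>r\<^sub>n\<close>, while the kurtosis estimate is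
  affine invariant. Almost surely \<open>\<theta>\<close> is not orthogonal to any eigenvector of the sample covariance \<open>S\<close>:
  otherwise the Krylov determinant of \<open>\<theta>, S \<theta>, \<dots>, S\<^sup>p\<^sup>-\<^sup>1 \<theta>\<close>, a nonzero polynomial in the data, would vanish.
  Then the spectrum is simple, the Gram-Schmidt vectors form an orthonormal basis of the orthogonal complement
  of \<open>\<theta>\<close>, and Parseval's identity makes the statistic asymptotic to
  \<open>n\<close> times the squared projection of \<open>S\<^sub>Y \<theta>\<close> on this complement. Its coordinates are sums of
  \<open>(u \<bullet> Y\<^sub>i) (\<theta> \<bullet> Y\<^sub>i)\<close>, which are uncorrelated with variance \<open>1 + \<kappa>\<close> by rotation invariance.\<close>

section \<open>Symmetric matrices with a cyclic vector\<close>

text \<open>No gap between the leading eigenvalue and the others may be used: when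
  \<open>r n\<close> tends to 0 fast, neither the eigenvectors nor the individual Gram-Schmidt
  vectors need converge. What survives is that the latter span the complement of \<theta> and that
  all weights \<open>(1 + a) / (l 1 * l j)\<close> are close to 1. The resulting error is
  multiplicative, and tightness of the main term makes it absolute. Rows live on unrelated
  probability spaces, so all laws of large numbers are weak ones, and since only the first moment of
  \<open>norm y ^ 4\<close> is assumed finite they are proved by truncation. The limit theorem is
  reduced to dimension one: the Laplace transform of a sum of squares is a Gaussian average of
  characteristic functions of linear combinations, each of them a normalized i.i.d. sum. Jacobians
  are never computed: a linear bijection maps Lebesgue measure to a multiple of itself, and the
  multiple is recovered from total mass one. Eigenvalues are counted as roots of the characteristic
  polynomial, so simplicity is a statement about determinants and not only about
  eigenspaces.\<close>

lemma outer_prod_mult_vec: "outer_prod u w *v x = (w \<bullet> x) *\<^sub>R u"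
  by (simp add: vec_eq_iff outer_prod_def matrix_vector_mult_def inner_vec_def sum_distrib_left mult_ac)

lemma spiked_cov_mult_vec: "spiked_cov \<theta> a *v x = x + (a * (\<theta> \<bullet> x)) *\<^sub>R \<theta>"
  by (simp add: spiked_cov_def matrix_vector_mult_add_rdistrib outer_prod_mult_vec
      scaleR_matrix_vector_assoc[symmetric])

text \<open>Full cardinality makes the orthonormal family span the space; the residual
  \<open>r\<close> is orthogonal to all of it, hence to itself.\<close>

lemma orthonormal_expansion:
  fixes b :: "'i \<Rightarrow> 'a::euclidean_space"
  assumes "finite J" "card J = DIM('a)"
    and on: "\<And>i j. i \<in> J \<Longrightarrow> j \<in> J \<Longrightarrow> b i \<bullet> b j = (if i = j then 1 else 0)"
  shows "(\<Sum>j\<in>J. (b j \<bullet> s) *\<^sub>R b j) = s"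
proof -
  have inj: "inj_on b J"
    by (rule inj_onI) (metis on zero_neq_one)
  have "pairwise orthogonal (b ` J)"
    using on by (auto simp: pairwise_def orthogonal_def)
  moreover have "0 \<notin> b ` J"
    using on by (metis imageE inner_zero_left zero_neq_one)
  ultimately have ind: "independent (b ` J)"
    by (rule pairwise_orthogonal_independent)
  have "card (b ` J) = DIM('a)"
    using inj assms by (simp add: card_image)
  then have span: "span (b ` J) = UNIV"
    using ind by (metis card_ge_dim_independent dim_UNIV order_refl subset_UNIV top.extremum_uniqueI)
  define r where "r = s - (\<Sum>j\<in>J. (b j \<bullet> s) *\<^sub>R b j)"
  have "b i \<bullet> r = 0" if "i \<in> J" for i
  proof -
    have "(\<Sum>j\<in>J. (b j \<bullet> s) * (b i \<bullet> b j)) = (\<Sum>j\<in>J. if i = j then b j \<bullet> s else 0)"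
      using that by (intro sum.cong) (auto simp: on)
    then show ?thesis
      using that assms(1) by (simp add: r_def inner_diff_right inner_sum_right)
  qed
  then have "orthogonal r x" if "x \<in> b ` J" for x
    using that by (auto simp: orthogonal_def inner_commute)
  then have "orthogonal r r"
    by (metis UNIV_I orthogonal_to_span span)
  then show ?thesis by (simp add: r_def orthogonal_def)
qed

lemma orthonormal_parseval:
  fixes b :: "'i \<Rightarrow> 'a::euclidean_space"
  assumes "finite J" "card J = DIM('a)"
    and "\<And>i j. i \<in> J \<Longrightarrow> j \<in> J \<Longrightarrow> b i \<bullet> b j = (if i = j then 1 else 0)"
  shows "(\<Sum>j\<in>J. (b j \<bullet> s)\<^sup>2) = s \<bullet> s"
proof -
  have "s \<bullet> s = (\<Sum>j\<in>J. (b j \<bullet> s) *\<^sub>R b j) \<bullet> s"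
    using orthonormal_expansion[OF assms, of s] by simp
  then show ?thesis by (simp add: inner_sum_left power2_eq_square)
qed

lemma symmetric_inner:
  fixes S :: "real^'n^'n"
  assumes "transpose S = S"
  shows "(S *v x) \<bullet> y = x \<bullet> (S *v y)"
  by (metis assms dot_lmul_matrix inner_commute transpose_matrix_vector)

text \<open>A rotation carrying a coordinate axis to \<open>u\<close> conjugates the matrix to a
  diagonal one with a single entry \<open>1 + c\<close> and all others 1.\<close>

lemma det_rank_one_update:
  fixes u :: "real^'n"
  assumes "norm u = 1"
  shows "det (mat 1 + c *\<^sub>R outer_prod u u) = 1 + c"
proof -
  obtain k :: 'n and A where A: "orthogonal_matrix A" "A *v axis k 1 = u"
    using orthogonal_matrix_exists_basis[OF assms] by blast
  define D :: "real^'n^'n" where "D = mat 1 + c *\<^sub>R outer_prod (axis k 1) (axis k 1)"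
  have AA: "A ** transpose A = mat 1" using A by (simp add: orthogonal_matrix_def)
  have *: "transpose A *v u = axis k 1"
    using A by (metis matrix_vector_mul_assoc matrix_vector_mul_lid orthogonal_matrix_def)
  have "mat 1 + c *\<^sub>R outer_prod u u = A ** D ** transpose A"
  proof (rule matrix_eq[THEN iffD2, rule_format])
    fix x :: "real^'n"
    have "axis k 1 \<bullet> (transpose A *v x) = u \<bullet> x"
      by (metis A(2) dot_lmul_matrix transpose_matrix_vector transpose_transpose)
    then have "A *v (D *v (transpose A *v x)) = x + (c * (u \<bullet> x)) *\<^sub>R u"
      unfolding D_def spiked_cov_def[symmetric] spiked_cov_mult_vec
      by (simp add: matrix_vector_right_distrib matrix_vector_mult_scaleR A(2) matrix_vector_mul_assoc AA del: transpose_matrix_vector)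
    then show "(mat 1 + c *\<^sub>R outer_prod u u) *v x = (A ** D ** transpose A) *v x"
      by (simp add: matrix_vector_mul_assoc[symmetric] spiked_cov_def[symmetric] spiked_cov_mult_vec)
  qed
  then have "det (mat 1 + c *\<^sub>R outer_prod u u) = det D * (det A * det (transpose A))"
    by (simp add: det_mul)
  also have "det A * det (transpose A) = 1"
    by (metis AA det_I det_mul)
  also have "det D = (\<Prod>i\<in>UNIV. D $ i $ i)"
    by (rule det_diagonal) (auto simp: D_def mat_def outer_prod_def axis_def)
  also have "\<dots> = (\<Prod>i\<in>UNIV. if i = k then 1 + c else 1)"
    by (intro prod.cong) (auto simp: D_def mat_def outer_prod_def axis_def)
  also have "\<dots> = 1 + c" by simp
  finally show ?thesis by simp
qed

lemma continuous_on_det [continuous_intros]: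
  fixes A :: "'a::topological_space \<Rightarrow> real^'n^'n"
  assumes "continuous_on T A"
  shows "continuous_on T (\<lambda>x. det (A x))"
  unfolding det_def by (intro continuous_intros assms)

text \<open>The vector \<open>\<theta>\<close> is cyclic for the symmetric matrix \<open>S\<close> iff no eigenvector is orthogonal to it.\<close>

definition cyclic_vec :: "real^'n^'n \<Rightarrow> real^'n \<Rightarrow> bool" where
  "cyclic_vec S \<theta> \<longleftrightarrow> (\<forall>x c. S *v x = c *\<^sub>R x \<longrightarrow> x \<bullet> \<theta> = 0 \<longrightarrow> x = 0)"

text \<open>\<open>eigen_system\<close> counts roots of the characteristic polynomial, whereas
  \<open>cyclic_vec\<close> only restricts eigenvectors, so a double root with a one-dimensional
  eigenspace has to be excluded. Deflation does this: adding the projection on the eigenvector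
  \<open>u\<close> to \<open>S - mat t\<close> moves the eigenvalue 0 along \<open>u\<close> to 1,
  and a second root at \<open>t\<close> would leave a kernel that symmetry and cyclicity
  forbid.\<close>

lemma eigen_system_simple:
  fixes S :: "real^'p^'p"
  assumes sym: "transpose S = S" and es: "eigen_system S l h" and cyc: "cyclic_vec S \<theta>"
    and j: "j \<in> {1..CARD('p)}" and k: "k \<in> {1..CARD('p)}" and "j \<noteq> k"
  shows "l j \<noteq> l k"
proof
  assume eq: "l j = l k"
  define t u where "t = l j" and "u = h j"
  have u: "norm u = 1" "S *v u = t *\<^sub>R u"
    using es j by (auto simp: eigen_system_def t_def u_def)
  have uu: "u \<bullet> u = 1" using u(1) by (simp add: norm_eq_1)
  have ker: "x = 0" if x: "S *v x = t *\<^sub>R x" "u \<bullet> x = 0" for x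
  proof (cases "x \<bullet> \<theta> = 0")
    case True then show ?thesis using cyc x by (auto simp: cyclic_vec_def)
  next
    case False
    \<comment> \<open>The combination of the two eigenvectors that is orthogonal to \<theta>;
      cyclicity forces it to vanish.\<close>
    define z where "z = (x \<bullet> \<theta>) *\<^sub>R u - (u \<bullet> \<theta>) *\<^sub>R x"
    have "S *v z = t *\<^sub>R z"
      by (simp add: z_def matrix_vector_mult_diff_distrib matrix_vector_mult_scaleR x u
          scaleR_diff_right mult.commute)
    moreover have "z \<bullet> \<theta> = 0"
      by (simp add: z_def inner_diff_left)
    ultimately have "z = 0" using cyc by (auto simp: cyclic_vec_def)
    then have "u \<bullet> z = 0" by simp
    then have "x \<bullet> \<theta> = 0" using x uu by (simp add: z_def inner_diff_right)
    then show ?thesis using False by simp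
  qed
  \<comment> \<open>The deflated matrix: it fixes \<open>u\<close> and acts as
    \<open>S - mat t\<close> on the complement of \<open>u\<close>.\<close>
  define B where "B = S - mat t + outer_prod u u"
  have mat_vec: "mat c *v x = c *\<^sub>R x" for c and x :: "real^'p"
    by (simp add: vec_eq_iff matrix_vector_mult_def mat_def if_distrib if_distribR cong: if_cong)
  have Bv: "B *v x = S *v x - t *\<^sub>R x + (u \<bullet> x) *\<^sub>R u" for x
    by (simp add: B_def matrix_vector_mult_add_rdistrib matrix_vector_mult_diff_rdistrib mat_vec outer_prod_mult_vec)
  \<comment> \<open>By symmetry the range of \<open>S - mat t\<close> is orthogonal to
    \<open>u\<close>, so a kernel vector of \<open>B\<close> is orthogonal to \<open>u\<close> and
    \<open>ker\<close> applies.\<close>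
  have "inj ((*v) (mat 0 - B))"
  proof (rule linear_injective_0[OF matrix_vector_mul_linear, THEN iffD2], intro allI impI)
    fix x assume "(mat 0 - B) *v x = 0"
    then have "B *v x = 0" by (simp add: matrix_vector_mult_diff_rdistrib mat_vec del: mat_0)
    then have 0: "S *v x - t *\<^sub>R x + (u \<bullet> x) *\<^sub>R u = 0" by (simp add: Bv)
    have "u \<bullet> (S *v x) = t * (u \<bullet> x)"
      using symmetric_inner[OF sym, of u x] by (simp add: u)
    then have ux: "u \<bullet> x = 0"
      using arg_cong[OF 0, of "\<lambda>z. u \<bullet> z"] by (simp add: inner_add_right inner_diff_right uu)
    with 0 show "x = 0" by (intro ker) auto
  qed
  then have detB: "det (mat 0 - B) \<noteq> 0"
    by (metis invertible_det_nz invertible_left_inverse matrix_left_invertible_injective)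
  \<comment> \<open>The characteristic polynomial at \<open>t + s\<close> without the two factors
    that both equal \<open>s\<close>.\<close>
  define rest where "rest = (\<lambda>s. \<Prod>i\<in>{1..CARD('p)} - {j, k}. t + s - l i)"
  \<comment> \<open>A rank-one factor turns \<open>mat s - B\<close> into
    \<open>mat (t + s) - S\<close>. Its determinant \<open>s / (s - 1)\<close> cancels only one of
    the two factors \<open>s\<close>, so a zero of \<open>det (mat s - B)\<close> at 0
    remains.\<close>
  have key: "det (mat s - B) = (s - 1) * s * rest s" if s: "s \<noteq> 0" "s \<noteq> 1" for s
  proof -
    have "mat (t + s) - S = (mat s - B) ** (mat 1 + (1 / (s - 1)) *\<^sub>R outer_prod u u)"
    proof (rule matrix_eq[THEN iffD2, rule_format])
      fix x :: "real^'p"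
      have "((mat s - B) ** (mat 1 + (1 / (s - 1)) *\<^sub>R outer_prod u u)) *v x
        = (mat s - B) *v x + ((1 / (s - 1)) * (u \<bullet> x)) *\<^sub>R ((mat s - B) *v u)"
        unfolding spiked_cov_def[symmetric]
        by (simp add: matrix_vector_mul_assoc[symmetric] spiked_cov_mult_vec matrix_vector_right_distrib
            matrix_vector_mult_scaleR)
      also have "(mat s - B) *v u = (s - 1) *\<^sub>R u"
        by (simp add: matrix_vector_mult_diff_rdistrib mat_vec Bv u uu algebra_simps)
      also have "(mat s - B) *v x + ((1 / (s - 1)) * (u \<bullet> x)) *\<^sub>R ((s - 1) *\<^sub>R u) = (mat (t + s) - S) *v x"
        using s by (simp add: matrix_vector_mult_diff_rdistrib mat_vec Bv scaleR_add_left)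
      finally show "(mat (t + s) - S) *v x
        = ((mat s - B) ** (mat 1 + (1 / (s - 1)) *\<^sub>R outer_prod u u)) *v x" by simp
    qed
    then have "det (mat (t + s) - S) = det (mat s - B) * (1 + 1 / (s - 1))"
      by (simp add: det_mul det_rank_one_update u(1))
    moreover have "det (mat (t + s) - S) = (\<Prod>i=1..CARD('p). t + s - l i)"
      using es by (simp add: eigen_system_def)
    moreover have "(\<Prod>i=1..CARD('p). t + s - l i)
        = (t + s - l j) * (\<Prod>i\<in>{1..CARD('p)} - {j}. t + s - l i)"
      using j by (intro prod.remove) auto
    moreover have "(\<Prod>i\<in>{1..CARD('p)} - {j}. t + s - l i)
        = (t + s - l k) * (\<Prod>i\<in>{1..CARD('p)} - {j} - {k}. t + s - l i)"
      using k \<open>j \<noteq> k\<close> by (intro prod.remove) auto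
    moreover have "{1..CARD('p)} - {j} - {k} = {1..CARD('p)} - {j, k}" by auto
    ultimately have "det (mat s - B) * (1 + 1 / (s - 1)) = s * s * rest s"
      using eq by (simp add: rest_def t_def)
    moreover have "1 + 1 / (s - 1) = s / (s - 1)" using s by (simp add: field_simps)
    ultimately have "s * det (mat s - B) = s * ((s - 1) * s * rest s)"
      using s by (simp add: divide_eq_eq mult_ac)
    then show ?thesis using s by simp
  qed
  \<comment> \<open>The identity excludes \<open>s = 0\<close>, the very point of interest;
    continuity of both sides extends it there.\<close>
  have "continuous_on UNIV (\<lambda>s::real. mat s :: real^'p^'p)"
  proof -
    have "continuous_on UNIV (\<lambda>s::real. if i = j' then s else 0)" for i j' :: 'p
      by (cases "i = j'") auto
    then show ?thesis unfolding mat_def by (intro continuous_on_vec_lambda)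
  qed
  then have "continuous_on UNIV (\<lambda>s::real. det (mat s - B))"
    by (intro continuous_intros)
  then have l1: "((\<lambda>s. det (mat s - B)) \<longlongrightarrow> det (mat 0 - B)) (at 0)"
    by (simp only: continuous_on_eq_continuous_at[OF open_UNIV] isCont_def Ball_def UNIV_I simp_thms)
  have "continuous_on UNIV (\<lambda>s. (s - 1) * s * rest s)"
    unfolding rest_def by (intro continuous_intros)
  then have "((\<lambda>s. (s - 1) * s * rest s) \<longlongrightarrow> (0 - 1) * 0 * rest 0) (at 0)"
    by (simp only: continuous_on_eq_continuous_at[OF open_UNIV] isCont_def Ball_def UNIV_I simp_thms)
  moreover have "\<forall>\<^sub>F s in at 0. (s - 1) * s * rest s = det (mat s - B)"
    unfolding eventually_at using key by (intro exI[of _ 1]) auto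
  ultimately have "((\<lambda>s. det (mat s - B)) \<longlongrightarrow> 0) (at 0)"
    by (simp add: tendsto_cong)
  with l1 have "det (mat 0 - B) = 0"
    using tendsto_unique by (metis trivial_limit_at)
  with detB show False by simp
qed

text \<open>Cyclicity matters here: for a multiple eigenvalue, \<open>eigen_system\<close> would
  admit non-orthogonal and even equal eigenvectors.\<close>

lemma eigen_system_orthonormal:
  fixes S :: "real^'p^'p"
  assumes sym: "transpose S = S" and es: "eigen_system S l h" and cyc: "cyclic_vec S \<theta>"
    and j: "j \<in> {1..CARD('p)}" and k: "k \<in> {1..CARD('p)}"
  shows "h j \<bullet> h k = (if j = k then 1 else 0)"
proof (cases "j = k")
  case True then show ?thesis using es k by (auto simp: eigen_system_def norm_eq_1)
next
  case False
  have "l j * (h j \<bullet> h k) = l k * (h j \<bullet> h k)"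
    using symmetric_inner[OF sym, of "h j" "h k"] es j k by (auto simp: eigen_system_def)
  then show ?thesis
    using eigen_system_simple[OF sym es cyc j k False] False by auto
qed

text \<open>Independence is witnessed by \<open>h 1\<close>, which is orthogonal to all later
  \<open>h j\<close> but not to \<theta>. The span clause is carried through the induction in order
  to show that no normalization divides by zero.\<close>

lemma gram_schmidt_orthonormal:
  fixes \<theta> :: "real^'p" and h :: "nat \<Rightarrow> real^'p"
  assumes \<theta>: "norm \<theta> = 1" and h1: "h 1 \<bullet> \<theta> \<noteq> 0"
    and on: "\<And>j k. j \<in> {1..p} \<Longrightarrow> k \<in> {1..p} \<Longrightarrow> h j \<bullet> h k = (if j = k then 1 else 0)"
    and "j \<in> {2..p}"
  shows "norm (gram_schmidt \<theta> h j) = 1 \<and> gram_schmidt \<theta> h j \<bullet> \<theta> = 0 \<and>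
    (\<forall>k\<in>{2..<j}. gram_schmidt \<theta> h j \<bullet> gram_schmidt \<theta> h k = 0) \<and>
    gram_schmidt \<theta> h j \<in> span (insert \<theta> (h ` {2..j}))"
  using assms(4)
proof (induction j rule: less_induct)
  case (less j)
  define g where "g = gram_schmidt \<theta> h"
  define w where "w = h j - (\<theta> \<bullet> h j) *\<^sub>R \<theta> - (\<Sum>k\<in>{2..<j}. (g k \<bullet> h j) *\<^sub>R g k)"
  have IH: "norm (g k) = 1" "g k \<bullet> \<theta> = 0" "g k \<in> span (insert \<theta> (h ` {2..k}))"
    "\<And>i. i \<in> {2..<k} \<Longrightarrow> g k \<bullet> g i = 0"
    if "k \<in> {2..<j}" for k
    using less.IH[of k] less.prems that by (auto simp: g_def)
  have IHo: "g k \<bullet> g i = (if i = k then 1 else 0)" if "k \<in> {2..<j}" "i \<in> {2..<j}" for i k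
    using IH(1)[OF that(1)] IH(4)[OF that(1), of i] IH(4)[OF that(2), of k] that
    by (cases i k rule: linorder_cases) (auto simp: norm_eq_1 inner_commute)
  have sum_vec: "(\<Sum>k\<in>K. A k) *v x = (\<Sum>k\<in>K. A k *v x)" if "finite K"
    for K :: "nat set" and A :: "nat \<Rightarrow> real^'p^'p" and x
    using that by induction (auto simp: matrix_vector_mult_add_rdistrib)
  have gw: "g j = (1 / norm w) *\<^sub>R w"
    unfolding g_def by (subst gram_schmidt.simps)
      (simp add: w_def g_def Let_def matrix_vector_mult_diff_rdistrib outer_prod_mult_vec sum_vec)
  have gspan: "g k \<in> span (insert \<theta> (h ` {2..<j}))" if "k \<in> {2..<j}" for k
    using IH(3)[OF that] span_mono[of "insert \<theta> (h ` {2..k})" "insert \<theta> (h ` {2..<j})"] that by fastforce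
  have hw: "h j - w \<in> span (insert \<theta> (h ` {2..<j}))"
    unfolding w_def using gspan
    by (simp, intro span_add span_sum span_scale) (auto intro: span_base)
  \<comment> \<open>Otherwise \<open>h j - c *\<^sub>R \<theta>\<close> lies in the span of the
    earlier \<open>h i\<close>. Pairing with \<open>h 1\<close> gives \<open>c = 0\<close>, and
    pairing with \<open>h j\<close> then contradicts its unit norm.\<close>
  have "w \<noteq> 0"
  proof
    assume "w = 0"
    with hw have "h j \<in> span (insert \<theta> (h ` {2..<j}))" by simp
    then obtain c where c: "h j - c *\<^sub>R \<theta> \<in> span (h ` {2..<j})"
      by (auto simp: span_insert)
    have perp: "orthogonal (h i) (h j - c *\<^sub>R \<theta>)" if "i = 1 \<or> i = j" for i
    proof (rule orthogonal_to_span[OF c])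
      fix y assume "y \<in> h ` {2..<j}"
      then show "orthogonal (h i) y"
        using that less.prems by (auto simp: orthogonal_def on)
    qed
    from perp[of 1] h1 have "c = 0"
      using less.prems by (auto simp: orthogonal_def inner_diff_right on)
    with perp[of j] show False
      using less.prems on[of j j] by (auto simp: orthogonal_def)
  qed
  then have n1: "norm (g j) = 1" by (simp add: gw)
  have t\<theta>: "w \<bullet> \<theta> = 0"
    using \<theta> IH(2) by (simp add: w_def inner_diff_left inner_sum_left norm_eq_1) (simp add: inner_commute)
  have tg: "w \<bullet> g i = 0" if i: "i \<in> {2..<j}" for i
  proof -
    have "(\<Sum>k\<in>{2..<j}. (g k \<bullet> h j) * (g k \<bullet> g i)) = (\<Sum>k\<in>{2..<j}. if k = i then g i \<bullet> h j else 0)"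
      using i by (intro sum.cong) (auto simp: IHo)
    then show ?thesis
      using IH(2)[OF i] i by (simp add: w_def inner_diff_left inner_sum_left) (simp add: inner_commute)
  qed
  have "g j \<in> span (insert \<theta> (h ` {2..j}))"
  proof -
    have "h j - w \<in> span (insert \<theta> (h ` {2..j}))"
      using hw span_mono[of "insert \<theta> (h ` {2..<j})" "insert \<theta> (h ` {2..j})"] by fastforce
    moreover have "h j \<in> span (insert \<theta> (h ` {2..j}))"
      using less.prems by (intro span_base) auto
    ultimately have "h j - (h j - w) \<in> span (insert \<theta> (h ` {2..j}))" by (rule span_diff[rotated])
    then show ?thesis unfolding gw by (intro span_scale) simp
  qed
  then show ?case using n1 t\<theta> tg by (auto simp: gw g_def[symmetric])
qed

section \<open>Null sets of polynomials\<close>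

text \<open>Every line through \<open>z0\<close> meets the zero set finitely often, because the
  restricted polynomial is nonzero at \<open>t = 0\<close>. Fubini exchanges the roles of direction
  and parameter, so that for some fixed nonzero \<open>t\<close> almost all \<open>y\<close> are
  good, and \<open>y \<mapsto> z0 + t y\<close> respects null sets.\<close>

lemma AE_polynomial_nonzero:
  fixes G :: "'b::euclidean_space \<Rightarrow> real"
  assumes [measurable]: "G \<in> borel_measurable borel"
    and poly: "\<And>y. \<exists>q. \<forall>t. G (z0 + t *\<^sub>R y) = poly q t"
    and nz: "G z0 \<noteq> 0"
  shows "AE z in lborel. G z \<noteq> 0"
proof -
  have "AE t in lborel. G (z0 + t *\<^sub>R y) \<noteq> 0" for y
  proof -
    obtain q where q: "\<And>t. G (z0 + t *\<^sub>R y) = poly q t" using poly by blast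
    have "q \<noteq> 0" using nz q[of 0] by auto
    then have "finite {t. poly q t = 0}" by (rule poly_roots_finite)
    then have "AE t in lborel. t \<notin> {t. poly q t = 0}"
      by (intro AE_not_in finite_imp_null_set_lborel)
    then show ?thesis by (simp add: q)
  qed
  then have "AE y in lborel. AE t in lborel. G (z0 + t *\<^sub>R y) \<noteq> 0" by simp
  then have "AE t in lborel. AE y in lborel. G (z0 + t *\<^sub>R y) \<noteq> 0"
    by (subst lborel_pair.AE_commute[symmetric]) measurable
  moreover have "AE t in lborel. t \<noteq> (0::real)" by (rule AE_lborel_singleton)
  ultimately have "AE t in lborel. t \<noteq> (0::real) \<and> (AE y in lborel. G (z0 + t *\<^sub>R y) \<noteq> 0)"
    by eventually_elim simp
  \<comment> \<open>A property that holds almost everywhere on the real line has a witness, since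
    Lebesgue measure is not zero.\<close>
  then have "\<not> (\<forall>t::real. \<not> (t \<noteq> 0 \<and> (AE y in lborel. G (z0 + t *\<^sub>R y) \<noteq> 0)))"
    by (intro notI) (simp add: eventually_False ae_filter_eq_bot_iff)
  then obtain t :: real where t: "t \<noteq> 0" "AE y in lborel. G (z0 + t *\<^sub>R y) \<noteq> 0"
    by blast
  show ?thesis
    by (subst lborel_affine[OF t(1), of z0]) (use t(2) in \<open>simp add: AE_density AE_distr_iff\<close>)
qed

text \<open>Polynomial functions of finitely many vectors, described by their restrictions to lines.\<close>

definition line_poly :: "((nat \<Rightarrow> 'b::real_vector) \<Rightarrow> real) \<Rightarrow> bool" where
  "line_poly F \<longleftrightarrow> (\<forall>x y. \<exists>q. \<forall>t. F (\<lambda>i. x i + t *\<^sub>R y i) = poly q t)"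

named_theorems line_poly_intros

lemma line_poly_const [line_poly_intros]: "line_poly (\<lambda>_. c)"
  unfolding line_poly_def by (intro allI exI[of _ "[:c:]"]) simp

lemma line_poly_inner [line_poly_intros]:
  "line_poly (\<lambda>x. (x i :: 'b::real_inner) \<bullet> b)"
  unfolding line_poly_def
proof (intro allI)
  fix x y :: "nat \<Rightarrow> 'b"
  show "\<exists>q. \<forall>t. (x i + t *\<^sub>R y i) \<bullet> b = poly q t"
    by (rule exI[of _ "[:x i \<bullet> b, y i \<bullet> b:]"]) (simp add: inner_add_left)
qed

lemma line_poly_add [line_poly_intros]:
  assumes "line_poly F" "line_poly G"
  shows "line_poly (\<lambda>x. F x + G x)"
  unfolding line_poly_def
proof (intro allI)
  fix x y
  obtain p q where "\<forall>t. F (\<lambda>i. x i + t *\<^sub>R y i) = poly p t" "\<forall>t. G (\<lambda>i. x i + t *\<^sub>R y i) = poly q t"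
    using assms unfolding line_poly_def by meson
  then show "\<exists>q. \<forall>t. F (\<lambda>i. x i + t *\<^sub>R y i) + G (\<lambda>i. x i + t *\<^sub>R y i) = poly q t"
    by (intro exI[of _ "p + q"]) simp
qed

lemma line_poly_mult [line_poly_intros]:
  assumes "line_poly F" "line_poly G"
  shows "line_poly (\<lambda>x. F x * G x)"
  unfolding line_poly_def
proof (intro allI)
  fix x y
  obtain p q where "\<forall>t. F (\<lambda>i. x i + t *\<^sub>R y i) = poly p t" "\<forall>t. G (\<lambda>i. x i + t *\<^sub>R y i) = poly q t"
    using assms unfolding line_poly_def by meson
  then show "\<exists>q. \<forall>t. F (\<lambda>i. x i + t *\<^sub>R y i) * G (\<lambda>i. x i + t *\<^sub>R y i) = poly q t"
    by (intro exI[of _ "p * q"]) simp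
qed

lemma line_poly_diff [line_poly_intros]:
  assumes "line_poly F" "line_poly G"
  shows "line_poly (\<lambda>x. F x - G x)"
  using line_poly_add[OF assms(1) line_poly_mult[OF line_poly_const[of "-1"] assms(2)]] by simp

lemma line_poly_sum [line_poly_intros]:
  assumes "\<And>i. i \<in> A \<Longrightarrow> line_poly (F i)"
  shows "line_poly (\<lambda>x. \<Sum>i\<in>A. F i x)"
  using assms by (induction A rule: infinite_finite_induct) (auto intro!: line_poly_intros)

lemma line_poly_prod [line_poly_intros]:
  assumes "\<And>i. i \<in> A \<Longrightarrow> line_poly (F i)"
  shows "line_poly (\<lambda>x. \<Prod>i\<in>A. F i x)"
  using assms by (induction A rule: infinite_finite_induct) (auto intro!: line_poly_intros)

lemma line_poly_det [line_poly_intros]: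
  fixes A :: "(nat \<Rightarrow> 'b::real_vector) \<Rightarrow> real^'n^'n"
  assumes "\<And>i j. line_poly (\<lambda>x. A x $ i $ j)"
  shows "line_poly (\<lambda>x. det (A x))"
  unfolding det_def by (intro line_poly_intros assms)

text \<open>Induction on the coordinates. With the new coordinate frozen at \<open>z i\<close>, the
  induction hypothesis makes \<open>F\<close> nonzero for almost all values of the others; for each
  of these, \<open>F\<close> is a polynomial in the new coordinate that is nonzero at
  \<open>z i\<close>.\<close>

lemma AE_PiM_line_poly_nonzero:
  fixes F :: "(nat \<Rightarrow> 'b::euclidean_space) \<Rightarrow> real"
  assumes N: "sigma_finite_measure N" "sets N = sets borel" "absolutely_continuous lborel N"
    and "finite I" "line_poly F" "F \<in> borel_measurable (PiM I (\<lambda>_. N))"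
    and "F z \<noteq> 0" "z \<in> extensional I"
  shows "AE x in PiM I (\<lambda>_. N). F x \<noteq> 0"
  using assms(4-8)
proof (induction I arbitrary: F z rule: finite_induct)
  case empty
  then have z: "z = (\<lambda>x. undefined)" by (auto simp: extensional_def)
  show ?case using empty by (auto simp: PiM_empty AE_count_space z)
next
  case (insert i I)
  interpret N: sigma_finite_measure N by fact
  interpret product_sigma_finite "\<lambda>_. N" ..
  interpret PI: finite_product_sigma_finite "\<lambda>_. N" I by standard fact
  interpret pair_sigma_finite "PiM I (\<lambda>_. N)" N ..
  note [measurable] = insert.prems(2)
  have spN: "space N = UNIV" using sets_eq_imp_space_eq[OF N(2)] by simp
  have upd: "(\<lambda>(f, y). f(i := y)) \<in> measurable (PiM I (\<lambda>_. N) \<Otimes>\<^sub>M N) (PiM (insert i I) (\<lambda>_. N))"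
    by (rule measurable_add_dim)
  have F2[measurable]: "(\<lambda>(f, y). F (f(i := y))) \<in> borel_measurable (PiM I (\<lambda>_. N) \<Otimes>\<^sub>M N)"
    using measurable_compose[OF upd insert.prems(2)] by (simp add: case_prod_beta')
  \<comment> \<open>Freezing a coordinate amounts to using directions whose \<open>i\<close>-th
    entry is 0.\<close>
  have lp1: "line_poly (\<lambda>f. F (f(i := z i)))"
    unfolding line_poly_def
  proof (intro allI)
    fix x y :: "nat \<Rightarrow> 'b"
    obtain q where q: "\<And>t. F (\<lambda>j. (x(i := z i)) j + t *\<^sub>R (y(i := 0)) j) = poly q t"
      using insert.prems(1) unfolding line_poly_def by blast
    have "(\<lambda>j. (x(i := z i)) j + t *\<^sub>R (y(i := 0)) j) = (\<lambda>j. x j + t *\<^sub>R y j)(i := z i)" for t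
      by auto
    then show "\<exists>q. \<forall>t. F ((\<lambda>i. x i + t *\<^sub>R y i)(i := z i)) = poly q t"
      using q by metis
  qed
  have AEf: "AE f in PiM I (\<lambda>_. N). F (f(i := z i)) \<noteq> 0"
  proof (rule insert.IH[OF lp1, of "z(i := undefined)"])
    have "(\<lambda>f. (f, z i)) \<in> PiM I (\<lambda>_. N) \<rightarrow>\<^sub>M PiM I (\<lambda>_. N) \<Otimes>\<^sub>M N"
      by (simp add: spN)
    from measurable_compose[OF this F2] show "(\<lambda>f. F (f(i := z i))) \<in> borel_measurable (PiM I (\<lambda>_. N))"
      by simp
    show "F ((z(i := undefined))(i := z i)) \<noteq> 0" using insert.prems by simp
  qed (use insert in \<open>auto simp: extensional_def\<close>)
  have AEy: "AE y in N. F (f(i := y)) \<noteq> 0" if f: "F (f(i := z i)) \<noteq> 0" "f \<in> space (PiM I (\<lambda>_. N))" for f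
  proof (rule absolutely_continuous_AE[OF _ N(3)])
    show "sets N = sets lborel" by (simp add: N(2))
    show "AE y in lborel. F (f(i := y)) \<noteq> 0"
    proof (rule AE_polynomial_nonzero[of _ "z i"])
      have "(\<lambda>y. (f, y)) \<in> N \<rightarrow>\<^sub>M PiM I (\<lambda>_. N) \<Otimes>\<^sub>M N" using f by simp
      from measurable_compose[OF this F2] show "(\<lambda>y. F (f(i := y))) \<in> borel_measurable borel"
        using measurable_cong_sets[OF N(2) refl] by auto
      fix y
      obtain q where q: "\<And>t. F (\<lambda>j. (f(i := z i)) j + t *\<^sub>R ((\<lambda>_. 0)(i := y)) j) = poly q t"
        using insert.prems(1) unfolding line_poly_def by blast
      have "(\<lambda>j. (f(i := z i)) j + t *\<^sub>R ((\<lambda>_. 0)(i := y)) j) = f(i := z i + t *\<^sub>R y)" for t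
        by auto
      then show "\<exists>q. \<forall>t. F (f(i := z i + t *\<^sub>R y)) = poly q t"
        using q by metis
    qed (use f in simp)
  qed
  have AE1: "AE f in PiM I (\<lambda>_. N). AE y in N. F (f(i := y)) \<noteq> 0"
    using AEf AE_space by eventually_elim (rule AEy)
  \<comment> \<open>The null set is measured by integrating its indicator, so that the product
    integral splits off the new coordinate.\<close>
  have "(\<integral>\<^sup>+x. indicator {0} (F x) \<partial>PiM (insert i I) (\<lambda>_. N))
    = (\<integral>\<^sup>+f. (\<integral>\<^sup>+y. indicator {0} (F (f(i := y))) \<partial>N) \<partial>PiM I (\<lambda>_. N))"
    using insert.hyps by (intro product_nn_integral_insert) auto
  also have "\<dots> = (\<integral>\<^sup>+f. 0 \<partial>PiM I (\<lambda>_. N))"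
  proof (rule nn_integral_cong_AE)
    show "AE f in PiM I (\<lambda>_. N). (\<integral>\<^sup>+y. indicator {0} (F (f(i := y))) \<partial>N) = 0"
      using AE1
    proof eventually_elim
      case (elim f)
      then have "AE y in N. indicator {0} (F (f(i := y))) = (0::ennreal)"
        by eventually_elim simp
      then have "(\<integral>\<^sup>+y. indicator {0} (F (f(i := y))) \<partial>N) = (\<integral>\<^sup>+y. 0 \<partial>N)"
        by (rule nn_integral_cong_AE)
      then show ?case by simp
    qed
  qed
  finally have "(\<integral>\<^sup>+x. indicator {0} (F x) \<partial>PiM (insert i I) (\<lambda>_. N)) = 0" by simp
  then have "AE x in PiM (insert i I) (\<lambda>_. N). indicator {0} (F x) = (0::ennreal)"
    by (subst (asm) nn_integral_0_iff_AE) auto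
  then show ?case
    by eventually_elim (auto simp: indicator_def split: if_splits)
qed

section \<open>A weak law of large numbers for triangular arrays\<close>

text \<open>``With high probability'', stated through measurable covers of the exceptional sets so that \<open>P\<close> need not be
  measurable.\<close>

definition whp :: "(nat \<Rightarrow> 'a measure) \<Rightarrow> (nat \<Rightarrow> 'a \<Rightarrow> bool) \<Rightarrow> bool" where
  "whp M P \<longleftrightarrow> (\<forall>e>0. \<forall>\<^sub>F n in sequentially. \<exists>B\<in>sets (M n).
     {\<omega> \<in> space (M n). \<not> P n \<omega>} \<subseteq> B \<and> emeasure (M n) B \<le> ennreal e)"

section \<open>Calculus of events of high probability\<close>

lemma whp_mono_eventually:
  assumes "whp M P" and "\<forall>\<^sub>F n in sequentially. \<forall>\<omega>\<in>space (M n). P n \<omega> \<longrightarrow> Q n \<omega>"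
  shows "whp M Q"
  unfolding whp_def
proof (intro allI impI)
  fix e :: real assume "e > 0"
  then have "\<forall>\<^sub>F n in sequentially. \<exists>B\<in>sets (M n).
     {\<omega> \<in> space (M n). \<not> P n \<omega>} \<subseteq> B \<and> emeasure (M n) B \<le> ennreal e"
    using assms(1) by (simp add: whp_def)
  then show "\<forall>\<^sub>F n in sequentially. \<exists>B\<in>sets (M n).
     {\<omega> \<in> space (M n). \<not> Q n \<omega>} \<subseteq> B \<and> emeasure (M n) B \<le> ennreal e"
    using assms(2) by eventually_elim blast
qed

lemma whp_mono: "whp M P \<Longrightarrow> (\<And>n \<omega>. P n \<omega> \<Longrightarrow> Q n \<omega>) \<Longrightarrow> whp M Q"
  by (rule whp_mono_eventually) auto

lemma whp_conj:
  assumes "whp M P" "whp M Q"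
  shows "whp M (\<lambda>n \<omega>. P n \<omega> \<and> Q n \<omega>)"
  unfolding whp_def
proof (intro allI impI)
  fix e :: real assume e: "e > 0"
  have "\<forall>\<^sub>F n in sequentially. \<exists>B\<in>sets (M n).
     {\<omega> \<in> space (M n). \<not> P n \<omega>} \<subseteq> B \<and> emeasure (M n) B \<le> ennreal (e/2)"
    "\<forall>\<^sub>F n in sequentially. \<exists>B\<in>sets (M n).
     {\<omega> \<in> space (M n). \<not> Q n \<omega>} \<subseteq> B \<and> emeasure (M n) B \<le> ennreal (e/2)"
    using assms e by (auto simp: whp_def)
  then show "\<forall>\<^sub>F n in sequentially. \<exists>B\<in>sets (M n).
     {\<omega> \<in> space (M n). \<not> (P n \<omega> \<and> Q n \<omega>)} \<subseteq> B \<and> emeasure (M n) B \<le> ennreal e"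
  proof eventually_elim
    case (elim n)
    then obtain B C where BC: "B \<in> sets (M n)" "{\<omega> \<in> space (M n). \<not> P n \<omega>} \<subseteq> B" "emeasure (M n) B \<le> ennreal (e/2)"
      "C \<in> sets (M n)" "{\<omega> \<in> space (M n). \<not> Q n \<omega>} \<subseteq> C" "emeasure (M n) C \<le> ennreal (e/2)" by auto
    have "emeasure (M n) (B \<union> C) \<le> emeasure (M n) B + emeasure (M n) C"
      using BC by (intro emeasure_subadditive) auto
    also have "\<dots> \<le> ennreal (e/2) + ennreal (e/2)" using BC by (intro add_mono) auto
    also have "\<dots> = ennreal e" using e by (simp add: ennreal_plus[symmetric] del: ennreal_plus)
    finally show ?case using BC by (intro bexI[of _ "B \<union> C"]) auto
  qed
qed

lemma whp_True: "whp M (\<lambda>n \<omega>. True)"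
  unfolding whp_def by (intro allI impI always_eventually) (auto intro!: bexI[of _ "{}"])

lemma whp_ball:
  assumes "finite I" "\<And>i. i \<in> I \<Longrightarrow> whp M (P i)"
  shows "whp M (\<lambda>n \<omega>. \<forall>i\<in>I. P i n \<omega>)"
  using assms
proof (induction I)
  case (insert i I)
  have "whp M (\<lambda>n \<omega>. P i n \<omega> \<and> (\<forall>i\<in>I. P i n \<omega>))"
    using insert by (intro whp_conj) auto
  then show ?case by simp
qed (simp add: whp_True)

lemma whp_AE:
  assumes "\<forall>\<^sub>F n in sequentially. AE \<omega> in M n. P n \<omega>"
  shows "whp M P"
  unfolding whp_def
proof (intro allI impI)
  fix e :: real
  show "\<forall>\<^sub>F n in sequentially. \<exists>B\<in>sets (M n).
     {\<omega> \<in> space (M n). \<not> P n \<omega>} \<subseteq> B \<and> emeasure (M n) B \<le> ennreal e"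
    using assms
  proof eventually_elim
    case (elim n)
    then obtain B where "{\<omega> \<in> space (M n). \<not> P n \<omega>} \<subseteq> B" "emeasure (M n) B = 0" "B \<in> sets (M n)"
      by (rule AE_E)
    then show ?case by (intro bexI[of _ B]) auto
  qed
qed

lemma whp_measure_tendsto:
  assumes "whp M P"
  shows "(\<lambda>n. measure (M n) {\<omega> \<in> space (M n). \<not> P n \<omega>}) \<longlonglongrightarrow> 0"
proof (rule order_tendstoI)
  fix e :: real assume "e > 0"
  then have "\<forall>\<^sub>F n in sequentially. \<exists>B\<in>sets (M n).
     {\<omega> \<in> space (M n). \<not> P n \<omega>} \<subseteq> B \<and> emeasure (M n) B \<le> ennreal (e/2)"
    using assms by (simp add: whp_def)
  then show "\<forall>\<^sub>F n in sequentially. measure (M n) {\<omega> \<in> space (M n). \<not> P n \<omega>} < e"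
  proof eventually_elim
    case (elim n)
    then have "emeasure (M n) {\<omega> \<in> space (M n). \<not> P n \<omega>} \<le> ennreal (e/2)"
      by (meson emeasure_mono order_trans)
    then have "measure (M n) {\<omega> \<in> space (M n). \<not> P n \<omega>} \<le> e / 2"
      unfolding measure_def using \<open>e > 0\<close> by (intro enn2real_leI) auto
    then show ?case using \<open>e > 0\<close> by simp
  qed
next
  fix a :: real assume "a < 0"
  then show "\<forall>\<^sub>F n in sequentially. a < measure (M n) {\<omega> \<in> space (M n). \<not> P n \<omega>}"
    by (intro always_eventually allI) (rule less_le_trans[OF _ measure_nonneg])
qed

lemma whp_markov:
  assumes prob: "\<forall>n\<ge>1. prob_space (M n)"
    and int: "\<And>n. n \<ge> 1 \<Longrightarrow> integrable (M n) (Z n)"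
    and lim: "(\<lambda>n. \<integral>\<omega>. \<bar>Z n \<omega>\<bar> \<partial>M n) \<longlonglongrightarrow> 0" and "\<epsilon> > (0::real)"
  shows "whp M (\<lambda>n \<omega>. \<bar>Z n \<omega> :: real\<bar> \<le> \<epsilon>)"
  unfolding whp_def
proof (intro allI impI)
  fix e :: real assume e: "e > 0"
  have "\<forall>\<^sub>F n in sequentially. (\<integral>\<omega>. \<bar>Z n \<omega>\<bar> \<partial>M n) < e * \<epsilon>"
    using lim e \<open>\<epsilon> > 0\<close> by (intro order_tendstoD) auto
  then show "\<forall>\<^sub>F n in sequentially. \<exists>B\<in>sets (M n).
     {\<omega> \<in> space (M n). \<not> \<bar>Z n \<omega>\<bar> \<le> \<epsilon>} \<subseteq> B \<and> emeasure (M n) B \<le> ennreal e"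
    using eventually_ge_at_top[of 1]
  proof eventually_elim
    case (elim n)
    interpret prob_space "M n" using prob elim by auto
    note [measurable] = borel_measurable_integrable[OF int[OF elim(2)]]
    let ?B = "{\<omega> \<in> space (M n). \<epsilon> \<le> \<bar>Z n \<omega>\<bar>}"
    have "prob ?B \<le> (\<integral>\<omega>. \<bar>Z n \<omega>\<bar> \<partial>M n) / \<epsilon>"
      using int[OF elim(2)] \<open>\<epsilon> > 0\<close> by (intro integral_Markov_inequality_measure[where A="{}"]) auto
    also have "\<dots> \<le> e" using elim(1) \<open>\<epsilon> > 0\<close> by (simp add: field_simps)
    finally show ?case
      by (intro bexI[of _ ?B]) (auto simp: emeasure_eq_measure e less_imp_le intro!: ennreal_leI)
  qed
qed

section \<open>Sums of independent variables and arrays with i.i.d. rows\<close>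

lemma (in prob_space) expectation_sum_square_indep:
  fixes W :: "'i \<Rightarrow> 'a \<Rightarrow> real"
  assumes "finite I" "indep_vars (\<lambda>_. borel) W I"
    and "\<And>i. i \<in> I \<Longrightarrow> integrable M (\<lambda>\<omega>. (W i \<omega>)\<^sup>2)" "\<And>i. i \<in> I \<Longrightarrow> expectation (W i) = 0"
  shows "integrable M (\<lambda>\<omega>. (\<Sum>i\<in>I. W i \<omega>)\<^sup>2) \<and>
    expectation (\<lambda>\<omega>. (\<Sum>i\<in>I. W i \<omega>)\<^sup>2) = (\<Sum>i\<in>I. expectation (\<lambda>\<omega>. (W i \<omega>)\<^sup>2))"
  using assms
proof (induction I rule: finite_induct)
  case (insert i I)
  have rv [measurable]: "W j \<in> borel_measurable M" if "j \<in> insert i I" for j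
    using insert.prems(1) that by (auto simp: indep_vars_def)
  have I: "indep_vars (\<lambda>_. borel) W I" using insert.prems(1) by (rule indep_vars_subset) auto
  have IH: "integrable M (\<lambda>\<omega>. (\<Sum>i\<in>I. W i \<omega>)\<^sup>2)"
    "expectation (\<lambda>\<omega>. (\<Sum>i\<in>I. W i \<omega>)\<^sup>2) = (\<Sum>i\<in>I. expectation (\<lambda>\<omega>. (W i \<omega>)\<^sup>2))"
    using insert.IH[OF I] insert.prems by auto
  have intW: "integrable M (W j)" if "j \<in> insert i I" for j
    using square_integrable_imp_integrable[OF rv[OF that]] insert.prems that by auto
  have ind: "indep_var borel (W i) borel (\<lambda>\<omega>. \<Sum>i\<in>I. W i \<omega>)"
    using insert by (intro indep_vars_sum) auto
  have intS: "integrable M (\<lambda>\<omega>. \<Sum>i\<in>I. W i \<omega>)" using intW by auto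
  have cross: "integrable M (\<lambda>\<omega>. W i \<omega> * (\<Sum>i\<in>I. W i \<omega>))"
    "expectation (\<lambda>\<omega>. W i \<omega> * (\<Sum>i\<in>I. W i \<omega>)) = 0"
    using indep_var_integrable[OF ind intW intS] indep_var_lebesgue_integral[OF ind intW intS] insert.prems
    by auto
  have eq: "(\<Sum>i\<in>insert i I. W i \<omega>)\<^sup>2 = (W i \<omega>)\<^sup>2 + 2 * (W i \<omega> * (\<Sum>i\<in>I. W i \<omega>)) + (\<Sum>i\<in>I. W i \<omega>)\<^sup>2" for \<omega>
    using insert.hyps by (simp add: power2_eq_square algebra_simps)
  show ?case unfolding eq using insert IH cross by auto
qed simp

text \<open>The law \<open>N\<close> is the same for all rows, but nothing relates different rows to
  each other. Row 0 is unconstrained, and \<open>M 0\<close> need not even be a probability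
  space.\<close>

definition iid_array ::
    "(nat \<Rightarrow> 'a measure) \<Rightarrow> (nat \<Rightarrow> nat \<Rightarrow> 'a \<Rightarrow> 'b::topological_space) \<Rightarrow> 'b measure \<Rightarrow> bool" where
  "iid_array M Y N \<longleftrightarrow> (\<forall>n\<ge>1. prob_space (M n) \<and>
     prob_space.indep_vars (M n) (\<lambda>_. borel) (Y n) {1..n} \<and>
     (\<forall>i\<in>{1..n}. distr (M n) borel (Y n i) = N))"

context
  fixes M :: "nat \<Rightarrow> 'a measure" and Y :: "nat \<Rightarrow> nat \<Rightarrow> 'a \<Rightarrow> 'b::topological_space" and N
  assumes iid: "iid_array M Y N"
begin

lemma iid_prob: "\<forall>n\<ge>1. prob_space (M n)"
  using iid by (auto simp: iid_array_def)

lemma iid_measurable: "i \<in> {1..n} \<Longrightarrow> Y n i \<in> borel_measurable (M n)"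
proof -
  assume i: "i \<in> {1..n}"
  then interpret prob_space "M n" using iid_prob by auto
  have "indep_vars (\<lambda>_. borel) (Y n) {1..n}" using iid i by (auto simp: iid_array_def)
  then show ?thesis using i by (auto simp: indep_vars_def)
qed

lemma iid_sets: "sets N = sets borel"
  using iid unfolding iid_array_def by (metis atLeastAtMost_iff order_refl sets_distr)

lemma iid_prob_law: "prob_space N"
proof -
  interpret prob_space "M 1" using iid_prob by auto
  have "distr (M 1) borel (Y 1 1) = N" using iid by (auto simp: iid_array_def)
  then show ?thesis using prob_space_distr[OF iid_measurable[of 1 1]] by auto
qed

lemma iid_integral:
  fixes g :: "'b \<Rightarrow> 'c::{banach, second_countable_topology}"
  assumes "i \<in> {1..n}" "g \<in> borel_measurable borel"
  shows "integrable (M n) (\<lambda>\<omega>. g (Y n i \<omega>)) \<longleftrightarrow> integrable N g"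
    "(\<integral>\<omega>. g (Y n i \<omega>) \<partial>M n) = (\<integral>y. g y \<partial>N)"
proof -
  have N: "distr (M n) borel (Y n i) = N" using iid assms by (auto simp: iid_array_def)
  show "integrable (M n) (\<lambda>\<omega>. g (Y n i \<omega>)) \<longleftrightarrow> integrable N g"
    "(\<integral>\<omega>. g (Y n i \<omega>) \<partial>M n) = (\<integral>y. g y \<partial>N)"
    unfolding N[symmetric] using iid_measurable[OF assms(1)] assms(2)
    by (auto simp: integrable_distr_eq integral_distr)
qed

lemma iid_compose:
  assumes "g \<in> borel \<rightarrow>\<^sub>M borel"
  shows "iid_array M (\<lambda>n i \<omega>. g (Y n i \<omega>)) (distr N borel g)"
  unfolding iid_array_def
proof (intro allI impI conjI ballI)
  fix n :: nat assume n: "n \<ge> 1"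
  then interpret prob_space "M n" using iid_prob by auto
  show "prob_space (M n)" by (rule prob_space_axioms)
  show "indep_vars (\<lambda>_. borel) (\<lambda>i \<omega>. g (Y n i \<omega>)) {1..n}"
  proof -
    have "indep_vars (\<lambda>_. borel) (Y n) {1..n}" using iid n by (simp add: iid_array_def)
    from indep_vars_compose2[OF this, of "\<lambda>_. g" "\<lambda>_. borel"] show ?thesis using assms by simp
  qed
  fix i assume i: "i \<in> {1..n}"
  have "distr (M n) borel (Y n i) = N" using iid i n by (auto simp: iid_array_def)
  then show "distr (M n) borel (\<lambda>\<omega>. g (Y n i \<omega>)) = distr N borel g"
    using distr_distr[OF assms iid_measurable[OF i]] by (simp add: comp_def)
qed

lemma iid_sum_square:
  fixes g :: "'b \<Rightarrow> real"
  assumes [measurable]: "g \<in> borel_measurable borel"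
    and "integrable N (\<lambda>y. (g y)\<^sup>2)" "(\<integral>y. g y \<partial>N) = 0" and n: "n \<ge> 1"
  shows "integrable (M n) (\<lambda>\<omega>. (\<Sum>i=1..n. g (Y n i \<omega>))\<^sup>2)"
    "(\<integral>\<omega>. (\<Sum>i=1..n. g (Y n i \<omega>))\<^sup>2 \<partial>M n) = real n * (\<integral>y. (g y)\<^sup>2 \<partial>N)"
proof -
  interpret prob_space "M n" using iid_prob n by auto
  have ind: "indep_vars (\<lambda>_. borel) (\<lambda>i \<omega>. g (Y n i \<omega>)) {1..n}"
    using iid_compose[OF assms(1)] n by (auto simp: iid_array_def)
  have g2: "(\<lambda>y. (g y)\<^sup>2) \<in> borel_measurable borel" by measurable
  have *: "integrable (M n) (\<lambda>\<omega>. (\<Sum>i=1..n. g (Y n i \<omega>))\<^sup>2) \<and>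
    expectation (\<lambda>\<omega>. (\<Sum>i=1..n. g (Y n i \<omega>))\<^sup>2) = (\<Sum>i=1..n. expectation (\<lambda>\<omega>. (g (Y n i \<omega>))\<^sup>2))"
    using ind assms iid_integral[OF _ assms(1)] iid_integral[OF _ g2]
    by (intro expectation_sum_square_indep) auto
  then show "integrable (M n) (\<lambda>\<omega>. (\<Sum>i=1..n. g (Y n i \<omega>))\<^sup>2)" by simp
  show "expectation (\<lambda>\<omega>. (\<Sum>i=1..n. g (Y n i \<omega>))\<^sup>2) = real n * (\<integral>y. (g y)\<^sup>2 \<partial>N)"
    using * iid_integral(2)[OF _ g2, of _ n] by simp
qed

text \<open>Truncation: the bounded part is handled by its variance, the tail by its small first
  absolute moment. Second moments of \<open>g\<close> must not be required, because the lemma is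
  used for \<open>norm y ^ 4\<close>.\<close>

lemma iid_weak_law_L1:
  fixes g :: "'b \<Rightarrow> real"
  assumes [measurable]: "g \<in> borel_measurable borel" and int: "integrable N g"
  shows "(\<lambda>n. \<integral>\<omega>. \<bar>(\<Sum>i=1..n. g (Y n i \<omega>)) / real n - (\<integral>y. g y \<partial>N)\<bar> \<partial>M n) \<longlonglongrightarrow> 0"
proof (rule order_tendstoI)
  fix e :: real assume e: "e > 0"
  interpret N: prob_space N by (rule iid_prob_law)
  have mN: "f \<in> borel_measurable N \<longleftrightarrow> f \<in> borel_measurable borel" for f :: "'b \<Rightarrow> real"
    by (simp add: measurable_cong_sets[OF iid_sets refl])
  have "(\<lambda>k. \<integral>y. \<bar>g y\<bar> * indicator {real k<..} \<bar>g y\<bar> \<partial>N) \<longlonglongrightarrow> (\<integral>y. 0 \<partial>N)"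
  proof (rule integral_dominated_convergence[where w="\<lambda>y. \<bar>g y\<bar>"])
    have "(\<lambda>k. \<bar>g y\<bar> * indicator {real k<..} \<bar>g y\<bar>) \<longlonglongrightarrow> 0" for y
    proof (rule tendsto_eventually)
      obtain k0 where "\<bar>g y\<bar> \<le> real k0" using real_arch_simple by blast
      then show "\<forall>\<^sub>F k in sequentially. \<bar>g y\<bar> * indicator {real k<..} \<bar>g y\<bar> = 0"
        by (intro eventually_sequentiallyI[of k0]) (auto simp: indicator_def)
    qed
    then show "AE y in N. (\<lambda>k. \<bar>g y\<bar> * indicator {real k<..} \<bar>g y\<bar>) \<longlonglongrightarrow> 0" by simp
  qed (use int in \<open>auto simp: mN indicator_def\<close>)
  then have "\<forall>\<^sub>F k in sequentially. (\<integral>y. \<bar>g y\<bar> * indicator {real k<..} \<bar>g y\<bar> \<partial>N) < e / 8"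
    using e by (intro order_tendstoD) auto
  \<comment> \<open>The tail enters twice, through the sample average of \<open>g2\<close> and
    through its mean \<open>m2\<close>; hence \<open>e / 8\<close>.\<close>
  then obtain k where k: "(\<integral>y. \<bar>g y\<bar> * indicator {real k<..} \<bar>g y\<bar> \<partial>N) < e / 8"
    using eventually_happens' sequentially_bot by blast
  define g1 g2 where "g1 = (\<lambda>y. g y * indicator {..real k} \<bar>g y\<bar>)" and "g2 = (\<lambda>y. g y * indicator {real k<..} \<bar>g y\<bar>)"
  have [measurable]: "g1 \<in> borel_measurable borel" "g2 \<in> borel_measurable borel"
    by (auto simp: g1_def g2_def)
  have g12: "g y = g1 y + g2 y" for y by (auto simp: g1_def g2_def indicator_def)
  have int1: "integrable N g1" "integrable N g2"
    by (rule Bochner_Integration.integrable_bound[OF int]; auto simp: mN g1_def g2_def indicator_def)+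
  define m1 m2 where "m1 = (\<integral>y. g1 y \<partial>N)" and "m2 = (\<integral>y. g2 y \<partial>N)"
  have m: "(\<integral>y. g y \<partial>N) = m1 + m2"
    using int1 by (simp add: g12 m1_def m2_def)
  have absg2: "(\<integral>y. \<bar>g2 y\<bar> \<partial>N) < e / 8" using k by (simp add: g2_def abs_mult)
  define h where "h = (\<lambda>y. g1 y - m1)"
  have [measurable]: "h \<in> borel_measurable borel" by (auto simp: h_def)
  have m1b: "\<bar>m1\<bar> \<le> real k"
  proof -
    have "\<bar>m1\<bar> \<le> (\<integral>y. \<bar>g1 y\<bar> \<partial>N)" unfolding m1_def by (rule integral_abs_bound)
    also have "\<dots> \<le> (\<integral>y. real k \<partial>N)"
      using int1 by (intro integral_mono) (auto simp: g1_def indicator_def)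
    finally show ?thesis by (simp add: N.prob_space)
  qed
  have "\<bar>g1 y\<bar> \<le> real k" for y by (auto simp: g1_def indicator_def)
  then have hb: "\<bar>h y\<bar> \<le> 2 * real k" for y
    using m1b abs_triangle_ineq4[of "g1 y" m1] unfolding h_def by (metis add_mono mult_2 order_trans)
  have h2b: "(h y)\<^sup>2 \<le> (2 * real k)\<^sup>2" for y
    using power_mono[OF hb, of y 2] by simp
  have inth2: "integrable N (\<lambda>y. (h y)\<^sup>2)"
    using h2b by (intro N.integrable_const_bound[of _ "(2 * real k)\<^sup>2"]) (auto simp: mN)
  have inth: "integrable N h" using int1 by (simp add: h_def)
  have h0: "(\<integral>y. h y \<partial>N) = 0" using int1 by (simp add: h_def m1_def N.prob_space)
  define V where "V = (\<integral>y. (h y)\<^sup>2 \<partial>N)"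
  have main: "(\<integral>\<omega>. \<bar>(\<Sum>i=1..n. g (Y n i \<omega>)) / real n - (\<integral>y. g y \<partial>N)\<bar> \<partial>M n) \<le> e / 4 + (e / 4 + V / real n / (e / 4))"
    if n: "n \<ge> 1" for n
  proof -
    interpret prob_space "M n" using iid_prob n by auto
    define A where "A = (\<lambda>\<omega>. (\<Sum>i=1..n. h (Y n i \<omega>)) / real n)"
    note rv [measurable] = iid_measurable[of _ n]
    have intA2: "integrable (M n) (\<lambda>\<omega>. (A \<omega>)\<^sup>2)" "expectation (\<lambda>\<omega>. (A \<omega>)\<^sup>2) = V / real n"
      using iid_sum_square[OF _ inth2 h0 n] n
      by (simp_all add: A_def power_divide V_def power2_eq_square)
    have intg2: "integrable (M n) (\<lambda>\<omega>. \<bar>g2 (Y n i \<omega>)\<bar>)"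
      "expectation (\<lambda>\<omega>. \<bar>g2 (Y n i \<omega>)\<bar>) = (\<integral>y. \<bar>g2 y\<bar> \<partial>N)" if "i \<in> {1..n}" for i
      using iid_integral[OF that, of "\<lambda>y. \<bar>g2 y\<bar>"] int1 by auto
    have m2: "\<bar>m2\<bar> \<le> (\<integral>y. \<bar>g2 y\<bar> \<partial>N)" unfolding m2_def by (rule integral_abs_bound)
    have bnd: "\<bar>(\<Sum>i=1..n. g (Y n i \<omega>)) / real n - (\<integral>y. g y \<partial>N)\<bar>
      \<le> (e / 4 + (A \<omega>)\<^sup>2 / (e / 4)) + ((\<Sum>i=1..n. \<bar>g2 (Y n i \<omega>)\<bar>) / real n + \<bar>m2\<bar>)" for \<omega>
    proof -
      have sg: "(\<Sum>i=1..n. g (Y n i \<omega>)) = (\<Sum>i=1..n. g1 (Y n i \<omega>)) + (\<Sum>i=1..n. g2 (Y n i \<omega>))"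
        by (simp add: g12 sum.distrib)
      have "(\<Sum>i=1..n. g (Y n i \<omega>)) / real n - (\<integral>y. g y \<partial>N) = A \<omega> + ((\<Sum>i=1..n. g2 (Y n i \<omega>)) / real n - m2)"
        using n unfolding sg m A_def h_def by (simp add: sum_subtractf add_divide_distrib diff_divide_distrib)
      moreover have "\<bar>(\<Sum>i=1..n. g2 (Y n i \<omega>)) / real n\<bar> \<le> (\<Sum>i=1..n. \<bar>g2 (Y n i \<omega>)\<bar>) / real n"
        by (simp add: abs_divide divide_right_mono sum_abs)
      \<comment> \<open>Trades the absolute value for a square, whose expectation is
        \<open>V / n\<close>, at the price of a constant \<open>e / 4\<close>.\<close>
      moreover have "\<bar>A \<omega>\<bar> \<le> e / 4 + (A \<omega>)\<^sup>2 / (e / 4)"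
      proof (cases "\<bar>A \<omega>\<bar> \<le> e / 4")
        case True then show ?thesis using e by (intro order_trans[OF True]) simp
      next
        case False
        then have "\<bar>A \<omega>\<bar> * (e / 4) \<le> \<bar>A \<omega>\<bar> * \<bar>A \<omega>\<bar>" by (intro mult_left_mono) auto
        then have "\<bar>A \<omega>\<bar> \<le> (A \<omega>)\<^sup>2 / (e / 4)" using e by (simp add: field_simps power2_eq_square)
        then show ?thesis using e by simp
      qed
      ultimately show ?thesis by linarith
    qed
    have "(\<integral>\<omega>. \<bar>(\<Sum>i=1..n. g (Y n i \<omega>)) / real n - (\<integral>y. g y \<partial>N)\<bar> \<partial>M n)
      \<le> (\<integral>\<omega>. (e / 4 + (A \<omega>)\<^sup>2 / (e / 4)) + ((\<Sum>i=1..n. \<bar>g2 (Y n i \<omega>)\<bar>) / real n + \<bar>m2\<bar>) \<partial>M n)"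
    proof (intro integral_mono bnd)
      show "integrable (M n) (\<lambda>\<omega>. \<bar>(\<Sum>i=1..n. g (Y n i \<omega>)) / real n - (\<integral>y. g y \<partial>N)\<bar>)"
        using int iid_integral(1)[OF _ assms(1), of _ n]
        by (intro integrable_abs Bochner_Integration.integrable_diff Bochner_Integration.integrable_divide
            Bochner_Integration.integrable_sum integrable_const) auto
      show "integrable (M n) (\<lambda>\<omega>. (e / 4 + (A \<omega>)\<^sup>2 / (e / 4)) + ((\<Sum>i=1..n. \<bar>g2 (Y n i \<omega>)\<bar>) / real n + \<bar>m2\<bar>))"
        by (intro Bochner_Integration.integrable_add integrable_const Bochner_Integration.integrable_divide
            Bochner_Integration.integrable_sum intA2 intg2)
    qed
    also have "\<dots> = (e / 4 + (V / real n) / (e / 4)) + ((\<Sum>i=1..n. \<integral>y. \<bar>g2 y\<bar> \<partial>N) / real n + \<bar>m2\<bar>)"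
    proof -
      have "integrable (M n) (\<lambda>\<omega>. \<Sum>i=1..n. \<bar>g2 (Y n i \<omega>)\<bar>)"
        "expectation (\<lambda>\<omega>. \<Sum>i=1..n. \<bar>g2 (Y n i \<omega>)\<bar>) = (\<Sum>i=1..n. \<integral>y. \<bar>g2 y\<bar> \<partial>N)"
        using intg2 by auto
      then show ?thesis using intA2 by (simp add: prob_space del: sum_constant)
    qed
    also have "(\<Sum>i=1..n. \<integral>y. \<bar>g2 y\<bar> \<partial>N) / real n = (\<integral>y. \<bar>g2 y\<bar> \<partial>N)" using n by simp
    finally show ?thesis using m2 absg2 by linarith
  qed
  have "(\<lambda>n. e / 4 + (e / 4 + V / real n / (e / 4))) \<longlonglongrightarrow> e / 4 + (e / 4 + 0 / (e / 4))"
    using e by (intro tendsto_add tendsto_const tendsto_divide lim_const_over_n) auto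
  then have "\<forall>\<^sub>F n in sequentially. e / 4 + (e / 4 + V / real n / (e / 4)) < e"
    by (rule order_tendstoD(2)) (use e in simp)
  then show "\<forall>\<^sub>F n in sequentially. (\<integral>\<omega>. \<bar>(\<Sum>i=1..n. g (Y n i \<omega>)) / real n - (\<integral>y. g y \<partial>N)\<bar> \<partial>M n) < e"
    using eventually_ge_at_top[of 1] by eventually_elim (rule le_less_trans[OF main])
next
  fix a :: real assume "a < 0"
  then show "\<forall>\<^sub>F n in sequentially. a < (\<integral>\<omega>. \<bar>(\<Sum>i=1..n. g (Y n i \<omega>)) / real n - (\<integral>y. g y \<partial>N)\<bar> \<partial>M n)"
    by (intro always_eventually allI) (rule less_le_trans[OF _ Bochner_Integration.integral_nonneg], auto)
qed

lemma iid_weak_law: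
  fixes g :: "'b \<Rightarrow> real"
  assumes [measurable]: "g \<in> borel_measurable borel" and int: "integrable N g" and "\<epsilon> > 0"
  shows "whp M (\<lambda>n \<omega>. \<bar>(\<Sum>i=1..n. g (Y n i \<omega>)) / real n - (\<integral>y. g y \<partial>N)\<bar> \<le> \<epsilon>)"
proof (rule whp_markov[OF iid_prob _ iid_weak_law_L1[OF assms(1,2)] assms(3)])
  fix n :: nat assume "n \<ge> 1"
  then interpret prob_space "M n" using iid_prob by auto
  show "integrable (M n) (\<lambda>\<omega>. (\<Sum>i=1..n. g (Y n i \<omega>)) / real n - (\<integral>y. g y \<partial>N))"
    using int iid_integral(1)[OF _ assms(1), of _ n]
    by (intro Bochner_Integration.integrable_diff Bochner_Integration.integrable_divide
        Bochner_Integration.integrable_sum integrable_const) auto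
qed

lemma iid_weak_law_vec:
  fixes g :: "'b \<Rightarrow> 'c::euclidean_space"
  assumes [measurable]: "g \<in> borel_measurable borel" and int: "integrable N g" and "\<epsilon> > 0"
  shows "whp M (\<lambda>n \<omega>. norm ((1 / real n) *\<^sub>R (\<Sum>i=1..n. g (Y n i \<omega>)) - (\<integral>y. g y \<partial>N)) \<le> \<epsilon>)"
proof -
  define d where "d = \<epsilon> / real DIM('c)"
  have d: "d > 0" using assms by (simp add: d_def)
  have "whp M (\<lambda>n \<omega>. \<forall>b\<in>Basis. \<bar>(\<Sum>i=1..n. g (Y n i \<omega>) \<bullet> b) / real n - (\<integral>y. g y \<bullet> b \<partial>N)\<bar> \<le> d)"
    using int d by (intro whp_ball iid_weak_law) auto
  then show ?thesis
  proof (rule whp_mono)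
    fix n \<omega> assume *: "\<forall>b\<in>Basis. \<bar>(\<Sum>i=1..n. g (Y n i \<omega>) \<bullet> b) / real n - (\<integral>y. g y \<bullet> b \<partial>N)\<bar> \<le> d"
    have "norm ((1 / real n) *\<^sub>R (\<Sum>i=1..n. g (Y n i \<omega>)) - (\<integral>y. g y \<partial>N))
      \<le> (\<Sum>b\<in>Basis. \<bar>((1 / real n) *\<^sub>R (\<Sum>i=1..n. g (Y n i \<omega>)) - (\<integral>y. g y \<partial>N)) \<bullet> b\<bar>)"
      by (rule norm_le_l1)
    also have "\<dots> \<le> (\<Sum>b\<in>(Basis :: 'c set). d)"
      using * int by (intro sum_mono) (auto simp: inner_diff_left inner_sum_left)
    also have "\<dots> = \<epsilon>" by (simp add: d_def)
    finally show "norm ((1 / real n) *\<^sub>R (\<Sum>i=1..n. g (Y n i \<omega>)) - (\<integral>y. g y \<partial>N)) \<le> \<epsilon>" .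
  qed
qed

end

section \<open>The chi-square limit\<close>

lemma char_distr_divide:
  assumes [measurable]: "Z \<in> borel_measurable M"
  shows "char (distr M borel (\<lambda>\<omega>. Z \<omega> / c)) t = char (distr M borel Z) (t / c)"
  by (simp add: char_def integral_distr)

text \<open>The characteristic function of a row sum is a power of that of \<nu> and so forgets the
  space it lives on. The classical theorem for one i.i.d. sequence on an infinite product space
  therefore transfers to the array.\<close>

lemma iid_char_clt:
  fixes W :: "nat \<Rightarrow> nat \<Rightarrow> 'a \<Rightarrow> real"
  assumes iid: "iid_array M W \<nu>" and sq: "integrable \<nu> (\<lambda>x. x\<^sup>2)" and mean: "(\<integral>x. x \<partial>\<nu>) = 0"
  shows "(\<lambda>n. char (distr (M n) borel (\<lambda>\<omega>. (\<Sum>i=1..n. W n i \<omega>) / sqrt (real n))) t)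
    \<longlonglongrightarrow> complex_of_real (exp (- ((\<integral>x. x\<^sup>2 \<partial>\<nu>) * t\<^sup>2) / 2))"
proof -
  define s where "s = (\<integral>x. x\<^sup>2 \<partial>\<nu>)"
  interpret \<nu>: prob_space \<nu> by (rule iid_prob_law[OF iid])
  interpret \<nu>: real_distribution \<nu> by standard (rule iid_sets[OF iid])
  have row: "char (distr (M n) borel (\<lambda>\<omega>. (\<Sum>i=1..n. W n i \<omega>) / sqrt (real n))) t = char \<nu> (t / sqrt (real n)) ^ n"
    if n: "n \<ge> 1" for n t
  proof -
    interpret prob_space "M n" using iid_prob[OF iid] n by auto
    note [measurable] = iid_measurable[OF iid, of _ n]
    have "indep_vars (\<lambda>_. borel) (W n) {1..n}" using iid n by (simp add: iid_array_def)
    then have "char (distr (M n) borel (\<lambda>\<omega>. \<Sum>i=1..n. W n i \<omega>)) u = (\<Prod>i=1..n. char (distr (M n) borel (W n i)) u)" for u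
      by (rule char_distr_sum)
    moreover have "distr (M n) borel (W n i) = \<nu>" if "i \<in> {1..n}" for i
      using iid n that by (simp add: iid_array_def)
    ultimately show ?thesis by (subst char_distr_divide) auto
  qed
  have lim: "(\<lambda>n. char \<nu> (t / sqrt (real n)) ^ n) \<longlonglongrightarrow> complex_of_real (exp (- (s * t\<^sup>2) / 2))"
  \<comment> \<open>The degenerate case really occurs: it covers the linear combination all of whose
    coefficients are zero.\<close>
  proof (cases "s = 0")
    case True
    have "AE x in \<nu>. x\<^sup>2 = 0"
      using True sq by (subst (asm) s_def, subst (asm) integral_nonneg_eq_0_iff_AE) auto
    then have "AE x in \<nu>. iexp (u * x) = 1" for u by eventually_elim simp
    then have "char \<nu> u = (\<integral>x. 1 \<partial>\<nu>)" for u
      unfolding char_def by (intro integral_cong_AE) auto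
    then show ?thesis using True by (simp add: \<nu>.prob_space[simplified])
  next
    case False
    then have s: "s > 0" unfolding s_def by (simp add: order_less_le)
    define P where "P = PiM UNIV (\<lambda>_::nat. \<nu>)"
    interpret P: product_prob_space "\<lambda>_::nat. \<nu>" UNIV ..
    interpret P: prob_space P unfolding P_def by (rule P.prob_space_axioms)
    define X where "X = (\<lambda>(i::nat) (\<omega>::nat \<Rightarrow> real). \<omega> i)"
    have X[measurable]: "X i \<in> borel_measurable P" for i
      unfolding X_def P_def by (subst measurable_cong_sets[OF refl \<nu>.events_eq_borel[symmetric]]) measurable
    have dX: "distr P borel (X i) = \<nu>" for i
      using distr_PiM_component[of UNIV "\<lambda>_. \<nu>" i] \<nu>.prob_space_axioms
      by (simp add: X_def P_def cong: distr_cong)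
    have setsP: "sets P = sets (PiM UNIV (\<lambda>_. borel))"
      unfolding P_def by (intro sets_PiM_cong) auto
    have "distr P (PiM UNIV (\<lambda>_. borel)) (\<lambda>x. \<lambda>i\<in>UNIV. X i x) = distr P P (\<lambda>x. x)"
      by (rule distr_cong) (auto simp: X_def setsP)
    also have "\<dots> = P" by simp
    also have "P = PiM UNIV (\<lambda>i. distr P borel (X i))" by (simp only: dX) (simp only: P_def)
    finally have ind: "P.indep_vars (\<lambda>_. borel) X UNIV"
      by (subst P.indep_vars_iff_distr_eq_PiM) auto
    have intX: "integrable P (\<lambda>\<omega>. (X i \<omega>)\<^sup>2)" "P.expectation (X i) = 0" "P.expectation (\<lambda>\<omega>. (X i \<omega>)\<^sup>2) = s" for i
    proof -
      show "integrable P (\<lambda>\<omega>. (X i \<omega>)\<^sup>2)"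
        using sq by (subst (asm) dX[of i, symmetric], subst (asm) integrable_distr_eq) auto
      show "P.expectation (X i) = 0"
        using mean by (subst (asm) dX[of i, symmetric], subst (asm) integral_distr) auto
      show "P.expectation (\<lambda>\<omega>. (X i \<omega>)\<^sup>2) = s"
        unfolding s_def by (subst dX[of i, symmetric], subst integral_distr) auto
    qed
    have "weak_conv_m (\<lambda>n. distr P borel (\<lambda>x. (\<Sum>i<n. X i x) / sqrt (real n * (sqrt s)\<^sup>2))) std_normal_distribution"
      by (rule P.central_limit_theorem_zero_mean[OF ind]) (use s intX dX in auto)
    \<comment> \<open>Evaluation at \<open>sqrt s * t\<close> undoes the division by the standard
      deviation.\<close>
    then have "(\<lambda>n. char (distr P borel (\<lambda>x. (\<Sum>i<n. X i x) / sqrt (real n * (sqrt s)\<^sup>2))) (sqrt s * t))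
       \<longlonglongrightarrow> char std_normal_distribution (sqrt s * t)"
      by (intro levy_continuity1 real_dist_normal_dist) auto
    moreover have "char (distr P borel (\<lambda>x. (\<Sum>i<n. X i x) / sqrt (real n * (sqrt s)\<^sup>2))) (sqrt s * t)
      = char \<nu> (t / sqrt (real n)) ^ n" for n
    proof -
      have "char (distr P borel (\<lambda>x. \<Sum>i<n. X i x)) u = char \<nu> u ^ n" for u
        using P.char_distr_sum[OF P.indep_vars_subset[OF ind], of "{..<n}" u] by (simp add: dX)
      then show ?thesis
        using s by (subst char_distr_divide) (auto simp: real_sqrt_mult)
    qed
    ultimately show ?thesis
      using s by (simp add: char_std_normal_distribution power_mult_distrib)
  qed
  show ?thesis
    unfolding s_def[symmetric]
    by (rule Lim_transform_eventually[OF lim]) (use row in \<open>auto intro!: eventually_sequentiallyI[of 1]\<close>)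
qed

lemma continuous_cts_step: "x < y \<Longrightarrow> continuous_on UNIV (cts_step x y)"
  by (intro uniformly_continuous_imp_continuous cts_step_uniformly_continuous)

text \<open>By the Weierstrass theorem the functions \<open>exp (- k x)\<close> are total among continuous functions of \<open>exp (- x)\<close>.\<close>

lemma weak_conv_m_laplace:
  fixes \<mu> :: "nat \<Rightarrow> real measure"
  assumes \<mu>: "\<And>n. real_distribution (\<mu> n)" and \<nu>: "real_distribution \<nu>"
    and pos: "\<And>n. AE x in \<mu> n. 0 \<le> x" "AE x in \<nu>. 0 \<le> x"
    and lim: "\<And>k::nat. (\<lambda>n. \<integral>x. exp (- (real k * x)) \<partial>\<mu> n) \<longlonglongrightarrow> (\<integral>x. exp (- (real k * x)) \<partial>\<nu>)"
  shows "weak_conv_m \<mu> \<nu>"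
proof (rule integral_cts_step_conv_imp_weak_conv[OF \<mu> \<nu>])
  fix x y :: real assume xy: "x < y"
  \<comment> \<open>The step function in the variable \<open>exp (- w)\<close>. The maximum keeps
    the logarithm away from 0 and changes nothing, since \<open>cts_step x y\<close> vanishes from
    \<open>y\<close> on.\<close>
  define f where "f = (\<lambda>z. cts_step x y (- ln (max z (exp (- y)))))"
  have "continuous_on {0..1} f"
  proof -
    have "continuous_on {0..1} (\<lambda>z. - ln (max z (exp (- y))))"
      by (intro continuous_intros) (auto simp: max_def)
    from continuous_on_compose2[OF continuous_cts_step[OF xy] this] show ?thesis
      unfolding f_def by auto
  qed
  have f: "f (exp (- w)) = cts_step x y w" for w
    using xy by (auto simp: f_def max_def cts_step_def)
  show "(\<lambda>n. integral\<^sup>L (\<mu> n) (cts_step x y)) \<longlonglongrightarrow> integral\<^sup>L \<nu> (cts_step x y)"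
  proof (rule LIMSEQ_I)
    fix e :: real assume e: "e > 0"
    obtain g where "real_polynomial_function g" and g: "\<And>z. z \<in> {0..1} \<Longrightarrow> \<bar>f z - g z\<bar> < e / 3"
      using Stone_Weierstrass_real_polynomial_function[of "{0..1}" f "e / 3"] \<open>continuous_on {0..1} f\<close> e by auto
    then obtain a m where ga: "g = (\<lambda>z. \<Sum>i\<le>m. a i * z ^ i)"
      by (auto simp: real_polynomial_function_iff_sum)
    have ge: "g (exp (- w)) = (\<Sum>i\<le>m. a i * exp (- (real i * w)))" for w
      by (simp add: ga exp_of_nat_mult[symmetric])
    have approx: "integrable N (\<lambda>w. exp (- (real i * w)))"
      "\<bar>integral\<^sup>L N (cts_step x y) - (\<Sum>i\<le>m. a i * (\<integral>w. exp (- (real i * w)) \<partial>N))\<bar> \<le> e / 3"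
      if N: "real_distribution N" "AE w in N. 0 \<le> w" for N i
    proof -
      interpret real_distribution N by fact
      have int: "integrable N (\<lambda>w. exp (- (real i * w)))" for i
        using N(2) by (intro integrable_const_bound[of _ 1]) (auto elim!: eventually_mono)
      show "integrable N (\<lambda>w. exp (- (real i * w)))" by (rule int)
      have intg: "integrable N (\<lambda>w. g (exp (- w)))" using int by (simp add: ge)
      have ig: "(\<Sum>i\<le>m. a i * (\<integral>w. exp (- (real i * w)) \<partial>N)) = (\<integral>w. g (exp (- w)) \<partial>N)"
        using int by (simp add: ge)
      have "\<bar>integral\<^sup>L N (cts_step x y) - (\<integral>w. g (exp (- w)) \<partial>N)\<bar> = \<bar>\<integral>w. cts_step x y w - g (exp (- w)) \<partial>N\<bar>"
        using intg integrable_cts_step[OF xy] by simp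
      also have "\<dots> \<le> (\<integral>w. \<bar>cts_step x y w - g (exp (- w))\<bar> \<partial>N)" by (rule integral_abs_bound)
      also have "\<dots> \<le> (\<integral>w. e / 3 \<partial>N)"
      proof (rule integral_mono_AE)
        show "AE w in N. \<bar>cts_step x y w - g (exp (- w))\<bar> \<le> e / 3"
          using N(2)
        proof eventually_elim
          case (elim w)
          then show ?case using g[of "exp (- w)"] by (simp add: f)
        qed
      qed (use intg integrable_cts_step[OF xy] in auto)
      finally show "\<bar>integral\<^sup>L N (cts_step x y) - (\<Sum>i\<le>m. a i * (\<integral>w. exp (- (real i * w)) \<partial>N))\<bar> \<le> e / 3"
        using prob_space by (simp add: ig)
    qed
    have "(\<lambda>n. \<Sum>i\<le>m. a i * (\<integral>w. exp (- (real i * w)) \<partial>\<mu> n)) \<longlonglongrightarrow> (\<Sum>i\<le>m. a i * (\<integral>w. exp (- (real i * w)) \<partial>\<nu>))"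
      by (intro tendsto_intros lim)
    from LIMSEQ_D[OF this, of "e / 3"] e obtain n0 where
      n0: "\<And>n. n \<ge> n0 \<Longrightarrow> \<bar>(\<Sum>i\<le>m. a i * (\<integral>w. exp (- (real i * w)) \<partial>\<mu> n)) - (\<Sum>i\<le>m. a i * (\<integral>w. exp (- (real i * w)) \<partial>\<nu>))\<bar> < e / 3"
      by auto
    show "\<exists>n0. \<forall>n\<ge>n0. norm (integral\<^sup>L (\<mu> n) (cts_step x y) - integral\<^sup>L \<nu> (cts_step x y)) < e"
    proof (intro exI[of _ n0] allI impI)
      fix n assume "n \<ge> n0"
      from n0[OF this] approx(2)[OF \<mu> pos(1), of n] approx(2)[OF \<nu> pos(2)]
      show "norm (integral\<^sup>L (\<mu> n) (cts_step x y) - integral\<^sup>L \<nu> (cts_step x y)) < e"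
        unfolding real_norm_def by arith
    qed
  qed
qed

section \<open>The chi-square law: absence of atoms and quantiles\<close>

abbreviation std_normals :: "nat \<Rightarrow> (nat \<Rightarrow> real) measure" where
  "std_normals k \<equiv> PiM {..<k} (\<lambda>_. std_normal_distribution)"

lemma prob_space_std_normals: "prob_space (std_normals k)"
  using real_dist_normal_dist by (intro prob_space_PiM) (simp add: real_distribution_def)

lemma measurable_std_normals [measurable]: "i < k \<Longrightarrow> (\<lambda>z. z i) \<in> borel_measurable (std_normals k)"
proof -
  assume "i < k"
  then have "(\<lambda>z. z i) \<in> std_normals k \<rightarrow>\<^sub>M std_normal_distribution"
    by (intro measurable_component_singleton) simp
  then show ?thesis by (subst (asm) measurable_cong_sets[OF refl, of _ borel]) auto
qed

lemma real_distribution_chi_square: "real_distribution (chi_square k)"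
proof -
  interpret prob_space "std_normals k" by (rule prob_space_std_normals)
  show ?thesis unfolding chi_square_def by (intro real_distribution_distr) measurable
qed

lemma AE_chi_square_nonneg: "AE x in chi_square k. 0 \<le> x"
  unfolding chi_square_def by (subst AE_distr_iff) (auto intro!: sum_nonneg AE_I2)

text \<open>The level set of a nonconstant polynomial is null under a product of laws with
  densities. The factors are written as inner products with 1 to match
  \<open>line_poly_inner\<close>.\<close>

lemma chi_square_no_atoms:
  assumes "k \<ge> 1"
  shows "measure (chi_square k) {c} = 0"
proof -
  interpret prob_space "std_normals k" by (rule prob_space_std_normals)
  \<comment> \<open>A point off the level set: all ones give the value \<open>k\<close>, which
    differs from 0, when \<open>c = 0\<close>; otherwise the origin works.\<close>
  define a :: real where "a = (if c = 0 then 1 else 0)"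
  have "AE z in std_normals k. (\<Sum>i<k. (z i \<bullet> 1) * (z i \<bullet> 1)) - c \<noteq> 0"
  proof (rule AE_PiM_line_poly_nonzero[where z="\<lambda>i\<in>{..<k}. a"])
    show "sigma_finite_measure std_normal_distribution"
      using real_dist_normal_dist by (auto simp: real_distribution_def prob_space_imp_sigma_finite)
    show "absolutely_continuous lborel std_normal_distribution"
      by (rule absolutely_continuousI_density) auto
    show "line_poly (\<lambda>z. (\<Sum>i<k. (z i \<bullet> 1) * (z i \<bullet> (1::real))) - c)"
      by (intro line_poly_intros)
    show "(\<Sum>i<k. ((\<lambda>i\<in>{..<k}. a) i \<bullet> 1) * ((\<lambda>i\<in>{..<k}. a) i \<bullet> 1)) - c \<noteq> 0"
      using assms by (auto simp: a_def)
  qed auto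
  then have "AE z in std_normals k. (\<Sum>i<k. (z i)\<^sup>2) \<notin> {c}"
    by eventually_elim (auto simp: power2_eq_square)
  then have "prob {z \<in> space (std_normals k). (\<Sum>i<k. (z i)\<^sup>2) \<in> {c}} = 0"
    by (subst prob_eq_0) auto
  moreover have "measure (chi_square k) {c} = prob ((\<lambda>z. \<Sum>i<k. (z i)\<^sup>2) -` {c} \<inter> space (std_normals k))"
    unfolding chi_square_def by (rule measure_distr) auto
  ultimately show ?thesis by (simp add: vimage_def Int_def conj_commute)
qed

lemma isCont_cdf_chi_square: "k \<ge> 1 \<Longrightarrow> isCont (cdf (chi_square k)) x"
proof -
  assume k: "k \<ge> 1"
  interpret real_distribution "chi_square k" by (rule real_distribution_chi_square)
  show ?thesis using chi_square_no_atoms[OF k] by (simp add: isCont_cdf)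
qed

text \<open>Continuity makes the set closed, so its infimum belongs to it and one inequality
  follows; the left limit at the infimum gives the other. The bounds on \<alpha> make the set
  nonempty and bounded below.\<close>

lemma cdf_upper_quantile:
  assumes N: "real_distribution N" and cont: "\<And>x. isCont (cdf N) x" and \<alpha>: "0 < \<alpha>" "\<alpha> < 1"
  shows "cdf N (upper_quantile N \<alpha>) = 1 - \<alpha>"
proof -
  interpret real_distribution N by fact
  define S where "S = {q. 1 - \<alpha> \<le> cdf N q}"
  have "closed S" unfolding S_def
    using cont by (intro closed_Collect_le continuous_on_const) (simp add: continuous_at_imp_continuous_on)
  have "\<forall>\<^sub>F q in at_top. 1 - \<alpha> < cdf N q" using cdf_lim_at_top_prob \<alpha> by (intro order_tendstoD) auto
  then have "S \<noteq> {}" unfolding S_def by (metis (mono_tags, lifting) empty_Collect_eq eventually_happens' less_imp_le trivial_limit_at_top_linorder)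
  have "\<forall>\<^sub>F q in at_bot. cdf N q < 1 - \<alpha>" using cdf_lim_at_bot \<alpha> by (intro order_tendstoD) auto
  then obtain l where "\<And>q. q \<le> l \<Longrightarrow> cdf N q < 1 - \<alpha>" by (auto simp: eventually_at_bot_linorder)
  then have l: "q \<in> S \<Longrightarrow> l \<le> q" for q unfolding S_def by (metis linorder_le_cases mem_Collect_eq not_le)
  then have bdd: "bdd_below S" by (auto simp: bdd_below_def)
  have "Inf S \<in> S" using closed_contains_Inf[OF \<open>S \<noteq> {}\<close> bdd \<open>closed S\<close>] .
  moreover have "cdf N (Inf S) \<le> 1 - \<alpha>"
  proof (rule tendsto_upperbound)
    show "(cdf N \<longlongrightarrow> cdf N (Inf S)) (at_left (Inf S))"
      using cont[of "Inf S"] unfolding isCont_def by (rule filterlim_mono) (auto simp: at_le)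
    have "cdf N q \<le> 1 - \<alpha>" if "q < Inf S" for q
      using cInf_lower[OF _ bdd, of q] that by (force simp: S_def)
    then show "\<forall>\<^sub>F q in at_left (Inf S). cdf N q \<le> 1 - \<alpha>"
      by (auto simp: eventually_at_filter)
  qed simp
  ultimately show ?thesis by (auto simp: upper_quantile_def S_def)
qed

text \<open>The function \<open>exp (- s x\<^sup>2)\<close> is the characteristic function of a
  centred normal variable evaluated at \<open>x\<close>, so the Laplace transform of a sum of squares is an
  average of the joint characteristic function.\<close>

lemma weak_conv_sum_squares:
  fixes Z :: "nat \<Rightarrow> nat \<Rightarrow> 'a \<Rightarrow> real"
  assumes prob: "\<And>n. prob_space (M n)"
    and meas: "\<And>n j. j < k \<Longrightarrow> Z n j \<in> borel_measurable (M n)"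
    and char: "\<And>c. (\<lambda>n. \<integral>\<omega>. iexp (\<Sum>j<k. c j * Z n j \<omega>) \<partial>M n) \<longlonglongrightarrow> complex_of_real (exp (- (\<Sum>j<k. (c j)\<^sup>2) / 2))"
  shows "weak_conv_m (\<lambda>n. distr (M n) borel (\<lambda>\<omega>. \<Sum>j<k. (Z n j \<omega>)\<^sup>2)) (chi_square k)"
proof (rule weak_conv_m_laplace)
  interpret G: prob_space "std_normals k" by (rule prob_space_std_normals)
  interpret g: real_distribution std_normal_distribution by (rule real_dist_normal_dist)
  interpret g: product_sigma_finite "\<lambda>_::nat. std_normal_distribution" ..
  show "real_distribution (chi_square k)" by (rule real_distribution_chi_square)
  show "AE x in chi_square k. 0 \<le> x" by (rule AE_chi_square_nonneg)
  fix n
  interpret prob_space "M n" by (rule prob)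
  note [measurable] = meas[of _ n]
  show "real_distribution (distr (M n) borel (\<lambda>\<omega>. \<Sum>j<k. (Z n j \<omega>)\<^sup>2))"
    by (intro real_distribution_distr) measurable
  show "AE x in distr (M n) borel (\<lambda>\<omega>. \<Sum>j<k. (Z n j \<omega>)\<^sup>2). 0 \<le> x"
    by (subst AE_distr_iff) (auto intro!: sum_nonneg AE_I2)
next
  interpret G: prob_space "std_normals k" by (rule prob_space_std_normals)
  interpret g: real_distribution std_normal_distribution by (rule real_dist_normal_dist)
  interpret g: product_sigma_finite "\<lambda>_::nat. std_normal_distribution" ..
  fix m :: nat
  \<comment> \<open>Chosen so that a standard normal \<open>g\<close> satisfies
    \<open>E (iexp (s * x * g)) = exp (- m * x\<^sup>2)\<close>.\<close>
  define s where "s = sqrt (2 * real m)"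
  have s2: "s\<^sup>2 = 2 * real m" by (simp add: s_def)
  have inner: "complex_of_real (exp (- (real m * (\<Sum>j<k. (x j)\<^sup>2)))) = (\<integral>z. iexp (\<Sum>j<k. s * z j * x j) \<partial>std_normals k)" for x
  proof -
    have "(\<integral>z. iexp (\<Sum>j<k. s * z j * x j) \<partial>std_normals k) = (\<integral>z. (\<Prod>j<k. iexp (s * x j * z j)) \<partial>std_normals k)"
      by (simp add: exp_sum[symmetric] sum_distrib_left mult_ac)
    also have "\<dots> = (\<Prod>j<k. \<integral>z. iexp (s * x j * z) \<partial>std_normal_distribution)"
      using g.integrable_iexp by (intro g.product_integral_prod) auto
    also have "\<dots> = (\<Prod>j<k. complex_of_real (exp (- (s * x j)\<^sup>2 / 2)))"
      using fun_cong[OF char_std_normal_distribution] by (simp only: char_def)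
    also have "\<dots> = complex_of_real (exp (\<Sum>j<k. - (s * x j)\<^sup>2 / 2))"
      by (simp add: exp_sum)
    also have "(\<Sum>j<k. - (s * x j)\<^sup>2 / 2) = - (real m * (\<Sum>j<k. (x j)\<^sup>2))"
      by (simp add: power_mult_distrib s2 sum_distrib_left sum_negf)
    finally show ?thesis by simp
  qed
  define F where "F = (\<lambda>n z. \<integral>\<omega>. iexp (\<Sum>j<k. s * z j * Z n j \<omega>) \<partial>M n)"
  have swap: "complex_of_real (\<integral>x. exp (- (real m * x)) \<partial>distr (M n) borel (\<lambda>\<omega>. \<Sum>j<k. (Z n j \<omega>)\<^sup>2))
      = (\<integral>z. F n z \<partial>std_normals k)"
    and Fm: "F n \<in> borel_measurable (std_normals k)" for n
  proof -
    interpret prob_space "M n" by (rule prob)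
    note [measurable] = meas[of _ n]
    interpret pair_prob_space "M n" "std_normals k" ..
    have "complex_of_real (\<integral>x. exp (- (real m * x)) \<partial>distr (M n) borel (\<lambda>\<omega>. \<Sum>j<k. (Z n j \<omega>)\<^sup>2))
      = complex_of_real (\<integral>\<omega>. exp (- (real m * (\<Sum>j<k. (Z n j \<omega>)\<^sup>2))) \<partial>M n)"
      by (subst integral_distr) auto
    also have "\<dots> = (\<integral>\<omega>. complex_of_real (exp (- (real m * (\<Sum>j<k. (Z n j \<omega>)\<^sup>2)))) \<partial>M n)"
      by (rule integral_complex_of_real[symmetric])
    also have "\<dots> = (\<integral>\<omega>. (\<integral>z. iexp (\<Sum>j<k. s * z j * Z n j \<omega>) \<partial>std_normals k) \<partial>M n)"
      by (simp add: inner)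
    also have "\<dots> = (\<integral>z. F n z \<partial>std_normals k)"
      unfolding F_def
    proof (rule Fubini_integral[symmetric])
      show "integrable (M n \<Otimes>\<^sub>M std_normals k) (\<lambda>(\<omega>, z). iexp (\<Sum>j<k. s * z j * Z n j \<omega>))"
        by (intro integrable_const_bound[of _ 1]) (auto simp: case_prod_beta')
    qed
    finally show "complex_of_real (\<integral>x. exp (- (real m * x)) \<partial>distr (M n) borel (\<lambda>\<omega>. \<Sum>j<k. (Z n j \<omega>)\<^sup>2))
      = (\<integral>z. F n z \<partial>std_normals k)" .
    show "F n \<in> borel_measurable (std_normals k)"
      unfolding F_def by measurable
  qed
  \<comment> \<open>For fixed \<open>z\<close>, \<open>F n z\<close> is the characteristic function
    of the linear combination with coefficients \<open>s * z j\<close>, so the hypothesis gives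
    pointwise convergence; the constant 1 dominates.\<close>
  have "(\<lambda>n. \<integral>z. F n z \<partial>std_normals k) \<longlonglongrightarrow> (\<integral>z. complex_of_real (exp (- (real m * (\<Sum>j<k. (z j)\<^sup>2)))) \<partial>std_normals k)"
  proof (rule integral_dominated_convergence[where w="\<lambda>_. 1"])
    show "AE z in std_normals k. (\<lambda>n. F n z) \<longlonglongrightarrow> complex_of_real (exp (- (real m * (\<Sum>j<k. (z j)\<^sup>2))))"
    proof (rule AE_I2)
      fix z
      have "- (\<Sum>j<k. (s * z j)\<^sup>2) / 2 = - (real m * (\<Sum>j<k. (z j)\<^sup>2))"
        by (simp add: power_mult_distrib s2 sum_distrib_left[symmetric])
      then show "(\<lambda>n. F n z) \<longlonglongrightarrow> complex_of_real (exp (- (real m * (\<Sum>j<k. (z j)\<^sup>2))))"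
        using char[of "\<lambda>j. s * z j"] by (simp add: F_def)
    qed
    show "AE z in std_normals k. norm (F n z) \<le> 1" for n
    proof (rule AE_I2)
      fix z
      interpret prob_space "M n" by (rule prob)
      have "norm (F n z) \<le> (\<integral>\<omega>. norm (iexp (\<Sum>j<k. s * z j * Z n j \<omega>)) \<partial>M n)"
        unfolding F_def by (rule integral_norm_bound)
      then show "norm (F n z) \<le> 1" by (simp add: prob_space)
    qed
  qed (use Fm in auto)
  also have "(\<integral>z. complex_of_real (exp (- (real m * (\<Sum>j<k. (z j)\<^sup>2)))) \<partial>std_normals k)
    = complex_of_real (\<integral>x. exp (- (real m * x)) \<partial>chi_square k)"
    unfolding chi_square_def integral_complex_of_real by (subst integral_distr) auto
  finally show "(\<lambda>n. \<integral>x. exp (- (real m * x)) \<partial>distr (M n) borel (\<lambda>\<omega>. \<Sum>j<k. (Z n j \<omega>)\<^sup>2))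
    \<longlonglongrightarrow> (\<integral>x. exp (- (real m * x)) \<partial>chi_square k)"
    unfolding swap[symmetric] by (simp only: tendsto_of_real_iff)
qed

section \<open>The elliptical model and its standardization\<close>

lemma nn_integral_translation_invariant:
  fixes \<mu> :: "'b::euclidean_space measure"
  assumes "\<And>t. distr \<mu> borel (\<lambda>x. x + t) = \<mu>" "sets \<mu> = sets borel" and [measurable]: "g \<in> borel_measurable borel"
  shows "(\<integral>\<^sup>+x. g (x + t) \<partial>\<mu>) = (\<integral>\<^sup>+x. g x \<partial>\<mu>)"
proof -
  have "(\<integral>\<^sup>+x. g x \<partial>\<mu>) = (\<integral>\<^sup>+x. g x \<partial>distr \<mu> borel (\<lambda>x. x + t))" by (simp add: assms(1))
  also have "\<dots> = (\<integral>\<^sup>+x. g (x + t) \<partial>\<mu>)"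
    by (rule nn_integral_distr) (auto simp: measurable_cong_sets[OF assms(2) refl])
  finally show ?thesis by simp
qed

text \<open>Uniqueness of Haar measure, by two applications of Fubini's theorem to \<open>1\<^sub>A (x) 1\<^sub>B (x + y)\<close>.\<close>

lemma translation_invariant_emeasure:
  fixes \<mu> :: "'b::euclidean_space measure"
  assumes inv: "\<And>t. distr \<mu> borel (\<lambda>x. x + t) = \<mu>" and sets: "sets \<mu> = sets borel"
    and sf: "sigma_finite_measure \<mu>"
    and A: "A \<in> sets borel" and B: "B \<in> sets borel"
  shows "emeasure \<mu> A * emeasure lborel B = emeasure \<mu> B * emeasure lborel A"
proof -
  interpret \<mu>: sigma_finite_measure \<mu> by fact
  interpret pair_sigma_finite \<mu> "lborel :: 'b measure" ..
  have inv_l: "distr lborel borel (\<lambda>x. x + t) = lborel" for t :: 'b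
  proof -
    have "(\<lambda>x. x + t) = (+) t" by (auto simp: add.commute)
    then show ?thesis by (simp add: lborel_distr_plus)
  qed
  note [measurable_cong] = sets
  note [measurable] = A B
  \<comment> \<open>After the shift the variable of the inner Lebesgue integral enters as
    \<open>x - y\<close>, so reflection invariance is required too.\<close>
  have refl_l: "(\<integral>\<^sup>+y. indicator A (x - y) \<partial>lborel) = emeasure lborel A" for x :: 'b
  proof -
    have l: "lborel = distr lborel borel (\<lambda>y. x - y)"
      using lborel_affine[of "- 1 :: real" x] by (simp add: density_1)
    have "emeasure lborel A = (\<integral>\<^sup>+y. indicator A y \<partial>distr lborel borel (\<lambda>y. x - y))"
      by (subst l[symmetric]) (simp add: A)
    also have "\<dots> = (\<integral>\<^sup>+y. indicator A (x - y) \<partial>lborel)"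
      by (rule nn_integral_distr) auto
    finally show ?thesis by simp
  qed
  have "emeasure \<mu> A * emeasure lborel B = (\<integral>\<^sup>+x. indicator A x * emeasure lborel B \<partial>\<mu>)"
    by (simp add: nn_integral_multc sets)
  also have "\<dots> = (\<integral>\<^sup>+x. indicator A x * (\<integral>\<^sup>+y. indicator B (y + x) \<partial>lborel) \<partial>\<mu>)"
    by (subst nn_integral_translation_invariant[OF inv_l]) auto
  also have "\<dots> = (\<integral>\<^sup>+x. (\<integral>\<^sup>+y. indicator A x * indicator B (y + x) \<partial>lborel) \<partial>\<mu>)"
    by (intro nn_integral_cong nn_integral_cmult[symmetric]) auto
  also have "\<dots> = (\<integral>\<^sup>+y. (\<integral>\<^sup>+x. indicator A x * indicator B (y + x) \<partial>\<mu>) \<partial>lborel)"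
    by (rule Fubini'[symmetric]) measurable
  also have "\<dots> = (\<integral>\<^sup>+y. (\<integral>\<^sup>+x. indicator A (x - y) * indicator B x \<partial>\<mu>) \<partial>lborel)"
  proof (rule nn_integral_cong)
    fix y
    show "(\<integral>\<^sup>+x. indicator A x * indicator B (y + x) \<partial>\<mu>) = (\<integral>\<^sup>+x. indicator A (x - y) * indicator B x \<partial>\<mu>)"
      using nn_integral_translation_invariant[OF inv sets, of "\<lambda>x. indicator A (x - y) * indicator B x" y]
      by (simp add: add.commute)
  qed
  also have "\<dots> = (\<integral>\<^sup>+x. (\<integral>\<^sup>+y. indicator A (x - y) * indicator B x \<partial>lborel) \<partial>\<mu>)"
    by (rule Fubini') measurable
  also have "\<dots> = (\<integral>\<^sup>+x. emeasure lborel A * indicator B x \<partial>\<mu>)"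
    by (subst nn_integral_multc) (auto simp: refl_l)
  also have "\<dots> = emeasure \<mu> B * emeasure lborel A"
    by (subst nn_integral_cmult) (auto simp: sets mult.commute)
  finally show ?thesis .
qed

text \<open>The image measure is translation invariant: a shift by \<open>t\<close> after
  \<open>f\<close> is a shift by \<open>g t\<close> before it.\<close>

lemma distr_lborel_linear_proportional:
  fixes f g :: "'b::euclidean_space \<Rightarrow> 'b"
  assumes f: "linear f" and g: "linear g" and fg: "\<And>x. f (g x) = x" "\<And>x. g (f x) = x"
    and A: "A \<in> sets borel" and B: "B \<in> sets borel"
  shows "emeasure (distr lborel borel f) A * emeasure lborel B = emeasure (distr lborel borel f) B * emeasure lborel A"
proof (rule translation_invariant_emeasure[OF _ _ _ A B])
  have [measurable]: "f \<in> borel_measurable borel" "g \<in> borel_measurable borel"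
    using f g by (auto intro!: borel_measurable_continuous_onI linear_continuous_on linear_conv_bounded_linear[THEN iffD1])
  fix t
  have l: "distr lborel borel (\<lambda>x. x + g t) = lborel"
  proof -
    have "(\<lambda>x. x + g t) = (+) (g t)" by (auto simp: add.commute)
    then show ?thesis by (simp add: lborel_distr_plus)
  qed
  have "distr (distr lborel borel f) borel (\<lambda>x. x + t) = distr lborel borel (\<lambda>x. f (x + g t))"
    by (simp add: distr_distr comp_def linear_add[OF f] fg)
  also have "\<dots> = distr (distr lborel borel (\<lambda>x. x + g t)) borel f"
    by (simp add: distr_distr comp_def)
  finally show "distr (distr lborel borel f) borel (\<lambda>x. x + t) = distr lborel borel f" by (simp add: l)
  show "sets (distr lborel borel f) = sets borel" by simp
  show "sigma_finite_measure (distr lborel borel f)"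
  proof
    \<comment> \<open>Preimages of balls under the inverse map: the image measure of
      \<open>C k\<close> is the volume of the ball of radius \<open>k\<close>.\<close>
    define C where "C = (\<lambda>k::nat. g -` cball 0 (real k))"
    have C[measurable]: "C k \<in> sets borel" for k
      unfolding C_def using measurable_sets[of g borel borel "cball 0 (real k)"] by simp
    have "(\<Union>k. C k) = UNIV"
      by (auto simp: C_def real_arch_simple)
    moreover have "emeasure (distr lborel borel f) (C k) \<noteq> \<infinity>" for k
    proof -
      have "f -` C k = cball 0 (real k)" by (auto simp: C_def fg)
      then show ?thesis using emeasure_bounded_finite[of "cball 0 (real k) :: 'b set"] by (simp add: emeasure_distr)
    qed
    ultimately show "\<exists>A. countable A \<and> A \<subseteq> sets (distr lborel borel f) \<and>
        \<Union> A = space (distr lborel borel f) \<and> (\<forall>a\<in>A. emeasure (distr lborel borel f) a \<noteq> \<infinity>)"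
      by (intro exI[of _ "range C"]) auto
  qed
qed

text \<open>The factor \<open>k\<close> is left unidentified; finiteness is enough, because it is
  later determined by normalization. It is the image mass of the unit ball divided by its
  volume.\<close>

lemma distr_lborel_linear:
  fixes f g :: "'b::euclidean_space \<Rightarrow> 'b"
  assumes "linear f" "linear g" "\<And>x. f (g x) = x" "\<And>x. g (f x) = x"
  obtains k where "0 \<le> k" "distr lborel borel f = density lborel (\<lambda>_. ennreal k)"
proof -
  have [measurable]: "f \<in> borel_measurable borel"
    using assms by (auto intro!: borel_measurable_continuous_onI linear_continuous_on linear_conv_bounded_linear[THEN iffD1])
  define c where "c = emeasure lborel (cball (0::'b) 1)"
  define d where "d = emeasure (distr lborel borel f) (cball 0 1)"
  have c: "c \<noteq> 0" "c \<noteq> top"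
    by (auto simp: c_def emeasure_cball unit_ball_vol_pos less_imp_neq[symmetric])
  obtain B where B: "\<And>x. norm (g x) \<le> B * norm x" using linear_bounded[OF assms(2)] by auto
  have "f -` cball 0 1 \<subseteq> cball 0 \<bar>B\<bar>"
  proof
    fix x assume "x \<in> f -` cball 0 1"
    then have "norm (f x) \<le> 1" by simp
    have "norm x \<le> B * norm (f x)" using B[of "f x"] assms(4) by simp
    also have "\<dots> \<le> \<bar>B\<bar> * 1" using \<open>norm (f x) \<le> 1\<close> by (intro mult_mono) auto
    finally show "x \<in> cball 0 \<bar>B\<bar>" by simp
  qed
  then have "emeasure lborel (f -` cball 0 1) \<le> emeasure lborel (cball (0::'b) \<bar>B\<bar>)"
    by (intro emeasure_mono) auto
  also have "\<dots> < \<infinity>" using emeasure_bounded_finite[of "cball (0::'b) \<bar>B\<bar>"] by (simp add: less_top)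
  finally have d: "d \<noteq> top" by (simp add: d_def emeasure_distr)
  have "distr lborel borel f = density lborel (\<lambda>_. d / c)"
  proof (rule measure_eqI)
    fix A assume "A \<in> sets (distr lborel borel f)"
    then have A: "A \<in> sets borel" by simp
    have "emeasure (distr lborel borel f) A * c = d * emeasure lborel A"
      unfolding c_def d_def by (rule distr_lborel_linear_proportional[OF assms A]) simp
    then have "emeasure (distr lborel borel f) A = (d * emeasure lborel A) / c"
      using c by (metis ennreal_mult_divide_eq)
    also have "\<dots> = d / c * emeasure lborel A" by (simp add: divide_ennreal_def mult_ac)
    also have "\<dots> = emeasure (density lborel (\<lambda>_. d / c)) A"
      using A by (simp add: emeasure_density nn_integral_cmult)
    finally show "emeasure (distr lborel borel f) A = emeasure (density lborel (\<lambda>_. d / c)) A" .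
  qed simp
  moreover have "d / c = ennreal (enn2real (d / c))"
    using c d by (intro ennreal_enn2real[symmetric]) (simp add: ennreal_divide_eq_top_iff less_top[symmetric])
  ultimately show ?thesis using that[of "enn2real (d / c)"] by simp
qed

text \<open>The unit ball is invariant, so the factor of proportionality is 1.\<close>

lemma distr_lborel_orthogonal:
  fixes f :: "'b::euclidean_space \<Rightarrow> 'b"
  assumes f: "orthogonal_transformation f"
  shows "distr lborel borel f = lborel"
proof -
  have lin: "linear f" using f by (rule orthogonal_transformation_linear)
  then have [measurable]: "f \<in> borel_measurable borel"
    by (auto intro!: borel_measurable_continuous_onI linear_continuous_on linear_conv_bounded_linear[THEN iffD1])
  have bij: "bij f" by (rule orthogonal_transformation_bij[OF f])
  define c where "c = emeasure lborel (cball (0::'b) 1)"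
  have c: "c \<noteq> 0" "c \<noteq> top"
    by (auto simp: c_def emeasure_cball unit_ball_vol_pos less_imp_neq[symmetric])
  have "f -` cball 0 1 = cball 0 1" using orthogonal_transformation_norm[OF f] by auto
  then have d: "emeasure (distr lborel borel f) (cball 0 1) = c" by (simp add: emeasure_distr c_def)
  show ?thesis
  proof (rule measure_eqI)
    fix A assume "A \<in> sets (distr lborel borel f)"
    then have A: "A \<in> sets borel" by simp
    have "emeasure (distr lborel borel f) A * c = emeasure (distr lborel borel f) (cball 0 1) * emeasure lborel A"
      unfolding c_def
      by (rule distr_lborel_linear_proportional[OF lin orthogonal_transformation_linear[OF orthogonal_transformation_inv[OF f]] _ _ A])
        (use bij in \<open>auto simp: bij_is_surj surj_f_inv_f bij_is_inj\<close>)
    then show "emeasure (distr lborel borel f) A = emeasure lborel A"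
      unfolding d using c by (metis ennreal_mult_divide_eq mult.commute)
  qed simp
qed

section \<open>Square roots of the spiked covariance matrix\<close>

lemma matrix_inv_eqI:
  fixes A B :: "real^'n^'n"
  assumes "A ** B = mat 1" "B ** A = mat 1"
  shows "matrix_inv A = B"
proof -
  have "A ** matrix_inv A = mat 1 \<and> matrix_inv A ** A = mat 1"
    unfolding matrix_inv_def by (rule someI[of _ B]) (simp add: assms)
  then have "matrix_inv A ** (A ** B) = B" by (simp only: matrix_mul_assoc matrix_mul_lid)
  then show ?thesis by (simp add: assms(1))
qed

text \<open>Along \<theta> the eigenvalues multiply,
  \<open>(1 + a) * (1 + b) = 1 + (a + b + a * b)\<close>; on the complement all factors are the
  identity.\<close>

lemma spiked_cov_mult:
  assumes "norm \<theta> = 1"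
  shows "spiked_cov \<theta> a ** spiked_cov \<theta> b = spiked_cov \<theta> (a + b + a * b)"
proof (rule matrix_eq[THEN iffD2, rule_format])
  fix x
  have "\<theta> \<bullet> \<theta> = 1" using assms by (simp add: norm_eq_1)
  then show "(spiked_cov \<theta> a ** spiked_cov \<theta> b) *v x = spiked_cov \<theta> (a + b + a * b) *v x"
    by (simp add: matrix_vector_mul_assoc[symmetric] spiked_cov_mult_vec inner_add_right algebra_simps)
qed

lemma spiked_cov_0: "spiked_cov \<theta> 0 = mat 1"
  by (simp add: spiked_cov_def)

lemma spiked_cov_symmetric: "(spiked_cov \<theta> a *v x) \<bullet> y = x \<bullet> (spiked_cov \<theta> a *v y)"
  by (simp add: spiked_cov_mult_vec inner_add_left inner_add_right inner_commute)

text \<open>The symmetric square root of \<open>spiked_cov \<theta> a\<close> for a unit \<theta>: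
  eigenvalue \<open>sqrt (1 + a)\<close> along \<theta> and 1 on the complement.
  \<open>spiked_iroot\<close> is its inverse.\<close>

definition spiked_root :: "real^'p \<Rightarrow> real \<Rightarrow> real^'p^'p" where
  "spiked_root \<theta> a = spiked_cov \<theta> (sqrt (1 + a) - 1)"

definition spiked_iroot :: "real^'p \<Rightarrow> real \<Rightarrow> real^'p^'p" where
  "spiked_iroot \<theta> a = spiked_cov \<theta> (1 / sqrt (1 + a) - 1)"

context
  fixes \<theta> :: "real^'p" and a :: real
  assumes \<theta>: "norm \<theta> = 1" and a: "a > 0"
begin

lemma spiked_root_iroot: "spiked_root \<theta> a ** spiked_iroot \<theta> a = mat 1" "spiked_iroot \<theta> a ** spiked_root \<theta> a = mat 1"
proof -
  have "(s - 1) + (1 / s - 1) + (s - 1) * (1 / s - 1) = (0::real)" "(1 / s - 1) + (s - 1) + (1 / s - 1) * (s - 1) = 0" if "s > 0" for s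
    using that by (auto simp: field_simps)
  then show "spiked_root \<theta> a ** spiked_iroot \<theta> a = mat 1" "spiked_iroot \<theta> a ** spiked_root \<theta> a = mat 1"
    using a by (auto simp: spiked_root_def spiked_iroot_def spiked_cov_mult[OF \<theta>] spiked_cov_0)
qed

lemma spiked_root_square: "spiked_root \<theta> a ** spiked_root \<theta> a = spiked_cov \<theta> a"
proof -
  have "(sqrt (1 + a) - 1) + (sqrt (1 + a) - 1) + (sqrt (1 + a) - 1) * (sqrt (1 + a) - 1) = (sqrt (1 + a))\<^sup>2 - 1"
    by (simp add: power2_eq_square algebra_simps)
  also have "\<dots> = a" using a by simp
  finally show ?thesis by (simp add: spiked_root_def spiked_cov_mult[OF \<theta>])
qed

lemma matrix_inv_spiked_cov: "matrix_inv (spiked_cov \<theta> a) = spiked_iroot \<theta> a ** spiked_iroot \<theta> a"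
proof (rule matrix_inv_eqI)
  let ?R = "spiked_root \<theta> a" and ?A = "spiked_iroot \<theta> a"
  have "spiked_cov \<theta> a ** (?A ** ?A) = ?R ** (?R ** ?A) ** ?A"
    by (simp add: spiked_root_square[symmetric] matrix_mul_assoc)
  then show "spiked_cov \<theta> a ** (?A ** ?A) = mat 1" by (simp add: spiked_root_iroot)
  have "(?A ** ?A) ** spiked_cov \<theta> a = ?A ** (?A ** ?R) ** ?R"
    by (simp add: spiked_root_square[symmetric] matrix_mul_assoc)
  then show "(?A ** ?A) ** spiked_cov \<theta> a = mat 1" by (simp add: spiked_root_iroot)
qed

lemma mahalanobis_spiked_cov: "sqrt (x \<bullet> (matrix_inv (spiked_cov \<theta> a) *v x)) = norm (spiked_iroot \<theta> a *v x)"
  by (simp add: matrix_inv_spiked_cov matrix_vector_mul_assoc[symmetric] norm_eq_sqrt_inner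
      spiked_iroot_def spiked_cov_symmetric)

end

lemma measurable_matrix_vector_mult [measurable]: "(\<lambda>x. A *v x) \<in> borel_measurable borel" for A :: "real^'n^'m"
  by (intro borel_measurable_continuous_onI matrix_vector_mult_linear_continuous_on)

text \<open>The elliptical law with identity scatter matrix, which is the law of a standardized
  observation.\<close>

definition radial_law :: "(real \<Rightarrow> real) \<Rightarrow> (real^'p) measure" where
  "radial_law f = density lborel (\<lambda>y. ennreal (elliptical_const TYPE('p) f * f (norm y)))"

text \<open>The image has a density proportional to \<open>f (norm y)\<close>. Since both it and the
  normalized radial density have total mass one, the constant must be
  \<open>elliptical_const\<close>, and no determinant is evaluated.\<close>

lemma elliptical_standardized_law:
  fixes \<theta> :: "real^'p"
  assumes \<theta>: "norm \<theta> = 1" and a: "a > 0"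
    and L: "L = density lborel (\<lambda>x. ennreal (elliptical_density (spiked_cov \<theta> a) f x))"
    and prob: "prob_space L"
    and f: "f \<in> borel_measurable (restrict_space borel {0..})" "\<And>t. 0 \<le> t \<Longrightarrow> 0 \<le> f t"
    and c: "0 < elliptical_const TYPE('p) f"
  shows "distr L borel (\<lambda>x. spiked_iroot \<theta> a *v x) = radial_law f"
proof -
  interpret L: prob_space L by (rule prob)
  let ?A = "spiked_iroot \<theta> a" and ?R = "spiked_root \<theta> a"
  define c where "c = elliptical_const TYPE('p) f"
  define k1 where "k1 = c / sqrt (det (spiked_cov \<theta> a))"
  define h :: "real^'p \<Rightarrow> real" where "h = (\<lambda>y. f (norm y))"
  have "norm \<in> (borel :: (real^'p) measure) \<rightarrow>\<^sub>M restrict_space borel {0..}"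
    by (rule measurable_restrict_space2) auto
  from measurable_compose[OF this f(1)] have [measurable]: "h \<in> borel_measurable borel"
    unfolding h_def by simp
  have h0: "0 \<le> h y" for y by (simp add: h_def f)
  obtain k where k: "0 \<le> k" "distr lborel borel (\<lambda>x. ?A *v x) = density lborel (\<lambda>_. ennreal k)"
    by (rule distr_lborel_linear[of "\<lambda>x. ?A *v x" "\<lambda>x. ?R *v x"])
      (auto simp: matrix_vector_mul_assoc spiked_root_iroot[OF \<theta> a])
  have "distr L borel (\<lambda>x. ?A *v x) = distr (density lborel (\<lambda>x. ennreal (k1 * h (?A *v x)))) borel (\<lambda>x. ?A *v x)"
    unfolding L elliptical_density_def mahalanobis_spiked_cov[OF \<theta> a] by (simp add: h_def k1_def c_def)
  also have "\<dots> = density (density lborel (\<lambda>_. ennreal k)) (\<lambda>y. ennreal (k1 * h y))"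
    by (subst k(2)[symmetric], subst density_distr) auto
  also have "\<dots> = density lborel (\<lambda>y. ennreal (k * k1 * h y))"
    by (subst density_density_eq) (auto simp: ennreal_mult'[symmetric] k mult.assoc)
  finally have D: "distr L borel (\<lambda>x. ?A *v x) = density lborel (\<lambda>y. ennreal (k * k1 * h y))" .
  have "prob_space (distr L borel (\<lambda>x. ?A *v x))"
    by (rule L.prob_space_distr) (auto simp: L)
  then have "(\<integral>\<^sup>+y. ennreal (k * k1 * h y) \<partial>lborel) = 1"
    unfolding D using prob_space.emeasure_space_1 by (force simp: emeasure_density)
  \<comment> \<open>The sign of the determinant is not computed; a negative constant would make the
    truncated density vanish, against total mass one.\<close>
  moreover have k1: "k * k1 \<ge> 0"
  proof (rule ccontr)
    assume "\<not> ?thesis"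
    then have "ennreal (k * k1 * h y) = 0" for y
      using h0[of y] by (intro ennreal_neg) (simp add: mult_nonpos_nonneg)
    with calculation show False by simp
  qed
  ultimately have "(LINT y|lborel. k * k1 * h y) = 1"
    using h0 by (subst integral_eq_nn_integral) auto
  then have "k * k1 * (LINT y|lborel. h y) = 1" by simp
  moreover have "c = 1 / (LINT y|lborel. h y)" by (simp add: c_def elliptical_const_def h_def)
  moreover have "(LINT y|lborel. h y) \<noteq> 0" using c by (auto simp: elliptical_const_def h_def)
  ultimately have "k * k1 = c" by (metis mult_right_cancel nonzero_eq_divide_eq)
  then show ?thesis unfolding D radial_law_def h_def c_def by simp
qed

section \<open>Moments of spherical laws\<close>

text \<open>Normalizing the second moment in one direction suffices: rotation invariance extends it
  to all directions and makes the covariance the identity.\<close>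

definition spherical_law :: "(real^'p) measure \<Rightarrow> bool" where
  "spherical_law N \<longleftrightarrow> prob_space N \<and> sets N = sets borel \<and>
     (\<forall>f. orthogonal_transformation f \<longrightarrow> distr N borel f = N) \<and>
     integrable N (\<lambda>y. norm y ^ 4) \<and> (\<exists>u. norm u = 1 \<and> (\<integral>y. (u \<bullet> y)\<^sup>2 \<partial>N) = 1)"

text \<open>For a spherical law with identity covariance this is \<open>1 + \<kappa>\<close>, where \<open>\<kappa>\<close> is the kurtosis
  parameter.\<close>

definition kurtosis_factor :: "(real^'p) measure \<Rightarrow> real" where
  "kurtosis_factor N = (\<integral>y. norm y ^ 4 \<partial>N) / (real CARD('p) * (real CARD('p) + 2))"

context
  fixes N :: "(real^'p) measure"
  assumes N: "spherical_law N"
begin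

interpretation N: prob_space N using N by (simp add: spherical_law_def)

lemma spherical_sets: "sets N = sets borel" using N by (simp add: spherical_law_def)

lemma spherical_measurable: "f \<in> borel_measurable borel \<Longrightarrow> f \<in> borel_measurable N"
  by (simp add: measurable_cong_sets[OF spherical_sets refl])

lemma spherical_integrable_poly:
  assumes [measurable]: "f \<in> borel_measurable borel" and "\<And>y. \<bar>f y\<bar> \<le> c * norm y ^ k" and "k \<le> 4"
  shows "integrable N (f :: real^'p \<Rightarrow> real)"
proof (rule Bochner_Integration.integrable_bound)
  show "integrable N (\<lambda>y. \<bar>c\<bar> * (1 + norm y ^ 4))"
    using N by (auto simp: spherical_law_def)
  show "f \<in> borel_measurable N" by (rule spherical_measurable) fact
  show "AE y in N. norm (f y) \<le> norm (\<bar>c\<bar> * (1 + norm y ^ 4))"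
  proof (rule AE_I2)
    fix y :: "real^'p"
    have "norm y ^ k \<le> 1 + norm y ^ 4"
    proof (cases "norm y \<le> 1")
      case True then have "norm y ^ k \<le> 1" by (simp add: power_le_one)
      then show ?thesis by (simp add: add_increasing2)
    next
      case False then have "norm y ^ k \<le> norm y ^ 4" using assms(3) by (intro power_increasing) auto
      then show ?thesis by simp
    qed
    have "norm (f y) \<le> c * norm y ^ k" using assms(2)[of y] by simp
    also have "\<dots> \<le> \<bar>c\<bar> * norm y ^ k" by (intro mult_right_mono) auto
    also have "\<dots> \<le> \<bar>c\<bar> * (1 + norm y ^ 4)" using \<open>norm y ^ k \<le> 1 + norm y ^ 4\<close> by (intro mult_left_mono) auto
    finally show "norm (f y) \<le> norm (\<bar>c\<bar> * (1 + norm y ^ 4))" by (simp add: add_nonneg_nonneg)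
  qed
qed

lemma abs_inner_power_le: "\<bar>(u \<bullet> y) ^ k\<bar> \<le> norm u ^ k * norm (y :: real^'p) ^ k"
proof -
  have "\<bar>u \<bullet> y\<bar> ^ k \<le> (norm u * norm y) ^ k" by (intro power_mono Cauchy_Schwarz_ineq2) auto
  then show ?thesis by (simp add: power_abs power_mult_distrib)
qed

lemma spherical_integrable_power: "k \<le> 4 \<Longrightarrow> integrable N (\<lambda>y. (u \<bullet> y) ^ k)"
proof (rule spherical_integrable_poly[where c="norm u ^ k" and k=k])
  show "\<bar>(u \<bullet> y) ^ k\<bar> \<le> norm u ^ k * norm y ^ k" for y by (rule abs_inner_power_le)
qed auto

lemma spherical_integrable_mult_power: "j + k \<le> 4 \<Longrightarrow> integrable N (\<lambda>y. (u \<bullet> y) ^ j * (w \<bullet> y) ^ k)"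
proof (rule spherical_integrable_poly[where c="norm u ^ j * norm w ^ k" and k="j + k"])
  fix y :: "real^'p"
  have "\<bar>(u \<bullet> y) ^ j * (w \<bullet> y) ^ k\<bar> \<le> (norm u ^ j * norm y ^ j) * (norm w ^ k * norm y ^ k)"
    unfolding abs_mult by (intro mult_mono abs_inner_power_le) auto
  then show "\<bar>(u \<bullet> y) ^ j * (w \<bullet> y) ^ k\<bar> \<le> norm u ^ j * norm w ^ k * norm y ^ (j + k)"
    by (simp add: power_add mult_ac)
qed auto

text \<open>An orthogonal map carrying \<open>u\<close> to \<open>w\<close> preserves the law of
  \<open>y\<close>.\<close>

lemma spherical_same_norm:
  assumes "norm u = norm w" "g \<in> borel_measurable borel"
  shows "(\<integral>y. g (u \<bullet> y) \<partial>N) = (\<integral>y. g (w \<bullet> y) \<partial>N :: real)"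
proof -
  obtain f where f: "orthogonal_transformation f" "f u = w"
    using orthogonal_transformation_exists[OF assms(1)] by blast
  then have [measurable]: "f \<in> borel_measurable N"
    by (intro spherical_measurable borel_measurable_continuous_onI linear_continuous_on
      linear_conv_bounded_linear[THEN iffD1] orthogonal_transformation_linear)
  note [measurable] = assms(2)
  have "(\<integral>y. g (w \<bullet> y) \<partial>N) = (\<integral>y. g (w \<bullet> y) \<partial>distr N borel f)"
    using N f by (simp add: spherical_law_def)
  also have "\<dots> = (\<integral>y. g (w \<bullet> f y) \<partial>N)" by (rule integral_distr) auto
  also have "\<dots> = (\<integral>y. g (u \<bullet> y) \<partial>N)"
  proof -
    have "w \<bullet> f y = u \<bullet> y" for y using f unfolding orthogonal_transformation_def by blast
    then show ?thesis by simp
  qed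
  finally show ?thesis by simp
qed

lemma spherical_mean: "(\<integral>y. u \<bullet> y \<partial>N) = 0"
  using spherical_same_norm[of u "- u" "\<lambda>x. x"] by simp

lemma spherical_power_scale:
  obtains m where "\<And>u. (\<integral>y. (u \<bullet> y) ^ k \<partial>N) = m * norm u ^ k"
proof
  fix u :: "real^'p"
  define e :: "real^'p" where "e = axis undefined 1"
  have "norm u = norm (norm u *\<^sub>R e)" by (simp add: e_def)
  from spherical_same_norm[OF this, of "\<lambda>x. x ^ k"]
  show "(\<integral>y. (u \<bullet> y) ^ k \<partial>N) = (\<integral>y. (e \<bullet> y) ^ k \<partial>N) * norm u ^ k"
    by (simp add: power_mult_distrib mult.commute)
qed

text \<open>Polarization of the second directional moment, which is the squared norm.\<close>

lemma spherical_cov: "(\<integral>y. (u \<bullet> y) * (w \<bullet> y) \<partial>N) = u \<bullet> w"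
proof -
  obtain m where m: "\<And>u. (\<integral>y. (u \<bullet> y)\<^sup>2 \<partial>N) = m * (norm u)\<^sup>2"
    using spherical_power_scale[of 2] by blast
  have "m = 1" using N m by (auto simp: spherical_law_def)
  have "(\<integral>y. ((u + w) \<bullet> y)\<^sup>2 \<partial>N) = (\<integral>y. (u \<bullet> y)\<^sup>2 + 2 * ((u \<bullet> y) * (w \<bullet> y)) + (w \<bullet> y)\<^sup>2 \<partial>N)"
    by (simp add: inner_add_left power2_sum algebra_simps)
  also have "\<dots> = (\<integral>y. (u \<bullet> y)\<^sup>2 \<partial>N) + 2 * (\<integral>y. (u \<bullet> y) * (w \<bullet> y) \<partial>N) + (\<integral>y. (w \<bullet> y)\<^sup>2 \<partial>N)"
    using spherical_integrable_power[of 2] spherical_integrable_mult_power[of 1 1 u w] by simp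
  finally have "(norm (u + w))\<^sup>2 = (norm u)\<^sup>2 + 2 * (\<integral>y. (u \<bullet> y) * (w \<bullet> y) \<partial>N) + (norm w)\<^sup>2"
    unfolding m \<open>m = 1\<close> by simp
  then show ?thesis by (simp add: power2_norm_eq_inner inner_add_left inner_add_right inner_commute)
qed

text \<open>Polarization again: adding the fourth moments in the directions \<open>u + w\<close> and
  \<open>u - w\<close>, which have equal norm when \<open>u\<close> and \<open>w\<close> are
  orthogonal, isolates the mixed moment as one third of the fourth directional moment
  \<open>m\<close>. Expanding \<open>norm y ^ 4\<close> in coordinates identifies
  \<open>m / 3\<close> with \<open>kurtosis_factor N\<close>.\<close>

lemma
  shows spherical_fourth: "u \<bullet> w = 0 \<Longrightarrow> (\<integral>y. (u \<bullet> y)\<^sup>2 * (w \<bullet> y)\<^sup>2 \<partial>N) = kurtosis_factor N * (norm u)\<^sup>2 * (norm w)\<^sup>2"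
    and spherical_kurtosis_pos: "kurtosis_factor N > 0"
proof -
  obtain m where m: "\<And>u. (\<integral>y. (u \<bullet> y) ^ 4 \<partial>N) = m * norm u ^ 4"
    using spherical_power_scale[of 4] by blast
  have cross: "(\<integral>y. (u \<bullet> y)\<^sup>2 * (w \<bullet> y)\<^sup>2 \<partial>N) = m / 3 * (norm u)\<^sup>2 * (norm w)\<^sup>2" if "u \<bullet> w = 0" for u w
  proof -
    have n: "norm (u + w) ^ 4 = ((norm u)\<^sup>2 + (norm w)\<^sup>2)\<^sup>2" "norm (u - w) ^ 4 = ((norm u)\<^sup>2 + (norm w)\<^sup>2)\<^sup>2"
    proof -
      have "norm x ^ 4 = (x \<bullet> x)\<^sup>2" for x :: "real^'p"
        by (simp add: power2_norm_eq_inner[symmetric] power_mult[symmetric])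
      then show "norm (u + w) ^ 4 = ((norm u)\<^sup>2 + (norm w)\<^sup>2)\<^sup>2" "norm (u - w) ^ 4 = ((norm u)\<^sup>2 + (norm w)\<^sup>2)\<^sup>2"
        using that by (simp_all add: power2_norm_eq_inner inner_add_left inner_add_right inner_diff_left inner_diff_right inner_commute)
    qed
    have "(\<integral>y. ((u + w) \<bullet> y) ^ 4 \<partial>N) + (\<integral>y. ((u - w) \<bullet> y) ^ 4 \<partial>N)
      = (\<integral>y. ((u + w) \<bullet> y) ^ 4 + ((u - w) \<bullet> y) ^ 4 \<partial>N)"
      using spherical_integrable_power[of 4] by simp
    also have "\<dots> = (\<integral>y. 2 * (u \<bullet> y) ^ 4 + 12 * ((u \<bullet> y)\<^sup>2 * (w \<bullet> y)\<^sup>2) + 2 * (w \<bullet> y) ^ 4 \<partial>N)"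
      by (intro Bochner_Integration.integral_cong refl)
        (simp add: inner_add_left inner_diff_left power4_eq_xxxx power2_eq_square algebra_simps)
    also have "\<dots> = 2 * (m * norm u ^ 4) + 12 * (\<integral>y. (u \<bullet> y)\<^sup>2 * (w \<bullet> y)\<^sup>2 \<partial>N) + 2 * (m * norm w ^ 4)"
      using spherical_integrable_power[of 4] spherical_integrable_mult_power[of 2 2 u w] by (simp add: m)
    finally have "12 * (\<integral>y. (u \<bullet> y)\<^sup>2 * (w \<bullet> y)\<^sup>2 \<partial>N) = 2 * m * ((norm u)\<^sup>2 + (norm w)\<^sup>2)\<^sup>2 - 2 * m * norm u ^ 4 - 2 * m * norm w ^ 4"
      unfolding m n by simp
    also have "\<dots> = 4 * m * (norm u)\<^sup>2 * (norm w)\<^sup>2"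
      by (simp add: power4_eq_xxxx power2_eq_square algebra_simps)
    finally show ?thesis by simp
  qed
  have n2: "norm y ^ 2 = (\<Sum>i\<in>UNIV. (axis i 1 \<bullet> y)\<^sup>2)" for y :: "real^'p"
    by (simp add: power2_norm_eq_inner inner_axis') (simp add: inner_vec_def power2_eq_square)
  have n4: "norm y ^ 4 = (\<Sum>i\<in>UNIV. \<Sum>j\<in>UNIV. (axis i 1 \<bullet> y)\<^sup>2 * (axis j 1 \<bullet> y)\<^sup>2)" for y :: "real^'p"
  proof -
    have "norm y ^ 4 = norm y ^ 2 * norm y ^ 2" by (simp add: power_add[symmetric])
    then show ?thesis unfolding n2 by (simp add: sum_product)
  qed
  have "(\<integral>y. norm y ^ 4 \<partial>N) = (\<Sum>i\<in>UNIV. \<Sum>j\<in>UNIV. \<integral>y. (axis i 1 \<bullet> y)\<^sup>2 * (axis j 1 \<bullet> y)\<^sup>2 \<partial>N)"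
    unfolding n4 using spherical_integrable_mult_power[of 2 2]
    by (subst Bochner_Integration.integral_sum) (auto intro!: Bochner_Integration.integrable_sum)
  \<comment> \<open>Off-diagonal terms are \<open>m / 3\<close>, diagonal ones
    \<open>m = m / 3 + 2 * m / 3\<close>; in total \<open>m / 3 * p * (p + 2)\<close>.\<close>
  also have "\<dots> = (\<Sum>i\<in>(UNIV::'p set). \<Sum>j\<in>(UNIV::'p set). m / 3 + (if i = j then 2 * m / 3 else 0))"
  proof (intro sum.cong refl)
    fix i j :: 'p
    show "(\<integral>y. (axis i 1 \<bullet> y)\<^sup>2 * (axis j 1 \<bullet> y)\<^sup>2 \<partial>N) = m / 3 + (if i = j then 2 * m / 3 else 0)"
    proof (cases "i = j")
      case True
      have "(axis j 1 \<bullet> y)\<^sup>2 * (axis j 1 \<bullet> y)\<^sup>2 = (axis j 1 \<bullet> y) ^ 4" for y :: "real^'p"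
        by (simp add: power_add[symmetric])
      then show ?thesis using True m[of "axis j 1"] by simp
    next
      case False
      then show ?thesis using cross[of "axis i 1" "axis j 1"] by (simp add: inner_axis_axis)
    qed
  qed
  also have "\<dots> = m / 3 * (real CARD('p) * (real CARD('p) + 2))"
    by (simp add: sum.distrib algebra_simps)
  finally have E4: "(\<integral>y. norm y ^ 4 \<partial>N) = m / 3 * (real CARD('p) * (real CARD('p) + 2))" .
  then have k: "kurtosis_factor N = m / 3"
    by (simp add: kurtosis_factor_def)
  show "u \<bullet> w = 0 \<Longrightarrow> (\<integral>y. (u \<bullet> y)\<^sup>2 * (w \<bullet> y)\<^sup>2 \<partial>N) = kurtosis_factor N * (norm u)\<^sup>2 * (norm w)\<^sup>2"
    unfolding k by (rule cross)
  obtain u where u: "norm u = 1" "(\<integral>y. (u \<bullet> y)\<^sup>2 \<partial>N) = 1" using N by (auto simp: spherical_law_def)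
  \<comment> \<open>The variance of the squared projection is nonnegative, so
    \<open>m \<ge> 1\<close>.\<close>
  have "0 \<le> (\<integral>y. ((u \<bullet> y)\<^sup>2 - 1)\<^sup>2 \<partial>N)" by simp
  also have "\<dots> = (\<integral>y. (u \<bullet> y) ^ 4 - 2 * (u \<bullet> y)\<^sup>2 + 1 \<partial>N)"
    by (intro Bochner_Integration.integral_cong refl) (simp add: power2_diff power_mult[symmetric])
  also have "\<dots> = m - 1"
    using spherical_integrable_power[of 4 u] spherical_integrable_power[of 2 u] u m[of u] N.prob_space by simp
  finally show "kurtosis_factor N > 0" by (simp add: k)
qed

end

text \<open>The image of Lebesgue measure under the norm is identified from the volumes of balls.\<close>

lemma nn_integral_norm_lborel:
  assumes [measurable]: "g \<in> borel_measurable borel"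
  defines "d \<equiv> DIM('b::euclidean_space)"
  shows "(\<integral>\<^sup>+y. g (norm (y::'b)) \<partial>lborel)
    = ennreal (unit_ball_vol d * d) * (\<integral>\<^sup>+t. ennreal (t ^ (d - 1)) * indicator {0..} t * g t \<partial>lborel)"
proof -
  have d: "d \<ge> 1" by (simp add: d_def DIM_positive Suc_leI)
  define V where "V = unit_ball_vol (real d)"
  have V: "V \<ge> 0" by (simp add: V_def)
  \<comment> \<open>The density is the derivative of the volume \<open>V * r ^ d\<close> of the ball
    of radius \<open>r\<close>.\<close>
  define \<nu> where "\<nu> = density lborel (\<lambda>t. ennreal (V * d * t ^ (d - 1)) * indicator {0..} t)"
  have eq: "emeasure (distr lborel borel (norm :: 'b \<Rightarrow> real)) {..r} = emeasure \<nu> {..r}" for r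
  proof (cases "r \<ge> 0")
    case True
    have "norm -` {..r} = cball (0::'b) r" by auto
    then have "emeasure (distr lborel borel (norm :: 'b \<Rightarrow> real)) {..r} = ennreal (V * r ^ d)"
      using True by (simp add: emeasure_distr emeasure_cball V_def d_def)
    moreover have "emeasure \<nu> {..r} = (\<integral>\<^sup>+t. ennreal (V * d * t ^ (d - 1)) * indicator {0..r} t \<partial>lborel)"
      unfolding \<nu>_def by (simp add: emeasure_density) (intro nn_integral_cong, auto simp: indicator_def)
    moreover have "\<dots> = ennreal (V * r ^ d - V * 0 ^ d)"
      using True V by (intro nn_integral_FTC_Icc) (auto intro!: derivative_eq_intros)
    ultimately show ?thesis using d by (simp add: power_0_left)
  next
    case False
    then have "norm -` {..r} = ({} :: 'b set)" by (auto simp: not_le) (meson norm_ge_zero order_trans not_le)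
    moreover have "emeasure \<nu> {..r} = (\<integral>\<^sup>+t. 0 \<partial>(lborel :: real measure))"
    proof -
      have "emeasure \<nu> {..r} = (\<integral>\<^sup>+t. ennreal (V * d * t ^ (d - 1)) * indicator {0..} t * indicator {..r} t \<partial>lborel)"
        unfolding \<nu>_def by (rule emeasure_density) auto
      also have "\<dots> = (\<integral>\<^sup>+t. 0 \<partial>(lborel :: real measure))"
        using False by (intro nn_integral_cong) (auto simp: indicator_def)
      finally show ?thesis .
    qed
    ultimately show ?thesis by (simp add: emeasure_distr)
  qed
  have "distr lborel borel (norm :: 'b \<Rightarrow> real) = \<nu>"
  proof (rule measure_eqI_generator_eq[where E="range (\<lambda>a::real. {..a})" and \<Omega>=UNIV and A="\<lambda>n. {..real n}"])
    show "Int_stable (range (\<lambda>a::real. {..a}))" by (auto simp: Int_stable_def)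
    show "sets (distr lborel borel norm) = sigma_sets UNIV (range (\<lambda>a::real. {..a}))"
      "sets \<nu> = sigma_sets UNIV (range (\<lambda>a::real. {..a}))"
      by (simp_all add: \<nu>_def borel_eq_atMost)
    show "(\<Union>i. {..real i}) = UNIV" by (auto simp: real_arch_simple)
    fix i
    have "norm -` {..real i} = cball (0::'b) (real i)" by auto
    then show "emeasure (distr lborel borel (norm :: 'b \<Rightarrow> real)) {..real i} \<noteq> \<infinity>"
      using emeasure_bounded_finite[of "cball (0::'b) (real i)"] by (simp add: emeasure_distr)
  qed (use eq in auto)
  moreover have "g \<in> borel_measurable \<nu>" by (simp add: \<nu>_def)
  ultimately have "(\<integral>\<^sup>+y. g (norm (y::'b)) \<partial>lborel) = (\<integral>\<^sup>+t. g t \<partial>\<nu>)"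
    using nn_integral_distr[of "norm :: 'b \<Rightarrow> real" lborel borel g] by simp
  also have "\<dots> = (\<integral>\<^sup>+t. ennreal (V * d * t ^ (d - 1)) * indicator {0..} t * g t \<partial>lborel)"
    unfolding \<nu>_def by (rule nn_integral_density) auto
  also have "\<dots> = (\<integral>\<^sup>+t. ennreal (V * d) * (ennreal (t ^ (d - 1)) * indicator {0..} t * g t) \<partial>lborel)"
    using V by (intro nn_integral_cong) (auto simp: indicator_def ennreal_mult' mult_ac)
  also have "\<dots> = ennreal (V * d) * (\<integral>\<^sup>+t. ennreal (t ^ (d - 1)) * indicator {0..} t * g t \<partial>lborel)"
    by (rule nn_integral_cmult) auto
  finally show ?thesis by (simp add: V_def)
qed

section \<open>Radial densities of the class give spherical laws\<close>

lemma spherical_law_radial_law: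
  fixes u :: "real^'p"
  assumes h: "(\<lambda>y::real^'p. f (norm y)) \<in> borel_measurable borel"
    and "prob_space (radial_law f :: (real^'p) measure)"
    and "integrable (radial_law f) (\<lambda>y::real^'p. norm y ^ 4)"
    and "norm u = 1" "(\<integral>y. (u \<bullet> y)\<^sup>2 \<partial>radial_law f) = 1"
  shows "spherical_law (radial_law f :: (real^'p) measure)"
  unfolding spherical_law_def
proof (intro conjI allI impI)
  fix g :: "real^'p \<Rightarrow> real^'p" assume g: "orthogonal_transformation g"
  have [measurable]: "g \<in> borel_measurable borel"
    using orthogonal_transformation_linear[OF g]
    by (intro borel_measurable_continuous_onI linear_continuous_on linear_conv_bounded_linear[THEN iffD1])
  have "distr (radial_law f) borel g
    = distr (density lborel (\<lambda>y. ennreal (elliptical_const TYPE('p) f * f (norm (g y))))) borel g"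
    by (simp add: radial_law_def orthogonal_transformation_norm[OF g])
  also have "\<dots> = density (distr lborel borel g) (\<lambda>y. ennreal (elliptical_const TYPE('p) f * f (norm y)))"
    using h by (subst density_distr) auto
  finally show "distr (radial_law f) borel g = radial_law f"
    by (simp add: distr_lborel_orthogonal[OF g] radial_law_def)
qed (use assms in \<open>auto simp: radial_law_def\<close>)

lemma radial_measurable:
  assumes "f \<in> borel_measurable (restrict_space borel {0..})"
  shows "(\<lambda>y::'b::euclidean_space. f (norm y)) \<in> borel_measurable borel"
proof -
  have "norm \<in> (borel :: 'b measure) \<rightarrow>\<^sub>M restrict_space borel {0..}"
    by (rule measurable_restrict_space2) auto
  from measurable_compose[OF this assms] show ?thesis .
qed

lemma prob_space_radial_law:
  assumes h: "(\<lambda>y::real^'p. f (norm y)) \<in> borel_measurable borel"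
    and f: "\<And>t. 0 \<le> t \<Longrightarrow> 0 \<le> f t" and c: "0 < elliptical_const TYPE('p) f"
  shows "prob_space (radial_law f :: (real^'p) measure)"
proof
  define m where "m = (LINT y|lborel. f (norm (y::real^'p)))"
  \<comment> \<open>Positivity excludes both default values: the integral 0 of a non-integrable
    function and the quotient \<open>1 / 0 = 0\<close>.\<close>
  have "m > 0" using c by (simp add: elliptical_const_def m_def)
  then have "integrable lborel (\<lambda>y::real^'p. f (norm y))"
    unfolding m_def by (metis less_irrefl not_integrable_integral_eq)
  then have "(\<integral>\<^sup>+y. ennreal (f (norm (y::real^'p))) \<partial>lborel) = ennreal m"
    unfolding m_def using f by (intro nn_integral_eq_integral) auto
  then have "(\<integral>\<^sup>+y. ennreal (1 / m * f (norm (y::real^'p))) \<partial>lborel) = ennreal (1 / m) * ennreal m"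
    using h \<open>m > 0\<close> by (simp add: ennreal_mult' nn_integral_cmult del: times_divide_eq_left)
  also have "\<dots> = 1" using \<open>m > 0\<close> by (simp flip: ennreal_mult')
  finally show "emeasure (radial_law f :: (real^'p) measure) (space (radial_law f)) = 1"
    using h by (simp add: radial_law_def emeasure_density elliptical_const_def m_def)
qed

text \<open>In polar coordinates the volume element contributes \<open>t ^ (p - 1)\<close> and the
  integrand \<open>t ^ 4\<close>, whence the moment of order \<open>p + 3\<close>.\<close>

lemma integrable_radial_law_norm4:
  assumes f: "f \<in> borel_measurable (restrict_space borel {0..})" "\<And>t. 0 \<le> t \<Longrightarrow> 0 \<le> f t"
    and mom: "radial_moment (CARD('p) + 3) f < \<infinity>"
  shows "integrable (radial_law f) (\<lambda>y::real^'p. norm y ^ 4)"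
proof (rule integrableI_bounded)
  define c where "c = elliptical_const TYPE('p) f"
  have h[measurable]: "(\<lambda>y::real^'p. f (norm y)) \<in> borel_measurable borel" by (rule radial_measurable[OF f(1)])
  show "(\<lambda>y::real^'p. norm y ^ 4) \<in> borel_measurable (radial_law f)" by (simp add: radial_law_def)
  \<comment> \<open>\<open>f\<close> is measurable only on the half-line; this extension is Borel on
    all reals and agrees with \<open>f\<close> where it matters.\<close>
  define g where "g = (\<lambda>t. f (max 0 t))"
  have [measurable]: "g \<in> borel_measurable borel"
    unfolding g_def by (rule measurable_compose[OF _ f(1)]) (auto intro!: measurable_restrict_space2)
  have "(\<integral>\<^sup>+y. ennreal (norm (norm y ^ 4)) \<partial>(radial_law f :: (real^'p) measure))
      = (\<integral>\<^sup>+y. ennreal (c * f (norm y)) * ennreal (norm (y::real^'p) ^ 4) \<partial>lborel)"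
    unfolding radial_law_def c_def by (subst nn_integral_density) auto
  also have "\<dots> \<le> (\<integral>\<^sup>+y. ennreal (\<bar>c\<bar> * (norm (y::real^'p) ^ 4 * g (norm y))) \<partial>lborel)"
  proof (rule nn_integral_mono)
    fix y :: "real^'p"
    have "c * f (norm y) * norm y ^ 4 \<le> \<bar>c\<bar> * (norm y ^ 4 * f (norm y))"
      using f(2)[of "norm y"] by (simp add: mult.assoc mult.commute mult_right_mono mult_left_mono)
    then show "ennreal (c * f (norm y)) * ennreal (norm y ^ 4) \<le> ennreal (\<bar>c\<bar> * (norm y ^ 4 * g (norm y)))"
      by (simp add: g_def ennreal_mult''[symmetric] ennreal_leI)
  qed
  also have "\<dots> = ennreal (unit_ball_vol CARD('p) * CARD('p)) * (\<integral>\<^sup>+t. ennreal (t ^ (CARD('p) - 1)) * indicator {0..} t * ennreal (\<bar>c\<bar> * (t ^ 4 * g t)) \<partial>lborel)"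
    by (subst nn_integral_norm_lborel) auto
  also have "(\<integral>\<^sup>+t. ennreal (t ^ (CARD('p) - 1)) * indicator {0..} t * ennreal (\<bar>c\<bar> * (t ^ 4 * g t)) \<partial>lborel)
     = (\<integral>\<^sup>+t. ennreal \<bar>c\<bar> * (ennreal (t ^ (CARD('p) + 3) * g t) * indicator {0..} t) \<partial>lborel)"
  proof (intro nn_integral_cong)
    fix t :: real
    have "t ^ (CARD('p) - 1) * t ^ 4 = t ^ (CARD('p) + 3)" by (simp add: power_add[symmetric] add.commute)
    then have r: "t ^ (CARD('p) - 1) * (\<bar>c\<bar> * (t ^ 4 * g t)) = \<bar>c\<bar> * (t ^ (CARD('p) + 3) * g t)"
      by (metis mult.assoc mult.left_commute)
    show "ennreal (t ^ (CARD('p) - 1)) * indicator {0..} t * ennreal (\<bar>c\<bar> * (t ^ 4 * g t))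
      = ennreal \<bar>c\<bar> * (ennreal (t ^ (CARD('p) + 3) * g t) * indicator {0..} t)"
    proof (cases "t \<ge> 0")
      case True
      then have "ennreal (t ^ (CARD('p) - 1)) * ennreal (\<bar>c\<bar> * (t ^ 4 * g t)) = ennreal \<bar>c\<bar> * ennreal (t ^ (CARD('p) + 3) * g t)"
        by (subst (1 2) ennreal_mult'[symmetric]) (simp_all only: r zero_le_power abs_ge_zero)
      then show ?thesis using True by simp
    qed simp
  qed
  also have "\<dots> = ennreal \<bar>c\<bar> * (\<integral>\<^sup>+t\<in>{0..}. ennreal (t ^ (CARD('p) + 3) * g t) \<partial>lborel)"
    by (rule nn_integral_cmult) auto
  also have "(\<integral>\<^sup>+t\<in>{0..}. ennreal (t ^ (CARD('p) + 3) * g t) \<partial>lborel) = radial_moment (CARD('p) + 3) f"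
    unfolding radial_moment_def by (intro nn_integral_cong) (auto simp: g_def indicator_def)
  also have "ennreal (unit_ball_vol CARD('p) * CARD('p)) * (ennreal \<bar>c\<bar> * radial_moment (CARD('p) + 3) f) < \<infinity>"
    using mom by (simp add: ennreal_mult_less_top)
  finally show "(\<integral>\<^sup>+y. ennreal (norm (norm y ^ 4)) \<partial>(radial_law f :: (real^'p) measure)) < \<infinity>" .
qed

text \<open>Only the unit second moment needs work. A coordinate of the observation is a linear
  functional \<open>w\<close> of the standardized vector, so the covariance condition gives its
  second moment as \<open>w \<bullet> w\<close>; dividing by \<open>norm w\<close> yields the
  required direction.\<close>

lemma radial_class_spherical_law:
  fixes \<theta> :: "real^'p"
  assumes f: "f \<in> radial_class TYPE('p)" and \<theta>: "norm \<theta> = 1" and a: "r > 0" "v > 0"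
    and L: "L = density lborel (\<lambda>x. ennreal (elliptical_density (spiked_cov \<theta> (r * v)) f x))"
    and prob: "prob_space L"
  shows "spherical_law (radial_law f :: (real^'p) measure)"
proof -
  have fm: "f \<in> borel_measurable (restrict_space borel {0..})" and f0: "\<And>t. 0 \<le> t \<Longrightarrow> 0 \<le> f t"
    and c: "0 < elliptical_const TYPE('p) f" and mom: "radial_moment (CARD('p) + 3) f < \<infinity>"
    and cov: "has_covariance L (spiked_cov \<theta> (r * v))"
    using f \<theta> a by (auto simp: radial_class_def radial_density_def L)
  have rv: "r * v > 0" using a by simp
  note h = radial_measurable[OF fm, where 'b="real^'p"]
  let ?N = "radial_law f :: (real^'p) measure"
  let ?A = "spiked_iroot \<theta> (r * v)" and ?R = "spiked_root \<theta> (r * v)"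
  have D: "distr L borel (\<lambda>x. ?A *v x) = ?N"
    by (rule elliptical_standardized_law[OF \<theta> rv L prob fm f0 c])
  have [measurable_cong]: "sets L = sets borel" by (simp add: L)
  obtain i :: 'p where True by auto
  define w where "w = ?R *v axis i 1"
  have RA: "?R *v (?A *v x) = x" for x by (simp add: matrix_vector_mul_assoc spiked_root_iroot[OF \<theta> rv])
  have "x $ i = w \<bullet> (?A *v x)" for x
  proof -
    have "w \<bullet> (?A *v x) = axis i 1 \<bullet> (?R *v (?A *v x))"
      unfolding w_def spiked_root_def by (rule spiked_cov_symmetric)
    then show ?thesis by (simp add: RA inner_axis')
  qed
  then have int: "(\<integral>x. g (x $ i) \<partial>L) = (\<integral>y. g (w \<bullet> y) \<partial>?N)" if [measurable]: "g \<in> borel_measurable borel" for g :: "real \<Rightarrow> real"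
    unfolding D[symmetric] by (subst integral_distr) auto
  \<comment> \<open>Centring is obtained from invariance under the reflection \<open>- y\<close>
    directly, because sphericity is still being proved.\<close>
  have "distr ?N borel uminus = ?N"
  proof -
    have o: "orthogonal_transformation (uminus :: real^'p \<Rightarrow> real^'p)"
      by (simp add: orthogonal_transformation_def linear_uminus)
    have "distr ?N borel uminus = distr (density lborel (\<lambda>y. ennreal (elliptical_const TYPE('p) f * f (norm (- y))))) borel uminus"
      by (simp add: radial_law_def)
    also have "\<dots> = density (distr lborel borel uminus) (\<lambda>y. ennreal (elliptical_const TYPE('p) f * f (norm y)))"
      using h by (subst density_distr) auto
    finally show ?thesis by (simp add: distr_lborel_orthogonal[OF o] radial_law_def)
  qed
  then have "(\<integral>y. w \<bullet> y \<partial>?N) = (\<integral>y. w \<bullet> y \<partial>distr ?N borel uminus)" by simp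
  also have "\<dots> = (\<integral>y. w \<bullet> (- y) \<partial>?N)" by (rule integral_distr) (auto simp: radial_law_def)
  finally have m0: "(\<integral>y. w \<bullet> y \<partial>?N) = 0" by simp
  have "(\<integral>x. (x $ i - (\<integral>y. y $ i \<partial>L)) * (x $ i - (\<integral>y. y $ i \<partial>L)) \<partial>L) = spiked_cov \<theta> (r * v) $ i $ i"
    using cov by (simp add: has_covariance_def)
  then have "(\<integral>y. (w \<bullet> y)\<^sup>2 \<partial>?N) = spiked_cov \<theta> (r * v) $ i $ i"
    using int[of "\<lambda>x. x"] int[of "\<lambda>x. x * x"] m0 by (simp add: power2_eq_square)
  also have "\<dots> = axis i 1 \<bullet> (spiked_cov \<theta> (r * v) *v axis i 1)"
    by (simp add: inner_axis' matrix_vector_mult_basis column_def)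
  also have "\<dots> = w \<bullet> w"
    unfolding w_def spiked_root_square[OF \<theta> rv, symmetric] matrix_vector_mul_assoc[symmetric]
    by (simp add: spiked_root_def spiked_cov_symmetric)
  finally have w2: "(\<integral>y. (w \<bullet> y)\<^sup>2 \<partial>?N) = (norm w)\<^sup>2" by (simp add: power2_norm_eq_inner)
  have "?A *v w = axis i 1" by (simp add: w_def matrix_vector_mul_assoc spiked_root_iroot[OF \<theta> rv])
  then have w0: "w \<noteq> 0" by (metis axis_eq_0_iff matrix_vector_mult_0_right zero_neq_one)
  show ?thesis
  proof (rule spherical_law_radial_law[OF h prob_space_radial_law[OF h f0 c] integrable_radial_law_norm4[OF fm f0 mom]])
    show "norm ((1 / norm w) *\<^sub>R w) = 1" using w0 by simp
    have "(\<integral>y. (((1 / norm w) *\<^sub>R w) \<bullet> y)\<^sup>2 \<partial>?N) = (\<integral>y. (1 / norm w)\<^sup>2 * (w \<bullet> y)\<^sup>2 \<partial>?N)"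
      by (simp add: power_mult_distrib power_divide)
    then show "(\<integral>y. (((1 / norm w) *\<^sub>R w) \<bullet> y)\<^sup>2 \<partial>?N) = 1"
      using w0 by (simp add: w2 power_divide)
  qed
qed

section \<open>The Gaussian radial density\<close>

lemma nn_integral_gaussian_even_moments:
  "(\<integral>\<^sup>+y. (\<Prod>b\<in>Basis. ennreal (std_normal_density (y \<bullet> b) * (y \<bullet> b) ^ (2 * e b))) \<partial>(lborel :: 'b::euclidean_space measure))
    = (\<Prod>b\<in>Basis. ennreal (fact (2 * e b) / (2 ^ e b * fact (e b))))"
proof -
  have "(\<integral>\<^sup>+y. (\<Prod>b\<in>Basis. ennreal (std_normal_density (y \<bullet> b) * (y \<bullet> b) ^ (2 * e b))) \<partial>(lborel :: 'b measure))
    = (\<Prod>b\<in>Basis. \<integral>\<^sup>+t. ennreal (std_normal_density t * t ^ (2 * e b)) \<partial>lborel)"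
    by (rule nn_integral_lborel_prod) auto
  also have "\<dots> = (\<Prod>b\<in>Basis. ennreal (fact (2 * e b) / (2 ^ e b * fact (e b))))"
  proof (intro prod.cong refl)
    fix b
    have "(\<integral>\<^sup>+t. ennreal (std_normal_density t * t ^ (2 * e b)) \<partial>lborel) = ennreal (\<integral>t. std_normal_density t * t ^ (2 * e b) \<partial>lborel)"
      by (intro nn_integral_eq_integral integrable_std_normal_moment) (auto simp: zero_le_even_power)
    then show "(\<integral>\<^sup>+t. ennreal (std_normal_density t * t ^ (2 * e b)) \<partial>lborel) = ennreal (fact (2 * e b) / (2 ^ e b * fact (e b)))"
      by (simp add: integral_std_normal_moment_even)
  qed
  finally show ?thesis .
qed

lemma prod_std_normal_density:
  "(\<Prod>b\<in>Basis. std_normal_density ((y::'b::euclidean_space) \<bullet> b)) = (1 / sqrt (2 * pi)) ^ DIM('b) * gaussian_radial (norm y)"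
proof -
  have "(norm y)\<^sup>2 = (\<Sum>b\<in>Basis. (y \<bullet> b)\<^sup>2)"
    unfolding power2_norm_eq_inner by (subst euclidean_inner) (simp add: power2_eq_square)
  then have "gaussian_radial (norm y) = (\<Prod>b\<in>Basis. exp (- (y \<bullet> b)\<^sup>2 / 2))"
    by (simp add: gaussian_radial_def exp_sum[symmetric] sum_negf sum_divide_distrib)
  then show ?thesis
    by (simp add: std_normal_density_def prod.distrib power_divide prod_dividef)
qed

lemma elliptical_const_gaussian:
  "elliptical_const TYPE('p::finite) gaussian_radial = (1 / sqrt (2 * pi)) ^ CARD('p)"
proof -
  define k where "k = (1 / sqrt (2 * pi)) ^ CARD('p)"
  have k: "k > 0" by (simp add: k_def)
  have g: "(\<Prod>b\<in>Basis. std_normal_density (y \<bullet> b)) = k * gaussian_radial (norm y)" for y :: "real^'p"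
    by (simp add: prod_std_normal_density k_def)
  have [measurable]: "(\<lambda>y::real^'p. gaussian_radial (norm y)) \<in> borel_measurable borel"
    by (simp add: gaussian_radial_def)
  have "(\<integral>\<^sup>+y. ennreal (k * gaussian_radial (norm y)) \<partial>(lborel :: (real^'p) measure)) = 1"
    using nn_integral_gaussian_even_moments[of "\<lambda>_::real^'p. 0"]
    by (simp add: g[symmetric] prod_ennreal)
  then have "(LINT y|lborel. k * gaussian_radial (norm (y::real^'p))) = 1"
    using k by (subst integral_eq_nn_integral) (auto simp: gaussian_radial_def)
  then show ?thesis
    using k unfolding elliptical_const_def k_def[symmetric]
    by (metis integral_mult_right_zero mult_zero_right nonzero_eq_divide_eq zero_neq_one)
qed

lemma radial_law_gaussian:
  "radial_law gaussian_radial = density lborel (\<lambda>y::real^'p. ennreal (\<Prod>b\<in>Basis. std_normal_density (y \<bullet> b)))"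
  by (simp add: radial_law_def elliptical_const_gaussian prod_std_normal_density)

text \<open>All facts are read off the product form of the Gaussian density. The kurtosis factor is
  the mixed moment of two squared coordinates, which equals 1 by independence.\<close>

lemma
  assumes p: "CARD('p::finite) \<ge> 2"
  shows gaussian_spherical_law: "spherical_law (radial_law gaussian_radial :: (real^'p) measure)"
    and gaussian_kurtosis_factor: "kurtosis_factor (radial_law gaussian_radial :: (real^'p) measure) = 1"
proof -
  let ?G = "radial_law gaussian_radial :: (real^'p) measure"
  have G: "(\<integral>\<^sup>+y. (\<Prod>b\<in>Basis. ennreal ((y \<bullet> b) ^ (2 * e b))) \<partial>?G) = (\<Prod>b\<in>Basis. ennreal (fact (2 * e b) / (2 ^ e b * fact (e b))))" for e
  proof -
    have "(\<integral>\<^sup>+y. (\<Prod>b\<in>Basis. ennreal ((y \<bullet> b) ^ (2 * e b))) \<partial>?G)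
       = (\<integral>\<^sup>+y. ennreal (\<Prod>b\<in>Basis. std_normal_density (y \<bullet> b)) * (\<Prod>b\<in>Basis. ennreal ((y \<bullet> b) ^ (2 * e b))) \<partial>lborel)"
      unfolding radial_law_gaussian by (rule nn_integral_density) auto
    also have "\<dots> = (\<integral>\<^sup>+y. (\<Prod>b\<in>Basis. ennreal (std_normal_density (y \<bullet> b) * (y \<bullet> b) ^ (2 * e b))) \<partial>(lborel :: (real^'p) measure))"
      by (simp add: prod_ennreal[symmetric] prod.distrib[symmetric] ennreal_mult'[symmetric])
    finally show ?thesis by (simp add: nn_integral_gaussian_even_moments)
  qed
  \<comment> \<open>Exponents 0 and 1 stand for the moments of order 0 and 2 of a standard normal
    variable, both equal to 1.\<close>
  have one: "(\<Prod>b\<in>(Basis :: (real^'p) set). ennreal (fact (2 * e b) / (2 ^ e b * fact (e b)))) = 1" if "\<And>b. e b \<le> 1" for e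
  proof (rule prod.neutral, rule ballI)
    fix b :: "real^'p"
    have "e b = 0 \<or> e b = 1" using that[of b] by auto
    then show "ennreal (fact (2 * e b) / (2 ^ e b * fact (e b))) = 1" by auto
  qed
  have sq: "(\<integral>\<^sup>+y. ennreal ((y \<bullet> c)\<^sup>2) \<partial>?G) = 1" if c: "c \<in> Basis" for c
  proof -
    have "(\<Prod>b\<in>Basis. ennreal ((y \<bullet> b) ^ (2 * (if b = c then 1 else 0)))) = ennreal ((y \<bullet> c)\<^sup>2)" for y :: "real^'p"
      using c by (simp add: if_distrib[of "\<lambda>n. ennreal (_ ^ n)"] if_distrib[of "(*) 2"] prod.delta cong: if_cong)
    then show ?thesis using G[of "\<lambda>b. if b = c then 1 else 0"] one[of "\<lambda>b. if b = c then 1 else 0"] by simp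
  qed
  have sqsq: "(\<integral>\<^sup>+y. ennreal ((y \<bullet> c)\<^sup>2 * (y \<bullet> d)\<^sup>2) \<partial>?G) = 1" if c: "c \<in> Basis" "d \<in> Basis" "c \<noteq> d" for c d
  proof -
    have "(\<Prod>b\<in>Basis. ennreal ((y \<bullet> b) ^ (2 * (if b = c \<or> b = d then 1 else 0)))) = ennreal ((y \<bullet> c)\<^sup>2 * (y \<bullet> d)\<^sup>2)" for y :: "real^'p"
    proof -
      have "(\<Prod>b\<in>Basis. ennreal ((y \<bullet> b) ^ (2 * (if b = c \<or> b = d then 1 else 0)))) = (\<Prod>b\<in>{c, d}. ennreal ((y \<bullet> b)\<^sup>2))"
        using c by (intro prod.mono_neutral_cong_right) auto
      then show ?thesis using c by (simp add: ennreal_mult')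
    qed
    then show ?thesis using G[of "\<lambda>b. if b = c \<or> b = d then 1 else 0"] one[of "\<lambda>b. if b = c \<or> b = d then 1 else 0"] by simp
  qed
  have four: "(\<integral>\<^sup>+y. ennreal ((y \<bullet> c) ^ 4) \<partial>?G) < \<infinity>" if c: "c \<in> Basis" for c
  proof -
    have "(\<Prod>b\<in>Basis. ennreal ((y \<bullet> b) ^ (2 * (if b = c then 2 else 0)))) = ennreal ((y \<bullet> c) ^ 4)" for y :: "real^'p"
      using c by (simp add: if_distrib[of "\<lambda>n. ennreal (_ ^ n)"] if_distrib[of "(*) 2"] prod.delta cong: if_cong)
    then have "(\<integral>\<^sup>+y. ennreal ((y \<bullet> c) ^ 4) \<partial>?G) = (\<Prod>b\<in>(Basis :: (real^'p) set). ennreal (fact (2 * (if b = c then 2 else 0)) / (2 ^ (if b = c then 2 else 0) * fact (if b = c then 2 else 0))))"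
      using G[of "\<lambda>b. if b = c then 2 else 0"] by simp
    also have "\<dots> < \<infinity>" by (subst prod_ennreal) auto
    finally show ?thesis .
  qed
  have G0: "(\<integral>\<^sup>+y. 1 \<partial>?G) = 1" using G[of "\<lambda>_. 0"] by simp
  have [measurable_cong]: "sets ?G = sets borel" by (simp add: radial_law_def)
  have n4: "norm y ^ 4 = (\<Sum>b\<in>Basis. \<Sum>c\<in>Basis. (y \<bullet> b)\<^sup>2 * (y \<bullet> c)\<^sup>2)" for y :: "real^'p"
  proof -
    have "norm y ^ 4 = (y \<bullet> y) * (y \<bullet> y)" by (simp add: power2_norm_eq_inner[symmetric] power_add[symmetric])
    then show ?thesis by (subst (asm) (1 2) euclidean_inner) (simp add: sum_product power2_eq_square)
  qed
  have int22: "integrable ?G (\<lambda>y. (y \<bullet> b)\<^sup>2 * (y \<bullet> c)\<^sup>2)" if "b \<in> Basis" "c \<in> Basis" for b c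
  proof (rule integrableI_bounded)
    show "(\<integral>\<^sup>+y. ennreal (norm ((y \<bullet> b)\<^sup>2 * (y \<bullet> c)\<^sup>2)) \<partial>?G) < \<infinity>"
    proof (cases "b = c")
      case True
      have "(y \<bullet> c)\<^sup>2 * (y \<bullet> c)\<^sup>2 = (y \<bullet> c) ^ 4" for y by (simp add: power_add[symmetric])
      then show ?thesis using four[OF that(2)] True by simp
    qed (use sqsq[OF that] in simp)
  qed simp
  have int4: "integrable ?G (\<lambda>y. norm y ^ 4)"
    unfolding n4 using int22 by (intro Bochner_Integration.integrable_sum) auto
  \<comment> \<open>Two distinct coordinates are required for the mixed moment; this is where
    \<open>p \<ge> 2\<close> enters.\<close>
  obtain i j :: 'p where ij: "i \<noteq> j"
    using p by (metis card_2_iff' card_le_Suc_iff ex_card UNIV_I subset_UNIV)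
  define u w :: "real^'p" where "u = axis i 1" and "w = axis j 1"
  have uw: "u \<in> Basis" "w \<in> Basis" "u \<noteq> w" "norm u = 1" "norm w = 1" "u \<bullet> w = 0"
    using ij by (auto simp: u_def w_def axis_in_Basis_iff axis_eq_axis inner_axis_axis)
  have h: "(\<lambda>y::real^'p. gaussian_radial (norm y)) \<in> borel_measurable borel"
    by (simp add: gaussian_radial_def)
  show *: "spherical_law ?G"
  proof (rule spherical_law_radial_law[OF h _ int4 uw(4)])
    show "prob_space ?G" by standard (use G0 in simp)
    show "(\<integral>y. (u \<bullet> y)\<^sup>2 \<partial>?G) = 1"
      using sq[OF uw(1)] by (subst integral_eq_nn_integral) (auto simp: inner_commute)
  qed
  have "(\<integral>y. (u \<bullet> y)\<^sup>2 * (w \<bullet> y)\<^sup>2 \<partial>?G) = 1"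
    using sqsq[OF uw(1,2,3)] by (subst integral_eq_nn_integral) (auto simp: inner_commute)
  then show "kurtosis_factor ?G = 1"
    using spherical_fourth[OF * uw(6)] uw by simp
qed

section \<open>Deterministic bounds for the statistics\<close>

lemma norm_matrix_vector_le: "norm (A *v x) \<le> norm (A :: real^'n^'m) * norm x"
proof -
  have "norm (A *v x) = L2_set (\<lambda>i. \<bar>A $ i \<bullet> x\<bar>) UNIV"
    by (simp add: norm_vec_def matrix_vector_mul_component)
  also have "\<dots> \<le> L2_set (\<lambda>i. norm (A $ i) * norm x) UNIV"
    by (intro L2_set_mono) (auto intro: Cauchy_Schwarz_ineq2)
  also have "\<dots> = norm A * norm x"
    by (simp add: L2_set_left_distrib[symmetric] norm_vec_def[of A])
  finally show ?thesis .
qed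

lemma sum_matrix_vector_mult:
  "finite I \<Longrightarrow> (\<Sum>i\<in>I. A i) *v x = (\<Sum>i\<in>I. A i *v x)" for A :: "'i \<Rightarrow> real^'n^'m"
  by (induction I rule: finite_induct) (auto simp: matrix_vector_mult_add_rdistrib)

lemma sample_cov_mult_vec:
  "sample_cov n x *v z = (1 / real n) *\<^sub>R (\<Sum>i=1..n. ((x i - sample_mean n x) \<bullet> z) *\<^sub>R (x i - sample_mean n x))"
  by (simp add: sample_cov_def scaleR_matrix_vector_assoc[symmetric] sum_matrix_vector_mult outer_prod_mult_vec)

lemma transpose_sample_cov: "transpose (sample_cov n x) = sample_cov n x"
  by (simp add: vec_eq_iff transpose_def sample_cov_def outer_prod_def mult.commute)

lemma sample_cov_mult_vec_uncentered:
  assumes "n \<ge> 1"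
  shows "sample_cov n y *v z = ((1 / real n) *\<^sub>R (\<Sum>i=1..n. outer_prod (y i) (y i))) *v z
    - (sample_mean n y \<bullet> z) *\<^sub>R sample_mean n y"
proof -
  define m where "m = sample_mean n y"
  have s: "(\<Sum>i=1..n. y i) = real n *\<^sub>R m" using assms by (simp add: m_def sample_mean_def)
  have "(\<Sum>i=1..n. ((y i - m) \<bullet> z) *\<^sub>R (y i - m))
    = (\<Sum>i=1..n. (y i \<bullet> z) *\<^sub>R y i) - ((\<Sum>i=1..n. y i) \<bullet> z) *\<^sub>R m - (m \<bullet> z) *\<^sub>R (\<Sum>i=1..n. y i) + real n *\<^sub>R ((m \<bullet> z) *\<^sub>R m)"
    by (simp add: inner_diff_left scaleR_diff_left scaleR_diff_right sum_subtractf sum.distrib inner_sum_left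
        scaleR_sum_left scaleR_sum_right sum_constant_scaleR del: sum_constant)
  also have "\<dots> = (\<Sum>i=1..n. (y i \<bullet> z) *\<^sub>R y i) - real n *\<^sub>R ((m \<bullet> z) *\<^sub>R m)"
    unfolding s by (simp add: algebra_simps)
  finally show ?thesis
    using assms by (simp add: sample_cov_mult_vec m_def[symmetric] scaleR_diff_right scaleR_matrix_vector_assoc[symmetric]
        sum_matrix_vector_mult outer_prod_mult_vec)
qed

text \<open>Half of \<delta> pays for the uncentred second moments, the other half for centring,
  where one factor \<open>norm (sample_mean n y)\<close> is bounded by 1.\<close>

lemma sample_cov_near_identity:
  assumes "n \<ge> 1" and A: "norm ((1 / real n) *\<^sub>R (\<Sum>i=1..n. outer_prod (y i) (y i)) - mat 1) \<le> \<delta> / 2"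
    and m: "norm (sample_mean n y) \<le> \<delta> / 2" and "0 \<le> \<delta>" "\<delta> \<le> 1"
  shows "norm (sample_cov n y *v z - z) \<le> \<delta> * norm z"
proof -
  define C where "C = (1 / real n) *\<^sub>R (\<Sum>i=1..n. outer_prod (y i) (y i)) - mat 1"
  have "sample_cov n y *v z - z = C *v z - (sample_mean n y \<bullet> z) *\<^sub>R sample_mean n y"
    unfolding sample_cov_mult_vec_uncentered[OF assms(1)] C_def matrix_vector_mult_diff_rdistrib by simp
  also have "norm \<dots> \<le> norm (C *v z) + norm ((sample_mean n y \<bullet> z) *\<^sub>R sample_mean n y)"
    by (rule norm_triangle_ineq4)
  also have "norm (C *v z) \<le> \<delta> / 2 * norm z"
    by (rule order_trans[OF norm_matrix_vector_le mult_right_mono[OF A[folded C_def]]]) simp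
  also have "norm ((sample_mean n y \<bullet> z) *\<^sub>R sample_mean n y) \<le> \<delta> / 2 * norm z"
  proof -
    have "\<bar>sample_mean n y \<bullet> z\<bar> * norm (sample_mean n y) \<le> (norm (sample_mean n y) * norm z) * 1"
      using m \<open>\<delta> \<le> 1\<close> by (intro mult_mono Cauchy_Schwarz_ineq2) auto
    also have "\<dots> \<le> \<delta> / 2 * norm z" using mult_right_mono[OF m norm_ge_zero[of z]] by simp
    finally show ?thesis by simp
  qed
  finally show ?thesis by simp
qed

text \<open>By Pythagoras, for a unit \<theta>: \<open>n\<close> times the squared length of the
  projection of \<open>sample_cov n y *v \<theta>\<close> on the complement of \<theta>.\<close>

definition leading_term :: "real^'p \<Rightarrow> nat \<Rightarrow> (nat \<Rightarrow> real^'p) \<Rightarrow> real" where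
  "leading_term \<theta> n y = real n * (norm (sample_cov n y *v \<theta>) ^ 2 - (\<theta> \<bullet> (sample_cov n y *v \<theta>))\<^sup>2)"

section \<open>Inequalities for a fixed sample whose standardized covariance is near the
  identity\<close>

context
  fixes \<theta> :: "real^'p" and a :: real and n :: nat and x y :: "nat \<Rightarrow> real^'p" and \<delta> :: real
  assumes \<theta>: "norm \<theta> = 1" and a: "a > 0" and n: "n \<ge> 1"
    and xy: "\<And>i. i \<in> {1..n} \<Longrightarrow> x i = spiked_root \<theta> a *v y i"
    and \<delta>: "0 \<le> \<delta>" "\<delta> \<le> 1 / 4"
    and near: "\<And>z. norm (sample_cov n y *v z - z) \<le> \<delta> * norm z"
begin

private abbreviation R where "R \<equiv> spiked_root \<theta> a"

lemma sample_mean_spiked: "sample_mean n x = R *v sample_mean n y"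
proof -
  have "(\<Sum>i=1..n. x i) = (\<Sum>i=1..n. R *v y i)" by (rule sum.cong) (auto simp: xy)
  then show ?thesis by (simp add: sample_mean_def matrix_vector_mult_scaleR vec.sum)
qed

lemma root_sym: "(R *v z) \<bullet> w = z \<bullet> (R *v w)"
  by (simp add: spiked_root_def spiked_cov_symmetric)

lemma sample_cov_spiked: "sample_cov n x *v z = R *v (sample_cov n y *v (R *v z))"
proof -
  have "(\<Sum>i=1..n. ((x i - sample_mean n x) \<bullet> z) *\<^sub>R (x i - sample_mean n x))
    = (\<Sum>i=1..n. R *v (((y i - sample_mean n y) \<bullet> (R *v z)) *\<^sub>R (y i - sample_mean n y)))"
    by (intro sum.cong refl)
      (simp add: xy sample_mean_spiked matrix_vector_mult_diff_distrib[symmetric] root_sym matrix_vector_mult_scaleR)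
  then show ?thesis
    by (simp add: sample_cov_mult_vec matrix_vector_mult_scaleR vec.sum)
qed

lemma root_norm: "(R *v z) \<bullet> (R *v z) = z \<bullet> z + a * (\<theta> \<bullet> z)\<^sup>2"
proof -
  have "(R *v z) \<bullet> (R *v z) = z \<bullet> (spiked_cov \<theta> a *v z)"
    by (simp add: root_sym matrix_vector_mul_assoc spiked_root_square[OF \<theta> a])
  then show ?thesis
    by (simp add: spiked_cov_mult_vec inner_add_right power2_eq_square inner_commute)
qed

text \<open>With \<open>w = R *v z\<close> the form becomes that of the standardized data at
  \<open>w\<close>, and \<open>w \<bullet> w\<close> is the quadratic form of the spiked covariance
  at \<open>z\<close>. The bounds are relative, hence uniform in \<open>a\<close>.\<close>

lemma sample_cov_quadratic_form:
  shows "(1 - \<delta>) * (z \<bullet> z + a * (\<theta> \<bullet> z)\<^sup>2) \<le> z \<bullet> (sample_cov n x *v z)"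
    and "z \<bullet> (sample_cov n x *v z) \<le> (1 + \<delta>) * (z \<bullet> z + a * (\<theta> \<bullet> z)\<^sup>2)"
proof -
  define w where "w = R *v z"
  have "z \<bullet> (sample_cov n x *v z) = w \<bullet> (sample_cov n y *v w)"
    by (simp add: sample_cov_spiked w_def root_sym)
  moreover have "\<bar>w \<bullet> (sample_cov n y *v w - w)\<bar> \<le> \<delta> * (w \<bullet> w)"
  proof -
    have "\<bar>w \<bullet> (sample_cov n y *v w - w)\<bar> \<le> norm w * (\<delta> * norm w)"
      by (rule order_trans[OF Cauchy_Schwarz_ineq2 mult_left_mono[OF near]]) simp
    then show ?thesis by (simp add: dot_square_norm power2_eq_square mult_ac)
  qed
  moreover have "w \<bullet> w = z \<bullet> z + a * (\<theta> \<bullet> z)\<^sup>2" by (simp add: w_def root_norm)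
  ultimately show "(1 - \<delta>) * (z \<bullet> z + a * (\<theta> \<bullet> z)\<^sup>2) \<le> z \<bullet> (sample_cov n x *v z)"
    "z \<bullet> (sample_cov n x *v z) \<le> (1 + \<delta>) * (z \<bullet> z + a * (\<theta> \<bullet> z)\<^sup>2)"
    by (simp_all add: inner_diff_right algebra_simps)
qed

text \<open>Courant-Fischer by hand. The first eigenvalue is tested with \<open>h 1\<close> from
  above and with \<theta> from below; the others are tested with \<open>h j\<close> from below, and
  from above with a vector in the plane of \<open>h 1\<close> and \<open>h 2\<close>.\<close>

lemma eigenvalue_bounds:
  assumes es: "eigen_system (sample_cov n x) l h" and cyc: "cyclic_vec (sample_cov n x) \<theta>"
    and p: "CARD('p) \<ge> 2"
  shows "(1 - \<delta>) * (1 + a) \<le> l 1" "l 1 \<le> (1 + \<delta>) * (1 + a)"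
    and "j \<in> {2..CARD('p)} \<Longrightarrow> 1 - \<delta> \<le> l j" "j \<in> {2..CARD('p)} \<Longrightarrow> l j \<le> 1 + \<delta>"
proof -
  let ?S = "sample_cov n x"
  note on = eigen_system_orthonormal[OF transpose_sample_cov es cyc]
  have Sh: "?S *v h j = l j *\<^sub>R h j" if "j \<in> {1..CARD('p)}" for j
    using es that by (auto simp: eigen_system_def)
  have lj: "l j = h j \<bullet> (?S *v h j)" if "j \<in> {1..CARD('p)}" for j
    using that by (simp add: Sh on)
  have mono: "l k \<le> l j" if "1 \<le> j" "j \<le> k" "k \<le> CARD('p)" for j k
    using es that by (auto simp: eigen_system_def)
  have \<theta>\<theta>: "\<theta> \<bullet> \<theta> = 1" using \<theta> by (simp add: norm_eq_1)
  have cs: "(\<theta> \<bullet> h j)\<^sup>2 \<le> 1" if "j \<in> {1..CARD('p)}" for j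
    using Cauchy_Schwarz_ineq[of \<theta> "h j"] on[OF that that] \<theta>\<theta> by simp
  have h1: "\<theta> \<bullet> h 1 \<noteq> 0"
  proof
    assume "\<theta> \<bullet> h 1 = 0"
    then have "h 1 = 0" using cyc Sh[of 1] p by (auto simp: cyclic_vec_def inner_commute)
    then show False using on[of 1 1] p by simp
  qed
  show "l 1 \<le> (1 + \<delta>) * (1 + a)"
  proof -
    have 1: "1 \<in> {1..CARD('p)}" using p by simp
    have "l 1 \<le> (1 + \<delta>) * (h 1 \<bullet> h 1 + a * (\<theta> \<bullet> h 1)\<^sup>2)"
      unfolding lj[OF 1] by (rule sample_cov_quadratic_form)
    also have "\<dots> \<le> (1 + \<delta>) * (1 + a * 1)"
      using cs[OF 1] on[OF 1 1] \<delta> a by (intro mult_left_mono add_mono) auto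
    finally show ?thesis by simp
  qed
  show "(1 - \<delta>) * (1 + a) \<le> l 1"
  proof -
    have ex: "(\<Sum>j=1..CARD('p). (h j \<bullet> \<theta>) *\<^sub>R h j) = \<theta>"
      by (rule orthonormal_expansion[OF _ _ on]) auto
    have pars: "(\<Sum>j=1..CARD('p). (h j \<bullet> \<theta>)\<^sup>2) = \<theta> \<bullet> \<theta>"
      by (rule orthonormal_parseval[OF _ _ on]) auto
    have "\<theta> \<bullet> (?S *v \<theta>) = \<theta> \<bullet> (\<Sum>j=1..CARD('p). (h j \<bullet> \<theta>) *\<^sub>R (l j *\<^sub>R h j))"
      by (subst (2) ex[symmetric]) (simp add: vec.sum matrix_vector_mult_scaleR Sh)
    also have "\<dots> = (\<Sum>j=1..CARD('p). l j * (h j \<bullet> \<theta>)\<^sup>2)"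
      by (simp add: inner_sum_right power2_eq_square inner_commute mult_ac)
    also have "\<dots> \<le> (\<Sum>j=1..CARD('p). l 1 * (h j \<bullet> \<theta>)\<^sup>2)"
      by (intro sum_mono mult_right_mono mono) auto
    also have "\<dots> = l 1" unfolding sum_distrib_left[symmetric] pars \<theta>\<theta> by simp
    finally show ?thesis using sample_cov_quadratic_form(1)[of \<theta>] by (simp add: \<theta>\<theta>)
  qed
  assume j: "j \<in> {2..CARD('p)}"
  then have j1: "j \<in> {1..CARD('p)}" by auto
  have "(1 - \<delta>) * 1 \<le> (1 - \<delta>) * (h j \<bullet> h j + a * (\<theta> \<bullet> h j)\<^sup>2)"
    using \<delta> a on[OF j1 j1] by (intro mult_left_mono) auto
  also have "\<dots> \<le> l j" unfolding lj[OF j1] by (rule sample_cov_quadratic_form)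
  finally show "1 - \<delta> \<le> l j" by simp
  have 12: "1 \<in> {1..CARD('p)}" "2 \<in> {1..CARD('p)}" using p by auto
  \<comment> \<open>The vector of this plane orthogonal to \<theta>, where the spike is invisible;
    it is nonzero because \<open>\<theta> \<bullet> h 1\<close> is.\<close>
  define z where "z = (\<theta> \<bullet> h 2) *\<^sub>R h 1 - (\<theta> \<bullet> h 1) *\<^sub>R h 2"
  have zz: "z \<bullet> z = (\<theta> \<bullet> h 2)\<^sup>2 + (\<theta> \<bullet> h 1)\<^sup>2"
    using on[OF 12(1) 12(1)] on[OF 12(1) 12(2)] on[OF 12(2) 12(2)]
    by (simp add: z_def inner_diff_left inner_diff_right inner_commute power2_eq_square)
  have Sz: "?S *v z = (\<theta> \<bullet> h 2) *\<^sub>R (l 1 *\<^sub>R h 1) - (\<theta> \<bullet> h 1) *\<^sub>R (l 2 *\<^sub>R h 2)"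
    by (simp only: z_def matrix_vector_mult_diff_distrib matrix_vector_mult_scaleR Sh[OF 12(1)] Sh[OF 12(2)])
  have "z \<bullet> (?S *v z) = l 1 * (\<theta> \<bullet> h 2)\<^sup>2 + l 2 * (\<theta> \<bullet> h 1)\<^sup>2"
    using on[OF 12(1) 12(1)] on[OF 12(1) 12(2)] on[OF 12(2) 12(2)]
    unfolding Sz
    by (simp add: z_def inner_diff_left inner_diff_right inner_commute power2_eq_square)
  also have "\<dots> \<ge> l 2 * (\<theta> \<bullet> h 2)\<^sup>2 + l 2 * (\<theta> \<bullet> h 1)\<^sup>2"
    using mono[of 1 2] p by (intro add_mono mult_right_mono) auto
  finally have "l 2 * (z \<bullet> z) \<le> z \<bullet> (?S *v z)" by (simp add: zz distrib_left)
  also have "\<dots> \<le> (1 + \<delta>) * (z \<bullet> z + a * (\<theta> \<bullet> z)\<^sup>2)" by (rule sample_cov_quadratic_form)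
  also have "\<theta> \<bullet> z = 0" by (simp add: z_def inner_diff_right)
  finally have "l 2 * (z \<bullet> z) \<le> (1 + \<delta>) * (z \<bullet> z)" by simp
  moreover have "z \<bullet> z > 0" using h1 by (simp add: zz add_nonneg_pos)
  ultimately have "l 2 \<le> 1 + \<delta>" by (simp add: mult_le_cancel_right)
  then show "l j \<le> 1 + \<delta>" using mono[of 2 j] j by auto
qed

text \<open>The root of the covariance fixes each \<open>g j\<close> and scales \<theta> by
  \<open>sqrt (1 + a)\<close>, so every squared term gains a factor \<open>1 + a\<close>, which
  \<open>l 1\<close> cancels up to a factor near 1. With the weights gone, Parseval makes the choice
  of basis irrelevant.\<close>

lemma Q_HPV_leading_term:
  assumes es: "eigen_system (sample_cov n x) l h" and cyc: "cyclic_vec (sample_cov n x) \<theta>"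
    and p: "CARD('p) \<ge> 2"
  shows "\<bar>Q_HPV \<theta> n x l h - leading_term \<theta> n y\<bar> \<le> 4 * \<delta> * leading_term \<theta> n y"
    and "leading_term \<theta> n y \<ge> 0"
proof -
  let ?S = "sample_cov n x" and ?B = "sample_cov n y"
  note on = eigen_system_orthonormal[OF transpose_sample_cov es cyc]
  note eb = eigenvalue_bounds[OF es cyc p]
  have \<theta>\<theta>: "\<theta> \<bullet> \<theta> = 1" using \<theta> by (simp add: norm_eq_1)
  have h1: "h 1 \<bullet> \<theta> \<noteq> 0"
  proof
    assume "h 1 \<bullet> \<theta> = 0"
    moreover have "?S *v h 1 = l 1 *\<^sub>R h 1" using es p by (auto simp: eigen_system_def)
    ultimately have "h 1 = 0" using cyc by (auto simp: cyclic_vec_def)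
    then show False using on[of 1 1] p by simp
  qed
  define g where "g = gram_schmidt \<theta> h"
  have gs: "norm (g j) = 1 \<and> g j \<bullet> \<theta> = 0 \<and> (\<forall>k\<in>{2..<j}. g j \<bullet> g k = 0)" if "j \<in> {2..CARD('p)}" for j
    unfolding g_def using gram_schmidt_orthonormal[OF \<theta> h1 on that] by blast
  define b where "b = (\<lambda>j. if j = 1 then \<theta> else g j)"
  have bon: "b j \<bullet> b k = (if j = k then 1 else 0)" if "j \<in> {1..CARD('p)}" "k \<in> {1..CARD('p)}" for j k
  proof -
    have gg: "g i \<bullet> g k = 0" if "i \<in> {2..CARD('p)}" "k \<in> {2..CARD('p)}" "i \<noteq> k" for i k
      using gs[OF that(1)] gs[OF that(2)] that by (cases "k < i") (auto simp: inner_commute)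
    show ?thesis
      using that gs[of j] gs[of k] gg[of j k] \<theta>\<theta>
      by (cases "j = 1"; cases "k = 1") (auto simp: b_def inner_commute norm_eq_1)
  qed
  define s where "s = ?B *v \<theta>"
  have pars: "(\<Sum>j=1..CARD('p). (b j \<bullet> s)\<^sup>2) = s \<bullet> s"
    by (rule orthonormal_parseval[OF _ _ bon]) auto
  have "(\<Sum>j=1..CARD('p). (b j \<bullet> s)\<^sup>2) = (b 1 \<bullet> s)\<^sup>2 + (\<Sum>j=2..CARD('p). (b j \<bullet> s)\<^sup>2)"
    using p by (subst sum.atLeast_Suc_atMost) (auto simp: numeral_2_eq_2)
  also have "(\<Sum>j=2..CARD('p). (b j \<bullet> s)\<^sup>2) = (\<Sum>j=2..CARD('p). (g j \<bullet> s)\<^sup>2)"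
    by (intro sum.cong) (auto simp: b_def)
  finally have W: "leading_term \<theta> n y = (\<Sum>j=2..CARD('p). real n * (g j \<bullet> s)\<^sup>2)"
    using pars by (simp add: leading_term_def s_def[symmetric] power2_norm_eq_inner b_def sum_distrib_left[symmetric])
  then show "leading_term \<theta> n y \<ge> 0" by (simp add: sum_nonneg)
  have R\<theta>: "R *v \<theta> = sqrt (1 + a) *\<^sub>R \<theta>"
    by (simp add: spiked_root_def spiked_cov_mult_vec \<theta>\<theta> scaleR_diff_left)
  have proj: "(g j \<bullet> (?S *v \<theta>))\<^sup>2 = (1 + a) * (g j \<bullet> s)\<^sup>2" if "j \<in> {2..CARD('p)}" for j
  proof -
    have "R *v g j = g j" using gs[OF that] by (simp add: spiked_root_def spiked_cov_mult_vec inner_commute)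
    then have "g j \<bullet> (?S *v \<theta>) = sqrt (1 + a) * (g j \<bullet> s)"
      by (simp add: sample_cov_spiked R\<theta> matrix_vector_mult_scaleR s_def root_sym[symmetric])
    then show ?thesis using a by (simp add: power_mult_distrib)
  qed
  \<comment> \<open>Ratio of the weight in the statistic to the ideal weight 1.\<close>
  define q where "q = (\<lambda>j. (1 + a) / (l 1 * l j))"
  have "Q_HPV \<theta> n x l h = (\<Sum>j=2..CARD('p). q j * (real n * (g j \<bullet> s)\<^sup>2))"
    unfolding Q_HPV_def sum_distrib_left g_def[symmetric]
    by (intro sum.cong refl) (simp add: proj q_def field_simps)
  then have "\<bar>Q_HPV \<theta> n x l h - leading_term \<theta> n y\<bar> = \<bar>\<Sum>j=2..CARD('p). (q j - 1) * (real n * (g j \<bullet> s)\<^sup>2)\<bar>"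
    by (simp add: W sum_subtractf[symmetric] algebra_simps)
  also have "\<dots> \<le> (\<Sum>j=2..CARD('p). \<bar>(q j - 1) * (real n * (g j \<bullet> s)\<^sup>2)\<bar>)" by (rule sum_abs)
  also have "\<dots> \<le> (\<Sum>j=2..CARD('p). 4 * \<delta> * (real n * (g j \<bullet> s)\<^sup>2))"
  proof (intro sum_mono)
    fix j assume j: "j \<in> {2..CARD('p)}"
    have l1: "l 1 > 0" 
    proof -
      have "0 < (1 - \<delta>) * (1 + a)" using \<delta> a by simp
      then show ?thesis using eb(1) by linarith
    qed
    have lj: "l j > 0" using eb(3)[OF j] \<delta> by linarith
    have ub: "l 1 * l j \<le> (1 + \<delta>) * (1 + a) * (1 + \<delta>)"
      using eb(2) eb(4)[OF j] lj \<delta> a by (intro mult_mono) auto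
    have lb: "(1 - \<delta>) * (1 + a) * (1 - \<delta>) \<le> l 1 * l j"
      using eb(1) eb(3)[OF j] l1 \<delta> by (intro mult_mono) auto
    have "0 \<le> \<delta> * \<delta>" "0 \<le> \<delta> * \<delta> * \<delta>" using \<delta> by simp_all
    \<comment> \<open>These two inequalities in \<delta> convert the factors
      \<open>(1 + \<delta>)\<^sup>2\<close> and \<open>(1 - \<delta>)\<^sup>2\<close> into the error
      \<open>4 * \<delta>\<close>; the second uses \<open>\<delta> \<le> 1 / 4\<close>.\<close>
    have d1: "(1 - 4 * \<delta>) * ((1 + \<delta>) * (1 + \<delta>)) \<le> 1"
    proof -
      have "(1 - 4 * \<delta>) * ((1 + \<delta>) * (1 + \<delta>)) = 1 - 2 * \<delta> - 7 * (\<delta> * \<delta>) - 4 * (\<delta> * \<delta> * \<delta>)"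
        by (simp add: algebra_simps)
      then show ?thesis using \<delta> \<open>0 \<le> \<delta> * \<delta>\<close> \<open>0 \<le> \<delta> * \<delta> * \<delta>\<close> by linarith
    qed
    have d2: "1 \<le> (1 + 4 * \<delta>) * ((1 - \<delta>) * (1 - \<delta>))"
    proof -
      have "(1 + 4 * \<delta>) * ((1 - \<delta>) * (1 - \<delta>)) = 1 + \<delta> * (2 - 7 * \<delta> + 4 * (\<delta> * \<delta>))"
        by (simp add: algebra_simps)
      moreover have "0 \<le> 2 - 7 * \<delta> + 4 * (\<delta> * \<delta>)" using \<delta> \<open>0 \<le> \<delta> * \<delta>\<close> by linarith
      ultimately show ?thesis using \<delta> by simp
    qed
    have "(1 - 4 * \<delta>) * (l 1 * l j) \<le> (1 - 4 * \<delta>) * ((1 + \<delta>) * (1 + a) * (1 + \<delta>))"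
      using ub \<delta> by (intro mult_left_mono) auto
    also have "\<dots> = (1 - 4 * \<delta>) * ((1 + \<delta>) * (1 + \<delta>)) * (1 + a)" by (simp add: mult_ac)
    also have "\<dots> \<le> 1 * (1 + a)" using d1 a by (intro mult_right_mono) auto
    finally have "1 - 4 * \<delta> \<le> q j" using l1 lj by (simp add: q_def pos_le_divide_eq)
    have "1 * (1 + a) \<le> (1 + 4 * \<delta>) * ((1 - \<delta>) * (1 - \<delta>)) * (1 + a)" using d2 a by (intro mult_right_mono) auto
    also have "\<dots> = (1 + 4 * \<delta>) * ((1 - \<delta>) * (1 + a) * (1 - \<delta>))" by (simp add: mult_ac)
    also have "\<dots> \<le> (1 + 4 * \<delta>) * (l 1 * l j)" using lb \<delta> by (intro mult_left_mono) auto
    finally have "q j \<le> 1 + 4 * \<delta>" using l1 lj by (simp add: q_def pos_divide_le_eq)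
    have "\<bar>q j - 1\<bar> \<le> 4 * \<delta>" using \<open>1 - 4 * \<delta> \<le> q j\<close> \<open>q j \<le> 1 + 4 * \<delta>\<close> by (simp add: abs_le_iff)
    then show "\<bar>(q j - 1) * (real n * (g j \<bullet> s)\<^sup>2)\<bar> \<le> 4 * \<delta> * (real n * (g j \<bullet> s)\<^sup>2)"
      unfolding abs_mult by (intro mult_mono) auto
  qed
  also have "\<dots> = 4 * \<delta> * leading_term \<theta> n y" by (simp add: W sum_distrib_left)
  finally show "\<bar>Q_HPV \<theta> n x l h - leading_term \<theta> n y\<bar> \<le> 4 * \<delta> * leading_term \<theta> n y" .
qed

text \<open>Affine invariance: the form equals \<open>d \<bullet> z\<close>, where \<open>z\<close>
  solves \<open>sample_cov n y *v z = d\<close>, and near-identity of that matrix keeps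
  \<open>z\<close> close to \<open>d\<close>.\<close>

lemma mahalanobis_sample_cov:
  assumes "i \<in> {1..n}"
  defines "d \<equiv> y i - sample_mean n y"
  shows "\<bar>(x i - sample_mean n x) \<bullet> (matrix_inv (sample_cov n x) *v (x i - sample_mean n x)) - d \<bullet> d\<bar> \<le> 2 * \<delta> * (d \<bullet> d)"
proof -
  let ?S = "sample_cov n x"
  have "inj ((*v) ?S)"
  proof (rule linear_injective_0[OF matrix_vector_mul_linear, THEN iffD2], intro allI impI)
    fix z assume "?S *v z = 0"
    then have "(1 - \<delta>) * (z \<bullet> z + a * (\<theta> \<bullet> z)\<^sup>2) \<le> 0" using sample_cov_quadratic_form(1)[of z] by simp
    then have "z \<bullet> z + a * (\<theta> \<bullet> z)\<^sup>2 \<le> 0" using \<delta> by (simp add: mult_le_0_iff)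
    moreover have "0 \<le> a * (\<theta> \<bullet> z)\<^sup>2" using a by simp
    ultimately have "z \<bullet> z \<le> 0" by linarith
    then show "z = 0" by (metis inner_ge_zero antisym inner_eq_zero_iff)
  qed
  then obtain S' where S': "S' ** ?S = mat 1" using matrix_left_invertible_injective by blast
  then have "?S ** S' = mat 1" by (simp add: matrix_left_right_inverse)
  then have inv: "?S ** matrix_inv ?S = mat 1" using S' matrix_inv_eqI by blast
  have xd: "x i - sample_mean n x = R *v d"
    using assms by (simp add: xy sample_mean_spiked d_def matrix_vector_mult_diff_distrib)
  define w where "w = matrix_inv ?S *v (R *v d)"
  have "?S *v w = R *v d" 
    unfolding w_def matrix_vector_mul_assoc[of ?S "matrix_inv ?S"] inv by simp
  then have "spiked_iroot \<theta> a *v (R *v (sample_cov n y *v (R *v w))) = spiked_iroot \<theta> a *v (R *v d)"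
    by (simp add: sample_cov_spiked)
  then have Bz: "sample_cov n y *v (R *v w) = d"
    by (simp add: matrix_vector_mul_assoc[of "spiked_iroot \<theta> a"] spiked_root_iroot[OF \<theta> a] del: matrix_vector_mul_assoc)
  define z where "z = R *v w"
  have q: "(x i - sample_mean n x) \<bullet> (matrix_inv ?S *v (x i - sample_mean n x)) = d \<bullet> z"
    by (simp add: xd w_def[symmetric] z_def root_sym)
  have dz: "norm (d - z) \<le> \<delta> * norm z" using near[of z] Bz by (simp add: z_def)
  \<comment> \<open>Turns the error bound relative to \<open>z\<close> into one relative to
    \<open>d\<close>, by absorbing a quarter of \<open>norm z\<close>.\<close>
  have "norm z \<le> norm d + norm (d - z)" using norm_triangle_ineq4[of d "d - z"] by simp
  then have "norm z \<le> norm d + 1 / 4 * norm z" using dz \<delta> mult_right_mono[of \<delta> "1/4" "norm z"] by simp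
  then have "norm z \<le> 2 * norm d" using norm_ge_zero[of d] by linarith
  then have dz2: "norm (d - z) \<le> \<delta> * (2 * norm d)" using dz \<delta> mult_left_mono order_trans by blast
  have "\<bar>d \<bullet> z - d \<bullet> d\<bar> = \<bar>d \<bullet> (d - z)\<bar>" by (simp add: inner_diff_right abs_minus_commute)
  also have "\<dots> \<le> norm d * (\<delta> * (2 * norm d))"
    by (rule order_trans[OF Cauchy_Schwarz_ineq2 mult_left_mono[OF dz2]]) simp
  also have "\<dots> = 2 * \<delta> * (d \<bullet> d)" by (simp add: dot_square_norm power2_eq_square)
  finally show ?thesis by (simp add: q)
qed

text \<open>Replacing the Mahalanobis form by the squared length of the centred vector costs 48, and
  removing the centring costs 8; 62 bounds their sum.\<close>

lemma kurtosis_est_near: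
  assumes m: "norm (sample_mean n y) \<le> \<delta>"
  defines "K \<equiv> (\<Sum>i=1..n. norm (y i) ^ 4) / real n"
  shows "\<bar>1 + kurtosis_est n x - K / (real CARD('p) * (real CARD('p) + 2))\<bar> \<le> 62 * \<delta> * (1 + K)"
proof -
  define q where "q = (\<lambda>i. (x i - sample_mean n x) \<bullet> (matrix_inv (sample_cov n x) *v (x i - sample_mean n x)))"
  have each: "\<bar>(q i)\<^sup>2 - norm (y i) ^ 4\<bar> \<le> 62 * \<delta> * (1 + norm (y i) ^ 4)" if i: "i \<in> {1..n}" for i
  proof -
    define d b c where "d = y i - sample_mean n y" and "b = norm (y i)" and "c = norm d"
    have b0: "b \<ge> 0" "c \<ge> 0" by (auto simp: b_def c_def)
    have cb: "\<bar>c - b\<bar> \<le> \<delta>"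
      using norm_triangle_ineq3[of d "y i"] m by (simp add: c_def b_def d_def)
    then have cb1: "c \<le> b + 1" using \<delta> by linarith
    have dd: "d \<bullet> d = c\<^sup>2" by (simp add: c_def dot_square_norm)
    have q1: "\<bar>q i - c\<^sup>2\<bar> \<le> 2 * \<delta> * c\<^sup>2"
      using mahalanobis_sample_cov[OF i] by (simp add: q_def d_def[symmetric] dd)
    \<comment> \<open>Convexity of the fourth power, through two applications of the bound for
      squares.\<close>
    have b4: "(b + 1) ^ 4 \<le> 8 * (1 + b ^ 4)"
    proof -
      have s: "(u + v)\<^sup>2 \<le> 2 * (u\<^sup>2 + v\<^sup>2)" for u v :: real
        using zero_le_power2[of "u - v"] by (simp add: power2_eq_square algebra_simps)
      have "(b + 1) ^ 4 = ((b + 1)\<^sup>2)\<^sup>2" by simp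
      also have "\<dots> \<le> (2 * (b\<^sup>2 + 1))\<^sup>2" using s[of b 1] by (intro power_mono) auto
      also have "\<dots> = 4 * (b\<^sup>2 + 1)\<^sup>2" by (simp only: power_mult_distrib) simp
      also have "\<dots> \<le> 4 * (2 * ((b\<^sup>2)\<^sup>2 + 1))" using s[of "b\<^sup>2" 1] by simp
      finally show ?thesis by simp
    qed
    have c4: "c ^ 4 \<le> 8 * (1 + b ^ 4)"
      using power_mono[OF cb1, of 4] b4 b0 by linarith
    have "(q i)\<^sup>2 - c ^ 4 = (q i - c\<^sup>2) * (q i - c\<^sup>2) + 2 * c\<^sup>2 * (q i - c\<^sup>2)"
      by (simp add: power2_eq_square power4_eq_xxxx algebra_simps)
    also have "\<bar>\<dots>\<bar> \<le> (2 * \<delta> * c\<^sup>2) * (2 * \<delta> * c\<^sup>2) + 2 * c\<^sup>2 * (2 * \<delta> * c\<^sup>2)"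
    proof (rule order_trans[OF abs_triangle_ineq add_mono])
      show "\<bar>(q i - c\<^sup>2) * (q i - c\<^sup>2)\<bar> \<le> (2 * \<delta> * c\<^sup>2) * (2 * \<delta> * c\<^sup>2)"
        unfolding abs_mult using q1 \<delta> by (intro mult_mono) auto
      show "\<bar>2 * c\<^sup>2 * (q i - c\<^sup>2)\<bar> \<le> 2 * c\<^sup>2 * (2 * \<delta> * c\<^sup>2)"
        unfolding abs_mult using q1 by (intro mult_mono) auto
    qed
    also have "\<dots> = (4 * \<delta> * \<delta> + 4 * \<delta>) * c ^ 4" by (simp add: power2_eq_square power4_eq_xxxx algebra_simps)
    also have "\<dots> \<le> (6 * \<delta>) * (8 * (1 + b ^ 4))"
    proof (intro mult_mono c4)
      have "\<delta> * \<delta> \<le> \<delta> * (1 / 4)" using \<delta> by (intro mult_left_mono) auto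
      then show "4 * \<delta> * \<delta> + 4 * \<delta> \<le> 6 * \<delta>" using \<delta> by simp
    qed (use \<delta> b0 in auto)
    finally have 1: "\<bar>(q i)\<^sup>2 - c ^ 4\<bar> \<le> 48 * \<delta> * (1 + b ^ 4)" by (simp add: algebra_simps)
    have "\<bar>c ^ 4 - b ^ 4\<bar> = \<bar>c - b\<bar> * ((c + b) * (c\<^sup>2 + b\<^sup>2))"
    proof -
      have "c ^ 4 - b ^ 4 = (c - b) * ((c + b) * (c\<^sup>2 + b\<^sup>2))"
        by (simp add: power2_eq_square power4_eq_xxxx algebra_simps)
      then show ?thesis using b0 by (simp add: abs_mult)
    qed
    also have "\<dots> \<le> \<delta> * ((b + 1 + b) * ((b + 1)\<^sup>2 + b\<^sup>2))"
      using cb cb1 b0 \<delta> by (intro mult_mono add_mono power_mono) auto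
    \<comment> \<open>The factorization of a difference of fourth powers, read backwards with
      \<open>c\<close> replaced by \<open>b + 1\<close>.\<close>
    also have "(b + 1 + b) * ((b + 1)\<^sup>2 + b\<^sup>2) = (b + 1) ^ 4 - b ^ 4"
      by (simp add: power2_eq_square power4_eq_xxxx algebra_simps)
    also have "\<delta> * ((b + 1) ^ 4 - b ^ 4) \<le> \<delta> * (8 * (1 + b ^ 4))"
    proof (rule mult_left_mono)
      show "(b + 1) ^ 4 - b ^ 4 \<le> 8 * (1 + b ^ 4)"
        using b4 zero_le_power[OF b0(1), of 4] by linarith
    qed (use \<delta> in simp)
    finally have 2: "\<bar>c ^ 4 - b ^ 4\<bar> \<le> 8 * \<delta> * (1 + b ^ 4)" by (simp add: algebra_simps)
    have "0 \<le> \<delta> * (1 + b ^ 4)" using \<delta> b0 by simp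
    then show ?thesis using 1 2 unfolding b_def by linarith
  qed
  define T where "T = (\<Sum>i=1..n. (q i)\<^sup>2) / real n"
  have n0: "real n > 0" using n by simp
  have "\<bar>T - K\<bar> = \<bar>\<Sum>i=1..n. (q i)\<^sup>2 - norm (y i) ^ 4\<bar> / real n"
    by (simp add: T_def K_def sum_subtractf diff_divide_distrib[symmetric])
  also have "\<dots> \<le> (\<Sum>i=1..n. 62 * \<delta> * (1 + norm (y i) ^ 4)) / real n"
    using n0 by (intro divide_right_mono order_trans[OF sum_abs sum_mono[OF each]]) auto
  also have "\<dots> = 62 * \<delta> * (1 + K)"
    using n0 by (simp add: sum_distrib_left[symmetric] sum.distrib K_def field_simps)
  finally have TK: "\<bar>T - K\<bar> \<le> 62 * \<delta> * (1 + K)" .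
  define e where "e = real CARD('p) * (real CARD('p) + 2)"
  have "CARD('p) \<ge> 1" by (simp add: Suc_leI)
  then have e: "e \<ge> 1" unfolding e_def by (metis add_increasing2 mult_ge1_I of_nat_1 of_nat_mono zero_le_numeral)
  have "1 + kurtosis_est n x = T / e"
    by (simp add: kurtosis_est_def T_def e_def q_def mult_ac)
  then have "\<bar>1 + kurtosis_est n x - K / e\<bar> = \<bar>T - K\<bar> / e" using e by (simp add: diff_divide_distrib[symmetric])
  also have "\<dots> \<le> \<bar>T - K\<bar> / 1" using e by (intro divide_left_mono) auto
  finally show ?thesis using TK by (simp add: e_def)
qed

end

text \<open>Centring shifts \<open>s\<close> by a vector of length at most the squared norm of the
  sample mean, and \<open>sqrt n\<close> times that is small. Squaring lengths that differ by at
  most \<epsilon> gives the factor \<open>1 + V\<close>.\<close>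

lemma leading_term_uncentered:
  fixes \<theta> :: "real^'p"
  assumes \<theta>: "norm \<theta> = 1" and n: "n \<ge> 1"
    and m: "sqrt (real n) * norm (sample_mean n y) ^ 2 \<le> \<epsilon>" and \<epsilon>: "0 \<le> \<epsilon>" "\<epsilon> \<le> 1"
  defines "s \<equiv> (1 / real n) *\<^sub>R (\<Sum>i=1..n. (\<theta> \<bullet> y i) *\<^sub>R y i)"
  defines "V \<equiv> real n * (norm s ^ 2 - (\<theta> \<bullet> s)\<^sup>2)"
  shows "\<bar>leading_term \<theta> n y - V\<bar> \<le> 2 * \<epsilon> * (1 + V)" and "V \<ge> 0"
proof -
  define P where "P = (\<lambda>z. z - (\<theta> \<bullet> z) *\<^sub>R \<theta>)"
  have \<theta>\<theta>: "\<theta> \<bullet> \<theta> = 1" using \<theta> by (simp add: norm_eq_1)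
  have P: "norm (P z) ^ 2 = norm z ^ 2 - (\<theta> \<bullet> z)\<^sup>2" for z
    unfolding P_def power2_norm_eq_inner
    by (simp add: inner_diff_left inner_diff_right \<theta>\<theta> inner_commute power2_eq_square)
  define t where "t = sample_cov n y *v \<theta>"
  define w where "w = sample_mean n y"
  have ts: "t = s - (w \<bullet> \<theta>) *\<^sub>R w"
    unfolding t_def sample_cov_mult_vec_uncentered[OF n]
    by (simp add: s_def w_def scaleR_matrix_vector_assoc[symmetric] sum_matrix_vector_mult outer_prod_mult_vec inner_commute)
  define \<alpha> \<beta> where "\<alpha> = sqrt (real n) * norm (P s)" and "\<beta> = sqrt (real n) * norm (P t)"
  have V: "V = \<alpha>\<^sup>2" by (simp add: V_def \<alpha>_def power_mult_distrib P)
  then show "V \<ge> 0" by simp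
  have W: "leading_term \<theta> n y = \<beta>\<^sup>2" by (simp add: leading_term_def t_def[symmetric] \<beta>_def power_mult_distrib P)
  have "\<bar>norm (P t) - norm (P s)\<bar> \<le> norm (P t - P s)" by (rule norm_triangle_ineq3)
  also have "P t - P s = - ((w \<bullet> \<theta>) *\<^sub>R P w)"
    by (simp add: P_def ts inner_diff_right algebra_simps)
  also have "norm \<dots> = \<bar>w \<bullet> \<theta>\<bar> * norm (P w)" by simp
  also have "\<dots> \<le> (norm w * 1) * norm w"
  proof (intro mult_mono)
    show "\<bar>w \<bullet> \<theta>\<bar> \<le> norm w * 1" using Cauchy_Schwarz_ineq2[of w \<theta>] \<theta> by simp
    have "norm (P w) ^ 2 \<le> norm w ^ 2" by (simp add: P)
    then show "norm (P w) \<le> norm w" by (rule power2_le_imp_le) simp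
  qed auto
  finally have "sqrt (real n) * \<bar>norm (P t) - norm (P s)\<bar> \<le> sqrt (real n) * (norm w * norm w)"
    by (intro mult_left_mono) auto
  also have "\<dots> \<le> \<epsilon>" using m by (simp add: w_def power2_eq_square)
  also have "sqrt (real n) * \<bar>norm (P t) - norm (P s)\<bar> = \<bar>\<beta> - \<alpha>\<bar>"
    by (simp add: \<alpha>_def \<beta>_def abs_mult[symmetric] right_diff_distrib[symmetric]) (simp add: abs_mult)
  finally have ba: "\<bar>\<beta> - \<alpha>\<bar> \<le> \<epsilon>" .
  have \<alpha>0: "\<alpha> \<ge> 0" "\<beta> \<ge> 0" by (auto simp: \<alpha>_def \<beta>_def)
  have "\<bar>\<beta>\<^sup>2 - \<alpha>\<^sup>2\<bar> = \<bar>\<beta> - \<alpha>\<bar> * (\<beta> + \<alpha>)"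
  proof -
    have "\<beta>\<^sup>2 - \<alpha>\<^sup>2 = (\<beta> - \<alpha>) * (\<beta> + \<alpha>)" by (simp add: power2_eq_square algebra_simps)
    then show ?thesis using \<alpha>0 by (simp add: abs_mult)
  qed
  also have "\<dots> \<le> \<epsilon> * (2 * (1 + \<alpha>\<^sup>2))"
  proof (intro mult_mono ba)
    have "2 * \<alpha> \<le> 1 + \<alpha>\<^sup>2" using zero_le_power2[of "\<alpha> - 1"] by (simp add: power2_eq_square algebra_simps)
    moreover have "\<beta> + \<alpha> \<le> 2 * \<alpha> + 1" using ba \<epsilon> by linarith
    ultimately have "\<beta> + \<alpha> \<le> 2 + \<alpha>\<^sup>2" by linarith
    also have "\<dots> \<le> 2 * (1 + \<alpha>\<^sup>2)" by simp
    finally show "\<beta> + \<alpha> \<le> 2 * (1 + \<alpha>\<^sup>2)" .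
  qed (use \<epsilon> \<alpha>0 in auto)
  finally show "\<bar>leading_term \<theta> n y - V\<bar> \<le> 2 * \<epsilon> * (1 + V)" by (simp add: V W mult_ac)
qed

section \<open>Measurability and almost sure simplicity of the spectrum\<close>

lemma measurable_vec_components:
  fixes F :: "'a \<Rightarrow> 'b::euclidean_space^'n"
  assumes "\<And>i. (\<lambda>\<omega>. F \<omega> $ i) \<in> borel_measurable M"
  shows "F \<in> borel_measurable M"
proof (rule borel_measurable_euclidean_space[THEN iffD2], rule ballI)
  fix b :: "'b^'n" assume "b \<in> Basis"
  then obtain i c where "b = axis i c" by (auto simp: Basis_vec_def)
  then show "(\<lambda>\<omega>. F \<omega> \<bullet> b) \<in> borel_measurable M"
    using assms[of i] by (simp add: inner_axis borel_measurable_inner)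
qed

lemma measurable_vec_nth' [measurable (raw)]:
  fixes F :: "'a \<Rightarrow> 'b::euclidean_space^'n"
  assumes "F \<in> borel_measurable M"
  shows "(\<lambda>\<omega>. F \<omega> $ i) \<in> borel_measurable M"
  using borel_measurable_continuous_onI[OF continuous_on_component[OF continuous_on_id, of UNIV i]] assms
  by (rule measurable_compose[rotated])

lemma measurable_matrix_vector [measurable (raw)]:
  fixes A :: "'a \<Rightarrow> real^'n^'m"
  assumes "A \<in> borel_measurable M" "z \<in> borel_measurable M"
  shows "(\<lambda>\<omega>. A \<omega> *v z \<omega>) \<in> borel_measurable M"
  using assms by (intro measurable_vec_components) (simp add: matrix_vector_mul_component)

lemma measurable_det [measurable (raw)]:
  fixes A :: "'a \<Rightarrow> real^'n^'n"
  assumes "A \<in> borel_measurable M"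
  shows "(\<lambda>\<omega>. det (A \<omega>)) \<in> borel_measurable M"
  using borel_measurable_continuous_onI[OF continuous_on_det[OF continuous_on_id, of UNIV]] assms
  by (rule measurable_compose[rotated])

lemma measurable_outer_prod [measurable (raw)]:
  fixes u :: "'a \<Rightarrow> real^'n"
  assumes [measurable]: "u \<in> borel_measurable M" "w \<in> borel_measurable M"
  shows "(\<lambda>\<omega>. outer_prod (u \<omega>) (w \<omega>)) \<in> borel_measurable M"
  by (intro measurable_vec_components) (simp add: outer_prod_def)

lemma det_zero_iff_kernel: "det (A :: real^'n^'n) = 0 \<longleftrightarrow> (\<exists>x. x \<noteq> 0 \<and> A *v x = 0)"
proof -
  have "det A \<noteq> 0 \<longleftrightarrow> inj ((*v) A)"
    by (metis invertible_det_nz invertible_left_inverse matrix_left_invertible_injective)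
  also have "\<dots> \<longleftrightarrow> (\<forall>x. A *v x = 0 \<longrightarrow> x = 0)"
    by (rule linear_injective_0[OF matrix_vector_mul_linear])
  finally show ?thesis by blast
qed

text \<open>\<open>matrix_inv\<close> takes one and the same junk value on all singular matrices; on the others it is
  given by Cramer's rule.\<close>

lemma measurable_matrix_inv_vec [measurable (raw)]:
  fixes A :: "'a \<Rightarrow> real^'n^'n"
  assumes [measurable]: "A \<in> borel_measurable M" "z \<in> borel_measurable M"
  shows "(\<lambda>\<omega>. matrix_inv (A \<omega>) *v z \<omega>) \<in> borel_measurable M"
proof -
  have eq: "matrix_inv B *v y = (if det B = 0 then matrix_inv 0 *v y
      else (\<chi> k. det (\<chi> i j. if j = k then y $ i else B $ i $ j) / det B))" for B :: "real^'n^'n" and y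
  proof (cases "det B = 0")
    case True
    have "(C ** A' = mat 1 \<and> A' ** C = mat 1) = False" if "det C = 0" for C A' :: "real^'n^'n"
      using that by (metis invertible_def invertible_det_nz)
    then have "matrix_inv C = (SOME A'. False)" if "det C = 0" for C :: "real^'n^'n"
      unfolding matrix_inv_def by (simp only: that)
    moreover have "det (0 :: real^'n^'n) = 0"
      unfolding det_zero_iff_kernel by (intro exI[of _ "axis undefined 1"]) simp
    ultimately have "matrix_inv B = matrix_inv 0" using True by presburger
    then show ?thesis using True by simp
  next
    case False
    then obtain C where "B ** C = mat 1" "C ** B = mat 1" by (metis invertible_def invertible_det_nz)
    then have "B ** matrix_inv B = mat 1" using matrix_inv_eqI by blast
    then have "B *v (matrix_inv B *v y) = y" by (simp add: matrix_vector_mul_assoc)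
    then show ?thesis using cramer[OF False, of "matrix_inv B *v y" y] False by simp
  qed
  have "(\<lambda>\<omega>. \<chi> k. det (\<chi> i j. if j = k then z \<omega> $ i else A \<omega> $ i $ j) / det (A \<omega>)) \<in> borel_measurable M"
  proof (rule measurable_vec_components)
    fix k
    have "(\<lambda>\<omega>. (\<chi> i j. if j = k then z \<omega> $ i else A \<omega> $ i $ j) :: real^'n^'n) \<in> borel_measurable M"
    proof (intro measurable_vec_components)
      fix i j
      show "(\<lambda>\<omega>. ((\<chi> i j. if j = k then z \<omega> $ i else A \<omega> $ i $ j) :: real^'n^'n) $ i $ j) \<in> borel_measurable M"
        by (cases "j = k") simp_all
    qed
    then show "(\<lambda>\<omega>. (\<chi> k. det (\<chi> i j. if j = k then z \<omega> $ i else A \<omega> $ i $ j) / det (A \<omega>)) $ k) \<in> borel_measurable M"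
      by simp
  qed
  then have "(\<lambda>\<omega>. if det (A \<omega>) = 0 then matrix_inv 0 *v z \<omega>
      else (\<chi> k. det (\<chi> i j. if j = k then z \<omega> $ i else A \<omega> $ i $ j) / det (A \<omega>))) \<in> borel_measurable M"
    by measurable
  then show ?thesis by (simp only: eq[symmetric])
qed

lemma measurable_sample_mean:
  assumes [measurable]: "\<And>i. i \<in> {1..n} \<Longrightarrow> X i \<in> borel_measurable M"
  shows "(\<lambda>\<omega>. sample_mean n (\<lambda>i. X i \<omega>)) \<in> borel_measurable M"
  unfolding sample_mean_def by measurable

lemma measurable_sample_cov:
  assumes [measurable]: "\<And>i. i \<in> {1..n} \<Longrightarrow> X i \<in> borel_measurable M"
  shows "(\<lambda>\<omega>. sample_cov n (\<lambda>i. X i \<omega>)) \<in> borel_measurable M"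
proof -
  note [measurable] = measurable_sample_mean[OF assms]
  show ?thesis unfolding sample_cov_def by measurable
qed

lemma measurable_kurtosis_est:
  assumes [measurable]: "\<And>i. i \<in> {1..n} \<Longrightarrow> X i \<in> borel_measurable M"
  shows "(\<lambda>\<omega>. kurtosis_est n (\<lambda>i. X i \<omega>)) \<in> borel_measurable M"
proof -
  note [measurable] = measurable_sample_mean[OF assms] measurable_sample_cov[OF assms]
  show ?thesis unfolding kurtosis_est_def by measurable
qed

lemma measurable_gram_schmidt:
  assumes "\<And>j. j \<in> {1..p} \<Longrightarrow> h j \<in> borel_measurable M" and "j \<in> {1..p}"
  shows "(\<lambda>\<omega>. gram_schmidt \<theta> (\<lambda>j. h j \<omega>) j) \<in> borel_measurable M"
  using assms(2)
proof (induction j rule: less_induct)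
  case (less j)
  have [measurable]: "(\<lambda>\<omega>. gram_schmidt \<theta> (\<lambda>j. h j \<omega>) k) \<in> borel_measurable M" if "k \<in> {2..<j}" for k
    using less that by auto
  have [measurable]: "h j \<in> borel_measurable M" using assms less by auto
  show ?case by (subst gram_schmidt.simps) (unfold Let_def, measurable)
qed

text \<open>Only the eigenvectors are assumed measurable; the eigenvalues are recovered as Rayleigh
  quotients.\<close>

lemma measurable_Q_HPV:
  fixes X :: "nat \<Rightarrow> 'a \<Rightarrow> real^'p"
  assumes X[measurable]: "\<And>i. i \<in> {1..n} \<Longrightarrow> X i \<in> borel_measurable M"
    and h[measurable]: "\<And>j. j \<in> {1..CARD('p)} \<Longrightarrow> h j \<in> borel_measurable M"
    and es: "\<And>\<omega>. \<omega> \<in> space M \<Longrightarrow> eigen_system (sample_cov n (\<lambda>i. X i \<omega>)) (\<lambda>j. l j \<omega>) (\<lambda>j. h j \<omega>)"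
  shows "(\<lambda>\<omega>. Q_HPV \<theta> n (\<lambda>i. X i \<omega>) (\<lambda>j. l j \<omega>) (\<lambda>j. h j \<omega>)) \<in> borel_measurable M"
proof -
  note [measurable] = measurable_sample_cov[OF X]
  have l[measurable]: "l j \<in> borel_measurable M" if j: "j \<in> {1..CARD('p)}" for j
  proof -
    have "(\<lambda>\<omega>. h j \<omega> \<bullet> (sample_cov n (\<lambda>i. X i \<omega>) *v h j \<omega>)) \<in> borel_measurable M"
      using j by measurable
    moreover have "h j \<omega> \<bullet> (sample_cov n (\<lambda>i. X i \<omega>) *v h j \<omega>) = l j \<omega>" if "\<omega> \<in> space M" for \<omega>
      using es[OF that] j by (auto simp: eigen_system_def norm_eq_1)
    ultimately show ?thesis by (subst (asm) measurable_cong) auto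
  qed
  have [measurable]: "l 1 \<in> borel_measurable M" by (rule l) (simp add: Suc_leI)
  note [measurable] = measurable_gram_schmidt[OF h, of "CARD('p)"]
  show ?thesis unfolding Q_HPV_def by measurable
qed

section \<open>Krylov vectors and almost sure cyclicity\<close>

definition krylov :: "real^'p^'p \<Rightarrow> real^'p \<Rightarrow> nat \<Rightarrow> real^'p" where
  "krylov S \<theta> k = ((\<lambda>z. S *v z) ^^ k) \<theta>"

lemma krylov_simps: "krylov S \<theta> 0 = \<theta>" "krylov S \<theta> (Suc k) = S *v krylov S \<theta> k"
  by (simp_all add: krylov_def)

text \<open>The index type carries no order, so \<kappa> says which power of \<open>S\<close>
  produces which row.\<close>

definition krylov_matrix :: "('p \<Rightarrow> nat) \<Rightarrow> real^'p^'p \<Rightarrow> real^'p \<Rightarrow> real^'p^'p" where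
  "krylov_matrix \<kappa> S \<theta> = (\<chi> i j. krylov S \<theta> (\<kappa> i) $ j)"

lemma krylov_matrix_mult: "(krylov_matrix \<kappa> S \<theta> *v x) $ i = krylov S \<theta> (\<kappa> i) \<bullet> x"
  by (simp add: krylov_matrix_def matrix_vector_mul_component)

text \<open>By symmetry, powers of \<open>S\<close> act on an eigenvector as scalars, so an
  eigenvector orthogonal to \<theta> is orthogonal to all Krylov vectors.\<close>

lemma cyclic_vec_krylov:
  assumes sym: "transpose S = S" and "det (krylov_matrix \<kappa> S \<theta>) \<noteq> 0"
  shows "cyclic_vec S \<theta>"
  unfolding cyclic_vec_def
proof (intro allI impI)
  fix x c assume x: "S *v x = c *\<^sub>R x" "x \<bullet> \<theta> = 0"
  have "krylov S \<theta> k \<bullet> x = 0" for k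
  proof (induction k)
    case 0 show ?case using x(2) by (simp add: krylov_simps inner_commute)
  next
    case (Suc k) then show ?case by (simp add: krylov_simps symmetric_inner[OF sym] x(1))
  qed
  then have "krylov_matrix \<kappa> S \<theta> *v x = 0" by (simp add: vec_eq_iff krylov_matrix_mult)
  then show "x = 0" using assms(2) det_zero_iff_kernel by blast
qed

lemma orthonormal_frame:
  fixes \<theta> :: "real^'p"
  assumes "norm \<theta> = 1"
  obtains e :: "nat \<Rightarrow> real^'p" where "e 0 = \<theta>"
    "\<And>i j. i < CARD('p) \<Longrightarrow> j < CARD('p) \<Longrightarrow> e i \<bullet> e j = (if i = j then 1 else 0)"
proof -
  obtain S where S: "\<theta> \<in> S" "pairwise orthogonal S" "\<And>x. x \<in> S \<Longrightarrow> norm x = 1"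
    "independent S" "card S = CARD('p)"
    using vector_in_orthonormal_basis[OF assms] by force
  have fin: "finite (S - {\<theta>})" using S(4) by (simp add: finiteI_independent)
  have card: "card (S - {\<theta>}) = CARD('p) - 1" using S(1,5) by simp
  obtain g where g: "bij_betw g {0..<CARD('p) - 1} (S - {\<theta>})"
    using ex_bij_betw_nat_finite[OF fin] card by auto
  define e where "e = (\<lambda>k. if k = 0 then \<theta> else g (k - 1))"
  have gS: "g k \<in> S - {\<theta>}" if "k < CARD('p) - 1" for k using g that by (auto simp: bij_betw_def)
  have eS: "e k \<in> S" if "k < CARD('p)" for k using gS[of "k - 1"] S(1) that by (auto simp: e_def)
  have inj: "e i \<noteq> e j" if "i < CARD('p)" "j < CARD('p)" "i \<noteq> j" for i j
  proof (cases "i = 0 \<or> j = 0")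
    case True then show ?thesis using gS[of "i - 1"] gS[of "j - 1"] that
      diff_less_mono[of i "CARD('p)" 1] diff_less_mono[of j "CARD('p)" 1] by (auto simp: e_def)
  next
    case False
    then have "i - 1 \<noteq> j - 1" "i - 1 < CARD('p) - 1" "j - 1 < CARD('p) - 1" using that by auto
    then have "g (i - 1) \<noteq> g (j - 1)" using g by (intro inj_on_contraD[of g "{0..<CARD('p) - 1}"]) (auto simp: bij_betw_def)
    then show ?thesis using False by (simp add: e_def)
  qed
  show thesis
  proof (rule that[of e])
    fix i j assume ij: "i < CARD('p)" "j < CARD('p)"
    show "e i \<bullet> e j = (if i = j then 1 else 0)"
      using S(2,3) eS[OF ij(1)] eS[OF ij(2)] inj[OF ij]
      by (auto simp: pairwise_def orthogonal_def norm_eq_1)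
  qed (simp add: e_def)
qed

text \<open>A sample whose covariance matrix is tridiagonal in an orthonormal basis starting with
  \<open>\<theta>\<close>, with nonzero off-diagonal entries, so that the Krylov vectors of \<open>\<theta>\<close> are independent.\<close>

lemma exists_krylov_sample:
  fixes \<theta> :: "real^'p"
  assumes \<theta>: "norm \<theta> = 1" and n: "n \<ge> 2 * CARD('p)" and \<kappa>: "bij_betw \<kappa> (UNIV :: 'p set) {..<CARD('p)}"
  obtains z where "z \<in> extensional {1..n}" "det (krylov_matrix \<kappa> (sample_cov n z) \<theta>) \<noteq> 0"
proof -
  obtain e :: "nat \<Rightarrow> real^'p" where e0: "e 0 = \<theta>"
    and e: "\<And>i j. i < CARD('p) \<Longrightarrow> j < CARD('p) \<Longrightarrow> e i \<bullet> e j = (if i = j then 1 else 0)"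
    using orthonormal_frame[OF \<theta>] by metis
  define m where "m = CARD('p) - 1"
  define w where "w = (\<lambda>k. e k + e (Suc k))"
  \<comment> \<open>Pairs \<open>- w k\<close>, \<open>w k\<close> make the mean zero, so that the
    covariance is \<open>2 / n\<close> times the sum of the projections along the
    \<open>w k\<close>. They occupy \<open>2 * (p - 1)\<close> places and the remaining observations
    are 0.\<close>
  define z where "z = (\<lambda>i\<in>{1..n}. if i \<le> 2 * m then (-1) ^ i *\<^sub>R w ((i - 1) div 2) else 0)"
  have z1: "z (2 * k + 1) = - w k" "z (2 * k + 2) = w k" if "k < m" for k
    using that n by (auto simp: z_def m_def)
  have z0: "z i = 0" if "i \<in> {1..n}" "i > 2 * m" for i using that by (auto simp: z_def)
  have split: "(\<Sum>i=1..n. F (z i)) = (\<Sum>k<m. F (- w k) + F (w k))" if "F 0 = 0" for F :: "real^'p \<Rightarrow> real^'p"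
  proof -
    have "(\<Sum>i=1..n. F (z i)) = (\<Sum>i=1..2 * m. F (z i))"
      using n that z0 by (intro sum.mono_neutral_right) (auto simp: m_def)
    also have "(\<Sum>i=1..2 * k. F (z i)) = (\<Sum>k<k. F (- w k) + F (w k))" if "k \<le> m" for k
      using that
    proof (induction k)
      case (Suc k)
      have "{1..2 * Suc k} = insert (2 * k + 2) (insert (2 * k + 1) {1..2 * k})" by auto
      then show ?case using Suc z1[of k] by (simp add: add_ac)
    qed simp
    finally show ?thesis by simp
  qed
  have mean: "sample_mean n z = 0"
    using split[of "\<lambda>x. x"] by (simp add: sample_mean_def)
  define S where "S = sample_cov n z"
  have S: "S *v u = (2 / real n) *\<^sub>R (\<Sum>k<m. (w k \<bullet> u) *\<^sub>R w k)" for u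
  proof -
    have "(- w k \<bullet> u) *\<^sub>R - w k + (w k \<bullet> u) *\<^sub>R w k = 2 *\<^sub>R ((w k \<bullet> u) *\<^sub>R w k)" for k
      by (simp only: inner_minus_left scaleR_minus_left scaleR_minus_right minus_minus scaleR_2)
    then have "(\<Sum>k<m. (- w k \<bullet> u) *\<^sub>R - w k + (w k \<bullet> u) *\<^sub>R w k) = 2 *\<^sub>R (\<Sum>k<m. (w k \<bullet> u) *\<^sub>R w k)"
      by (simp only: scaleR_sum_right)
    then show ?thesis
      using split[of "\<lambda>x. (x \<bullet> u) *\<^sub>R x"] by (simp add: S_def sample_cov_mult_vec mean)
  qed
  have Se: "S *v e k = (2 / real n) *\<^sub>R (w k + (if k = 0 then 0 else w (k - 1)))" if k: "k < m" for k
  proof -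
    have "(\<Sum>l<m. (w l \<bullet> e k) *\<^sub>R w l) = (\<Sum>l<m. (if l = k then w l else 0) + (if Suc l = k then w l else 0))"
      using k by (intro sum.cong refl) (auto simp: w_def inner_add_left e m_def)
    also have "\<dots> = w k + (\<Sum>l<m. if Suc l = k then w l else 0)"
      using k by (simp add: sum.distrib)
    also have "(\<Sum>l<m. if Suc l = k then w l else 0) = (if k = 0 then 0 else w (k - 1))"
    proof (cases k)
      case (Suc j)
      then have "(\<Sum>l<m. if Suc l = k then w l else 0) = (\<Sum>l<m. if l = j then w l else 0)" by (intro sum.cong) auto
      then show ?thesis using Suc k by simp
    qed simp
    finally show ?thesis by (simp add: S)
  qed
  have "CARD('p) > 0" by simp
  then have n0: "real n > 0" using n by linarith
  \<comment> \<open>\<open>S *v e k\<close> is a positive multiple of \<open>e (Suc k)\<close> plus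
    a combination of \<open>e k\<close> and \<open>e (k - 1)\<close>, so each Krylov step reaches
    one new basis vector.\<close>
  have span: "e j \<in> span (krylov S \<theta> ` {..k})" if "j \<le> k" "k < CARD('p)" for j k
    using that
  proof (induction k arbitrary: j)
    case 0
    then show ?case by (simp add: e0 krylov_simps span_base)
  next
    case (Suc k)
    have k: "k < m" using Suc.prems by (simp add: m_def)
    have sub: "span (krylov S \<theta> ` {..k}) \<subseteq> span (krylov S \<theta> ` {..Suc k})"
      by (intro span_mono) auto
    have IH: "e i \<in> span (krylov S \<theta> ` {..Suc k})" if "i \<le> k" for i
      using Suc.IH[OF that] Suc.prems sub by auto
    have "S *v e k \<in> (*v) S ` span (krylov S \<theta> ` {..k})" using Suc.IH[of k] Suc.prems by auto
    also have "\<dots> = span ((*v) S ` krylov S \<theta> ` {..k})"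
      by (simp add: linear_span_image)
    also have "\<dots> \<subseteq> span (krylov S \<theta> ` {..Suc k})"
      by (intro span_mono) (auto simp: krylov_simps[symmetric])
    finally have 1: "S *v e k \<in> span (krylov S \<theta> ` {..Suc k})" .
    have 2: "(if k = 0 then 0 else w (k - 1)) \<in> span (krylov S \<theta> ` {..Suc k})"
      using IH[of "k - 1"] IH[of k] by (auto simp: w_def span_zero intro!: span_add)
    have "(real n / 2) *\<^sub>R (S *v e k) = w k + (if k = 0 then 0 else w (k - 1))"
      using n0 by (simp add: Se[OF k])
    then have "e (Suc k) = (real n / 2) *\<^sub>R (S *v e k) - (if k = 0 then 0 else w (k - 1)) - e k"
      by (simp add: w_def)
    then have "e (Suc k) \<in> span (krylov S \<theta> ` {..Suc k})"
      using 1 2 IH[of k] by (simp add: span_diff span_scale del: if_split)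
    then show ?case using IH Suc.prems by (cases "j = Suc k") auto
  qed
  have "det (krylov_matrix \<kappa> S \<theta>) \<noteq> 0"
  proof
    assume "det (krylov_matrix \<kappa> S \<theta>) = 0"
    then obtain x where x: "x \<noteq> 0" "krylov_matrix \<kappa> S \<theta> *v x = 0" using det_zero_iff_kernel by blast
    have kx: "krylov S \<theta> k \<bullet> x = 0" if "k < CARD('p)" for k
    proof -
      have "k \<in> range \<kappa>" using \<kappa> \<open>k < CARD('p)\<close> by (simp add: bij_betw_def)
      then obtain i where "\<kappa> i = k" by blast
      then show ?thesis using krylov_matrix_mult[of \<kappa> S \<theta> x i] x(2) by simp
    qed
    have "e k \<bullet> x = 0" if "k < CARD('p)" for k
    proof -
      have "orthogonal x y" if "y \<in> krylov S \<theta> ` {..k}" for y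
        using that kx \<open>k < CARD('p)\<close> by (auto simp: orthogonal_def inner_commute)
      then have "orthogonal x (e k)" by (rule orthogonal_to_span[OF span[OF order_refl that]])
      then show ?thesis by (simp add: orthogonal_def inner_commute)
    qed
    moreover have "(\<Sum>k<CARD('p). (e k \<bullet> x)\<^sup>2) = x \<bullet> x"
      by (rule orthonormal_parseval) (auto simp: e)
    ultimately show False using x(1) by simp
  qed
  then show thesis using that[of z] by (simp add: S_def z_def)
qed

lemma line_poly_component: "line_poly (\<lambda>x. (x i :: real^'p) $ j)"
  using line_poly_inner[of i "axis j 1 :: real^'p"] by (simp add: inner_axis)

lemma line_poly_krylov: "line_poly (\<lambda>x. krylov (sample_cov n x) \<theta> k $ i)"
proof (induction k arbitrary: i)
  case 0
  then show ?case by (simp add: krylov_simps line_poly_const)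
next
  case (Suc k)
  have mean: "line_poly (\<lambda>x. sample_mean n x $ i)" for i
  proof -
    have "sample_mean n x $ i = (1 / real n) * (\<Sum>k=1..n. x k $ i)" for x by (simp add: sample_mean_def)
    then show ?thesis by (simp only:) (intro line_poly_intros line_poly_component)
  qed
  have cov: "line_poly (\<lambda>x. sample_cov n x $ i $ j)" for i j
  proof -
    have "sample_cov n x $ i $ j
      = (1 / real n) * (\<Sum>k=1..n. (x k $ i - sample_mean n x $ i) * (x k $ j - sample_mean n x $ j))" for x
      by (simp add: sample_cov_def outer_prod_def)
    then show ?thesis by (simp only:) (intro line_poly_intros line_poly_component mean)
  qed
  have "krylov (sample_cov n x) \<theta> (Suc k) $ i = (\<Sum>j\<in>UNIV. sample_cov n x $ i $ j * krylov (sample_cov n x) \<theta> k $ j)" for x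
    by (simp add: krylov_simps matrix_vector_mult_def)
  then show ?case by (simp only:) (intro line_poly_intros cov Suc)
qed

text \<open>The Krylov determinant is polynomial in the data, and
  \<open>exists_krylov_sample\<close> exhibits a sample at which it is nonzero.\<close>

lemma AE_cyclic_vec_sample_cov:
  fixes \<theta> :: "real^'p"
  assumes N: "sigma_finite_measure N" "sets N = sets borel" "absolutely_continuous lborel N"
    and \<theta>: "norm \<theta> = 1" and n: "n \<ge> 2 * CARD('p)"
  shows "AE x in PiM {1..n} (\<lambda>_. N). cyclic_vec (sample_cov n x) \<theta>"
proof -
  obtain \<kappa> where \<kappa>: "bij_betw \<kappa> (UNIV :: 'p set) {..<CARD('p)}"
    using finite_same_card_bij[of "UNIV :: 'p set" "{..<CARD('p)}"] by auto
  obtain z where z: "z \<in> extensional {1..n}" "det (krylov_matrix \<kappa> (sample_cov n z) \<theta>) \<noteq> 0"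
    using exists_krylov_sample[OF \<theta> n \<kappa>] by blast
  let ?P = "PiM {1..n} (\<lambda>_. N)"
  have X: "(\<lambda>x. x i) \<in> borel_measurable ?P" if "i \<in> {1..n}" for i
    using measurable_component_singleton[OF that, of "\<lambda>_. N"] by (simp add: measurable_cong_sets[OF refl N(2)])
  note [measurable] = measurable_sample_cov[of n "\<lambda>i x. x i", OF X]
  have k[measurable]: "(\<lambda>x. krylov (sample_cov n x) \<theta> k) \<in> borel_measurable ?P" for k
  proof (induction k)
    case (Suc k)
    note [measurable] = Suc
    show ?case unfolding krylov_simps by measurable
  qed (simp add: krylov_simps)
  have "(\<lambda>x. krylov_matrix \<kappa> (sample_cov n x) \<theta>) \<in> borel_measurable ?P"
    by (intro measurable_vec_components) (simp only: krylov_matrix_def vec_lambda_beta measurable_vec_nth'[OF k])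
  then have "AE x in ?P. det (krylov_matrix \<kappa> (sample_cov n x) \<theta>) \<noteq> 0"
    using z by (intro AE_PiM_line_poly_nonzero[where z=z, OF N] line_poly_det measurable_det)
      (auto simp: krylov_matrix_def line_poly_krylov)
  then show ?thesis
    by eventually_elim (rule cyclic_vec_krylov[OF transpose_sample_cov])
qed

section \<open>Convergence of the leading term\<close>

lemma real_distribution_cdf_tail:
  assumes "real_distribution N" "e > 0"
  obtains K where "K \<ge> 0" "cdf N K > 1 - e"
proof -
  interpret real_distribution N by fact
  have "\<forall>\<^sub>F q in at_top. 1 - e < cdf N q" using cdf_lim_at_top_prob assms by (intro order_tendstoD) auto
  then have "\<forall>\<^sub>F q in at_top. 1 - e < cdf N q \<and> 0 \<le> q" using eventually_ge_at_top[of 0] by eventually_elim simp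
  then show thesis using that eventually_happens'[OF trivial_limit_at_top_linorder] by blast
qed

text \<open>Convergence in law keeps \<open>V\<close> below some \<open>K\<close> with high
  probability; there the relative bound with \<open>\<epsilon> / (1 + K)\<close> is an absolute
  bound \<epsilon>.\<close>

lemma whp_tight:
  assumes prob: "\<forall>n\<ge>1. prob_space (M n)"
    and V: "\<And>n. n \<ge> 1 \<Longrightarrow> V n \<in> borel_measurable (M n)"
    and N: "real_distribution N"
    and conv: "\<And>x. (\<lambda>n. measure (M n) {\<omega> \<in> space (M n). V n \<omega> \<le> x}) \<longlonglongrightarrow> cdf N x"
    and D: "\<And>\<epsilon>. \<epsilon> > 0 \<Longrightarrow> whp M (\<lambda>n \<omega>. \<bar>D n \<omega>\<bar> \<le> \<epsilon> * (1 + V n \<omega>))"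
    and "\<epsilon> > (0::real)"
  shows "whp M (\<lambda>n \<omega>. \<bar>D n \<omega>\<bar> \<le> \<epsilon>)"
  unfolding whp_def
proof (intro allI impI)
  fix e :: real assume e: "e > 0"
  obtain K where K: "K \<ge> 0" "cdf N K > 1 - e / 2" using real_distribution_cdf_tail[OF N, of "e / 2"] e by auto
  have "\<forall>\<^sub>F n in sequentially. measure (M n) {\<omega> \<in> space (M n). V n \<omega> \<le> K} > 1 - e / 2"
    using conv K(2) by (rule order_tendstoD)
  moreover have "\<forall>\<^sub>F n in sequentially. \<exists>B\<in>sets (M n). {\<omega> \<in> space (M n). \<not> \<bar>D n \<omega>\<bar> \<le> \<epsilon> / (1 + K) * (1 + V n \<omega>)} \<subseteq> B
      \<and> emeasure (M n) B \<le> ennreal (e / 2)"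
    using D[of "\<epsilon> / (1 + K)"] \<open>\<epsilon> > 0\<close> K e by (simp add: whp_def)
  ultimately show "\<forall>\<^sub>F n in sequentially. \<exists>B\<in>sets (M n). {\<omega> \<in> space (M n). \<not> \<bar>D n \<omega>\<bar> \<le> \<epsilon>} \<subseteq> B \<and> emeasure (M n) B \<le> ennreal e"
    using eventually_ge_at_top[of 1]
  proof eventually_elim
    case (elim n)
    interpret prob_space "M n" using prob elim by auto
    note [measurable] = V[OF elim(3)]
    obtain B where B: "B \<in> sets (M n)" "{\<omega> \<in> space (M n). \<not> \<bar>D n \<omega>\<bar> \<le> \<epsilon> / (1 + K) * (1 + V n \<omega>)} \<subseteq> B"
      "emeasure (M n) B \<le> ennreal (e / 2)" using elim(2) by auto
    let ?C = "{\<omega> \<in> space (M n). \<not> V n \<omega> \<le> K}"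
    have "prob ?C = 1 - prob {\<omega> \<in> space (M n). V n \<omega> \<le> K}" by (rule prob_neg) measurable
    then have "emeasure (M n) ?C \<le> ennreal (e / 2)"
      using elim(1) by (simp add: emeasure_eq_measure ennreal_leI)
    then have "emeasure (M n) B + emeasure (M n) ?C \<le> ennreal (e / 2) + ennreal (e / 2)"
      by (intro add_mono B)
    also have "\<dots> = ennreal e" using e by (simp add: ennreal_plus[symmetric] del: ennreal_plus)
    finally have le: "emeasure (M n) (B \<union> ?C) \<le> ennreal e"
      by (rule order_trans[OF emeasure_subadditive[OF B(1)], rotated]) measurable
    have "\<bar>D n \<omega>\<bar> \<le> \<epsilon>" if "\<omega> \<in> space (M n)" "\<omega> \<notin> B" "\<omega> \<notin> ?C" for \<omega>
    proof -
      have "\<bar>D n \<omega>\<bar> \<le> \<epsilon> / (1 + K) * (1 + V n \<omega>)" using B(2) that by blast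
      also have "\<dots> \<le> \<epsilon> / (1 + K) * (1 + K)" using that K \<open>\<epsilon> > 0\<close> by (intro mult_left_mono) auto
      finally show ?thesis using K by simp
    qed
    then show ?case using B(1) le by (intro bexI[of _ "B \<union> ?C"]) auto
  qed
qed

text \<open>The event for \<open>Q\<close> at \<open>x\<close> is enclosed between those for
  \<open>V\<close> at \<open>x - h\<close> and \<open>x + h\<close>, up to an event of small
  probability; continuity of \<open>G\<close> at \<open>x\<close> closes the gap.\<close>

lemma slutsky_cdf:
  assumes prob: "\<forall>n\<ge>1. prob_space (M n)"
    and V: "\<And>n. n \<ge> 1 \<Longrightarrow> V n \<in> borel_measurable (M n)" and Q: "\<And>n. n \<ge> 1 \<Longrightarrow> Q n \<in> borel_measurable (M n)"
    and conv: "\<And>x. (\<lambda>n. measure (M n) {\<omega> \<in> space (M n). V n \<omega> \<le> x}) \<longlonglongrightarrow> G x"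
    and G: "isCont G (x::real)"
    and near: "\<And>\<epsilon>. \<epsilon> > 0 \<Longrightarrow> whp M (\<lambda>n \<omega>. \<bar>Q n \<omega> - V n \<omega>\<bar> \<le> \<epsilon>)"
  shows "(\<lambda>n. measure (M n) {\<omega> \<in> space (M n). Q n \<omega> \<le> x}) \<longlonglongrightarrow> G x"
proof (rule LIMSEQ_I)
  fix e :: real assume e: "e > 0"
  obtain d where d: "d > 0" "\<And>y. \<bar>y - x\<bar> < d \<Longrightarrow> \<bar>G y - G x\<bar> < e / 3"
    using G e unfolding continuous_at_eps_delta by (metis dist_real_def divide_pos_pos zero_less_numeral)
  define h where "h = d / 2"
  have h: "h > 0" "\<bar>G (x + h) - G x\<bar> < e / 3" "\<bar>G (x - h) - G x\<bar> < e / 3"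
    using d by (auto simp: h_def)
  let ?m = "\<lambda>n P. measure (M n) {\<omega> \<in> space (M n). P \<omega>}"
  have "\<forall>\<^sub>F n in sequentially. ?m n (\<lambda>\<omega>. V n \<omega> \<le> x + h) < G (x + h) + e / 3"
    "\<forall>\<^sub>F n in sequentially. ?m n (\<lambda>\<omega>. V n \<omega> \<le> x - h) > G (x - h) - e / 3"
    "\<forall>\<^sub>F n in sequentially. ?m n (\<lambda>\<omega>. \<not> \<bar>Q n \<omega> - V n \<omega>\<bar> \<le> h) < e / 3"
    using order_tendstoD(2)[OF conv[of "x + h"], of "G (x + h) + e / 3"] order_tendstoD(1)[OF conv[of "x - h"], of "G (x - h) - e / 3"]
      order_tendstoD(2)[OF whp_measure_tendsto[OF near[OF h(1)]], of "e / 3"] e by auto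
  then have "\<forall>\<^sub>F n in sequentially. norm (?m n (\<lambda>\<omega>. Q n \<omega> \<le> x) - G x) < e"
    using eventually_ge_at_top[of 1]
  proof eventually_elim
    case (elim n)
    interpret prob_space "M n" using prob elim by auto
    note [measurable] = V[OF elim(4)] Q[OF elim(4)]
    have "?m n (\<lambda>\<omega>. Q n \<omega> \<le> x) \<le> prob ({\<omega> \<in> space (M n). V n \<omega> \<le> x + h} \<union> {\<omega> \<in> space (M n). \<not> \<bar>Q n \<omega> - V n \<omega>\<bar> \<le> h})"
      by (intro finite_measure_mono) auto
    also have "\<dots> \<le> ?m n (\<lambda>\<omega>. V n \<omega> \<le> x + h) + ?m n (\<lambda>\<omega>. \<not> \<bar>Q n \<omega> - V n \<omega>\<bar> \<le> h)"
      by (intro measure_Un_le) measurable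
    finally have 1: "?m n (\<lambda>\<omega>. Q n \<omega> \<le> x) < G x + e" using elim h by linarith
    have "?m n (\<lambda>\<omega>. V n \<omega> \<le> x - h) \<le> prob ({\<omega> \<in> space (M n). Q n \<omega> \<le> x} \<union> {\<omega> \<in> space (M n). \<not> \<bar>Q n \<omega> - V n \<omega>\<bar> \<le> h})"
      by (intro finite_measure_mono) auto
    also have "\<dots> \<le> ?m n (\<lambda>\<omega>. Q n \<omega> \<le> x) + ?m n (\<lambda>\<omega>. \<not> \<bar>Q n \<omega> - V n \<omega>\<bar> \<le> h)"
      by (intro measure_Un_le) measurable
    finally have 2: "?m n (\<lambda>\<omega>. Q n \<omega> \<le> x) > G x - e" using elim h by linarith
    show ?case using 1 2 by (simp add: abs_less_iff)
  qed
  then show "\<exists>n0. \<forall>n\<ge>n0. norm (?m n (\<lambda>\<omega>. Q n \<omega> \<le> x) - G x) < e"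
    by (simp add: eventually_sequentially)
qed

text \<open>Combines the three errors (weights, kurtosis estimate, centring) into one choice of
  \<delta>. The factors \<open>1 + V\<close> are kept for a later tightness argument.\<close>

lemma quotient_approximation:
  fixes \<gamma> C \<eta> :: real
  assumes \<gamma>: "\<gamma> > 0" and C: "C > 0" and \<eta>: "\<eta> > 0"
  obtains \<delta> where "0 < \<delta>" "\<delta> \<le> 1 / 4"
    "\<And>Q W g V. 0 \<le> W \<Longrightarrow> 0 \<le> V \<Longrightarrow> \<bar>Q - W\<bar> \<le> 4 * \<delta> * W \<Longrightarrow> \<bar>g - \<gamma>\<bar> \<le> C * \<delta> \<Longrightarrow> \<bar>W - V\<bar> \<le> 2 * \<delta> * (1 + V)
      \<Longrightarrow> \<bar>Q / g - V / \<gamma>\<bar> \<le> \<eta> * (1 + V / \<gamma>) \<and> \<bar>Q - V\<bar> \<le> \<eta> * (1 + V)"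
proof -
  \<comment> \<open>With \<open>W \<le> 2 * (1 + V)\<close> and \<open>g \<ge> \<gamma> / 2\<close>,
    the three parts of \<open>Q / g - V / \<gamma>\<close> contribute \<open>16 / \<gamma>\<close>,
    \<open>4 * C / \<gamma>\<^sup>2\<close> and \<open>2 / \<gamma>\<close>; the factor
    \<open>1 + \<gamma>\<close> replaces \<open>1 + V\<close> by
    \<open>1 + V / \<gamma>\<close>.\<close>
  define E where "E = (18 / \<gamma> + 4 * C / \<gamma>\<^sup>2) * (1 + \<gamma>)"
  have E: "E > 0" using \<gamma> C unfolding E_def by (intro mult_pos_pos add_pos_pos) auto
  \<comment> \<open>The four bounds serve, in this order: the earlier lemmas,
    \<open>g \<ge> \<gamma> / 2\<close>, the quotient, and \<open>\<bar>Q - V\<bar>\<close>, whose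
    error is \<open>8 + 2\<close> times \<delta>.\<close>
  define \<delta> where "\<delta> = min (min (1 / 4) (\<gamma> / (2 * C))) (min (\<eta> / E) (\<eta> / 10))"
  have \<delta>: "0 < \<delta>" "\<delta> \<le> 1 / 4" "C * \<delta> \<le> \<gamma> / 2" "\<delta> * E \<le> \<eta>" "10 * \<delta> \<le> \<eta>"
  proof -
    show "0 < \<delta>" using \<gamma> C \<eta> E by (simp add: \<delta>_def)
    show "\<delta> \<le> 1 / 4" unfolding \<delta>_def by (rule order_trans[OF min.cobounded1 min.cobounded1])
    have "\<delta> \<le> \<gamma> / (2 * C)" unfolding \<delta>_def by (rule order_trans[OF min.cobounded1 min.cobounded2])
    moreover have "\<delta> \<le> \<eta> / E" unfolding \<delta>_def by (rule order_trans[OF min.cobounded2 min.cobounded1])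
    moreover have "\<delta> \<le> \<eta> / 10" unfolding \<delta>_def by (rule order_trans[OF min.cobounded2 min.cobounded2])
    ultimately show "C * \<delta> \<le> \<gamma> / 2" "\<delta> * E \<le> \<eta>" "10 * \<delta> \<le> \<eta>" using C E by (auto simp: field_simps)
  qed
  have main: "\<bar>Q / g - V / \<gamma>\<bar> \<le> \<eta> * (1 + V / \<gamma>) \<and> \<bar>Q - V\<bar> \<le> \<eta> * (1 + V)"
    if W: "0 \<le> W" and V: "0 \<le> V" and QW: "\<bar>Q - W\<bar> \<le> 4 * \<delta> * W" and g: "\<bar>g - \<gamma>\<bar> \<le> C * \<delta>" and WV: "\<bar>W - V\<bar> \<le> 2 * \<delta> * (1 + V)"
    for Q W g V
  proof
    define T where "T = \<delta> * (1 + V)"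
    have "T \<le> 1 / 4 * (1 + V)" unfolding T_def using \<delta> V by (intro mult_right_mono) auto
    moreover have WT: "\<bar>W - V\<bar> \<le> 2 * T" using WV by (simp add: T_def mult.assoc)
    then have "W - V \<le> 2 * T" by (rule abs_le_D1)
    ultimately have W2: "W \<le> 2 * (1 + V)" using V by (simp add: algebra_simps)
    have QW2: "4 * \<delta> * W \<le> 4 * \<delta> * (2 * (1 + V))" using W2 \<delta> by (intro mult_left_mono) auto
    then have "4 * \<delta> * W \<le> 8 * T" by (simp add: T_def mult_ac)
    then have "\<bar>Q - V\<bar> \<le> 10 * T" using QW WT by linarith
    also have "10 * T = 10 * \<delta> * (1 + V)" by (simp add: T_def)
    also have "\<dots> \<le> \<eta> * (1 + V)" using \<delta> V by (intro mult_right_mono) auto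
    finally show "\<bar>Q - V\<bar> \<le> \<eta> * (1 + V)" .
    have g2: "g \<ge> \<gamma> / 2" using g \<delta>(3) by linarith
    then have g0: "g > 0" using \<gamma> by linarith
    have "Q / g - V / \<gamma> = (Q - W) / g + (\<gamma> - g) * W / (g * \<gamma>) + (W - V) / \<gamma>"
      using g0 \<gamma> by (simp add: field_simps)
    also have "\<bar>\<dots>\<bar> \<le> \<bar>Q - W\<bar> / g + \<bar>\<gamma> - g\<bar> * W / (g * \<gamma>) + \<bar>W - V\<bar> / \<gamma>"
    proof -
      have "\<bar>(Q - W) / g\<bar> = \<bar>Q - W\<bar> / g" "\<bar>(\<gamma> - g) * W / (g * \<gamma>)\<bar> = \<bar>\<gamma> - g\<bar> * W / (g * \<gamma>)" "\<bar>(W - V) / \<gamma>\<bar> = \<bar>W - V\<bar> / \<gamma>"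
        using g0 \<gamma> W by (simp_all add: abs_mult)
      moreover have "\<bar>x + y + z\<bar> \<le> \<bar>x\<bar> + \<bar>y\<bar> + \<bar>z\<bar>" for x y z :: real by arith
      ultimately show ?thesis by metis
    qed
    also have "\<bar>Q - W\<bar> / g \<le> (4 * \<delta> * (2 * (1 + V))) / (\<gamma> / 2)"
      using QW QW2 g2 \<gamma> by (intro frac_le) auto
    also have "\<bar>\<gamma> - g\<bar> * W / (g * \<gamma>) \<le> (C * \<delta>) * (2 * (1 + V)) / ((\<gamma> / 2) * \<gamma>)"
    proof (rule frac_le)
      show "\<bar>\<gamma> - g\<bar> * W \<le> (C * \<delta>) * (2 * (1 + V))"
        using g W W2 C \<delta> by (intro mult_mono) (auto simp: abs_minus_commute)
      show "(\<gamma> / 2) * \<gamma> \<le> g * \<gamma>" using g2 \<gamma> by (intro mult_right_mono) auto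
    qed (use \<gamma> C \<delta> V in auto)
    also have "\<bar>W - V\<bar> / \<gamma> \<le> 2 * \<delta> * (1 + V) / \<gamma>"
      using WV \<gamma> by (intro divide_right_mono) auto
    also have "(4 * \<delta> * (2 * (1 + V))) / (\<gamma> / 2) + (C * \<delta>) * (2 * (1 + V)) / ((\<gamma> / 2) * \<gamma>) + 2 * \<delta> * (1 + V) / \<gamma>
      = \<delta> * (18 / \<gamma> + 4 * C / \<gamma>\<^sup>2) * (1 + V)"
      using \<gamma> by (simp add: field_simps power2_eq_square)
    also have "\<dots> \<le> \<delta> * (18 / \<gamma> + 4 * C / \<gamma>\<^sup>2) * ((1 + \<gamma>) * (1 + V / \<gamma>))"
    proof (rule mult_left_mono)
      have "(1 + \<gamma>) * (1 + V / \<gamma>) = 1 + \<gamma> + V / \<gamma> + V" using \<gamma> by (simp add: field_simps)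
      moreover have "0 \<le> V / \<gamma>" using V \<gamma> by simp
      ultimately show "1 + V \<le> (1 + \<gamma>) * (1 + V / \<gamma>)" using \<gamma> by linarith
      show "0 \<le> \<delta> * (18 / \<gamma> + 4 * C / \<gamma>\<^sup>2)" using \<delta> \<gamma> C by simp
    qed
    also have "\<dots> = (\<delta> * E) * (1 + V / \<gamma>)" by (simp add: E_def mult_ac)
    also have "\<dots> \<le> \<eta> * (1 + V / \<gamma>)" using \<delta>(4) V \<gamma> by (intro mult_right_mono) auto
    finally show "\<bar>Q / g - V / \<gamma>\<bar> \<le> \<eta> * (1 + V / \<gamma>)" by simp
  qed
  show thesis by (rule that[OF \<delta>(1,2) main])
qed

lemma integrable_euclidean:
  fixes F :: "'a \<Rightarrow> 'b::euclidean_space"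
  assumes "\<And>b. b \<in> Basis \<Longrightarrow> integrable N (\<lambda>y. F y \<bullet> b)"
  shows "integrable N F"
proof -
  have "integrable N (\<lambda>y. \<Sum>b\<in>Basis. (F y \<bullet> b) *\<^sub>R b)"
    using assms by (intro Bochner_Integration.integrable_sum integrable_scaleR_left) auto
  then show ?thesis by (simp add: euclidean_representation)
qed

section \<open>Laws of large numbers and limit of the score for a spherical law\<close>

context
  fixes N :: "(real^'p) measure" and M :: "nat \<Rightarrow> 'a measure" and Y :: "nat \<Rightarrow> nat \<Rightarrow> 'a \<Rightarrow> real^'p"
  assumes N: "spherical_law N" and iid: "iid_array M Y N"
begin

lemma spherical_whp_mean:
  assumes "\<epsilon> > 0"
  shows "whp M (\<lambda>n \<omega>. norm (sample_mean n (\<lambda>i. Y n i \<omega>)) \<le> \<epsilon>)"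
proof -
  have int: "integrable N (\<lambda>y::real^'p. y)"
  proof (rule integrable_euclidean)
    fix b :: "real^'p"
    show "integrable N (\<lambda>y. y \<bullet> b)"
      using spherical_integrable_power[OF N, of 1 b] by (simp add: inner_commute)
  qed
  have "(\<integral>y. y \<partial>N) \<bullet> b = 0" for b
    using integral_inner_left[OF int, of b] spherical_mean[OF N, of b] by (simp add: inner_commute)
  from this[of "\<integral>y. y \<partial>N"] have "(\<integral>y. y \<partial>N) = 0" by simp
  then show ?thesis
    using iid_weak_law_vec[OF iid _ int assms] by (simp add: sample_mean_def)
qed

lemma spherical_whp_second_moment:
  assumes "\<epsilon> > 0"
  shows "whp M (\<lambda>n \<omega>. norm ((1 / real n) *\<^sub>R (\<Sum>i=1..n. outer_prod (Y n i \<omega>) (Y n i \<omega>)) - mat 1) \<le> \<epsilon>)"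
proof -
  have comp: "\<exists>i j. \<forall>A. (A :: real^'p^'p) \<bullet> b = A $ i $ j" if "b \<in> Basis" for b
    using that by (auto simp: Basis_vec_def inner_axis) (metis inner_axis inner_real_def mult.right_neutral)
  have c: "integrable N (\<lambda>y::real^'p. y $ i * y $ j)" "(\<integral>y. y $ i * y $ j \<partial>N) = mat 1 $ i $ j" for i j
  proof -
    show "integrable N (\<lambda>y::real^'p. y $ i * y $ j)"
      using spherical_integrable_mult_power[OF N, of 1 1 "axis i 1" "axis j 1"] by (simp add: inner_axis')
    have "(\<integral>y. y $ i * y $ j \<partial>N) = (\<integral>y. (axis i 1 \<bullet> y) * (axis j 1 \<bullet> y) \<partial>N)"
      by (simp add: inner_axis')
    also have "\<dots> = axis i 1 \<bullet> (axis j 1 :: real^'p)" by (rule spherical_cov[OF N])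
    also have "\<dots> = mat 1 $ i $ j" by (simp add: inner_axis_axis mat_def)
    finally show "(\<integral>y. y $ i * y $ j \<partial>N) = mat 1 $ i $ j" .
  qed
  have int: "integrable N (\<lambda>y. outer_prod y y :: real^'p^'p)"
  proof (rule integrable_euclidean)
    fix b :: "real^'p^'p" assume "b \<in> Basis"
    then obtain i j where "\<forall>A. A \<bullet> b = A $ i $ j" using comp by blast
    then show "integrable N (\<lambda>y. outer_prod y y \<bullet> b)" using c(1)[of i j] by (simp add: outer_prod_def)
  qed
  have "(\<integral>y. outer_prod y y \<partial>N) = (mat 1 :: real^'p^'p)"
  proof (rule euclidean_eqI)
    fix b :: "real^'p^'p" assume "b \<in> Basis"
    then obtain i j where ij: "\<forall>A. A \<bullet> b = A $ i $ j" using comp by blast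
    have "(\<integral>y. outer_prod y y \<partial>N) \<bullet> b = (\<integral>y. outer_prod y y \<bullet> b \<partial>N)"
      using integral_inner_left[OF int, of b] by simp
    also have "\<dots> = mat 1 $ i $ j" using c(2)[of i j] by (simp add: ij outer_prod_def)
    finally show "(\<integral>y. outer_prod y y \<partial>N) \<bullet> b = mat 1 \<bullet> b" by (simp add: ij)
  qed
  moreover have "(\<lambda>y. outer_prod y y :: real^'p^'p) \<in> borel_measurable borel"
    using borel_measurable_integrable[OF int] by (simp add: measurable_cong_sets[OF spherical_sets[OF N] refl])
  ultimately show ?thesis
    using iid_weak_law_vec[OF iid _ int assms] by simp
qed

lemma spherical_whp_fourth_moment:
  assumes "\<epsilon> > 0"
  shows "whp M (\<lambda>n \<omega>. \<bar>(\<Sum>i=1..n. norm (Y n i \<omega>) ^ 4) / real n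
    - kurtosis_factor N * (real CARD('p) * (real CARD('p) + 2))\<bar> \<le> \<epsilon>)"
proof -
  have "(\<integral>y. norm y ^ 4 \<partial>N) = kurtosis_factor N * (real CARD('p) * (real CARD('p) + 2))"
    by (simp add: kurtosis_factor_def add_pos_pos less_imp_neq[symmetric])
  moreover have "integrable N (\<lambda>y. norm y ^ 4)" using N by (simp add: spherical_law_def)
  ultimately show ?thesis using iid_weak_law[OF iid, of "\<lambda>y. norm y ^ 4"] assms by simp
qed

text \<open>The squared norm of the mean has expectation \<open>p / n\<close>, which still tends to
  zero after multiplication by \<open>sqrt n\<close>; Markov's inequality does the rest.\<close>

lemma spherical_whp_sqrt_mean:
  assumes "\<epsilon> > 0"
  shows "whp M (\<lambda>n \<omega>. sqrt (real n) * norm (sample_mean n (\<lambda>i. Y n i \<omega>)) ^ 2 \<le> \<epsilon>)"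
proof -
  define Z where "Z = (\<lambda>n \<omega>. sqrt (real n) * norm (sample_mean n (\<lambda>i. Y n i \<omega>)) ^ 2)"
  have Z: "Z n \<omega> = (\<Sum>b\<in>Basis. sqrt (real n) / (real n)\<^sup>2 * (\<Sum>i=1..n. Y n i \<omega> \<bullet> b)\<^sup>2)" for n \<omega>
  proof -
    have "norm x ^ 2 = (\<Sum>b\<in>Basis. (x \<bullet> b)\<^sup>2)" for x :: "real^'p"
      unfolding power2_norm_eq_inner by (subst euclidean_inner) (simp add: power2_eq_square)
    then show ?thesis
      by (simp add: Z_def sample_mean_def inner_sum_left power_mult_distrib power_divide sum_distrib_left sum_divide_distrib)
  qed
  have sq: "integrable (M n) (\<lambda>\<omega>. (\<Sum>i=1..n. Y n i \<omega> \<bullet> b)\<^sup>2)" "(\<integral>\<omega>. (\<Sum>i=1..n. Y n i \<omega> \<bullet> b)\<^sup>2 \<partial>M n) = real n"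
    if "n \<ge> 1" "b \<in> Basis" for n b
  proof -
    have 1: "integrable N (\<lambda>y. (y \<bullet> b)\<^sup>2)" using spherical_integrable_power[OF N, of 2 b] by (simp add: inner_commute)
    have 2: "(\<integral>y. y \<bullet> b \<partial>N) = 0" using spherical_mean[OF N, of b] by (simp add: inner_commute)
    have 3: "(\<integral>y. (y \<bullet> b)\<^sup>2 \<partial>N) = 1"
      using spherical_cov[OF N, of b b] that by (simp add: inner_commute power2_eq_square)
    show "integrable (M n) (\<lambda>\<omega>. (\<Sum>i=1..n. Y n i \<omega> \<bullet> b)\<^sup>2)" "(\<integral>\<omega>. (\<Sum>i=1..n. Y n i \<omega> \<bullet> b)\<^sup>2 \<partial>M n) = real n"
      using iid_sum_square[OF iid _ 1 2 that(1)] 3 by simp_all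
  qed
  have int: "integrable (M n) (Z n)" if "n \<ge> 1" for n
    unfolding Z using sq[OF that] by (intro Bochner_Integration.integrable_sum integrable_mult_right) auto
  have Z0: "Z n \<omega> \<ge> 0" for n \<omega> by (simp add: Z_def)
  have "(\<integral>\<omega>. \<bar>Z n \<omega>\<bar> \<partial>M n) = real CARD('p) / sqrt (real n)" if n: "n \<ge> 1" for n
  proof -
    have "(\<integral>\<omega>. \<bar>Z n \<omega>\<bar> \<partial>M n) = (\<integral>\<omega>. (\<Sum>b\<in>Basis. sqrt (real n) / (real n)\<^sup>2 * (\<Sum>i=1..n. Y n i \<omega> \<bullet> b)\<^sup>2) \<partial>M n)"
      using Z0 by (simp add: Z)
    also have "\<dots> = (\<Sum>b\<in>(Basis :: (real^'p) set). sqrt (real n) / (real n)\<^sup>2 * real n)"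
      using sq[OF n] by (subst Bochner_Integration.integral_sum) auto
    also have "\<dots> = real CARD('p) * (sqrt (real n) / (real n)\<^sup>2 * real n)" by simp
    also have "sqrt (real n) / (real n)\<^sup>2 * real n = 1 / sqrt (real n)"
      using n by (simp add: power2_eq_square field_simps)
    finally show ?thesis by simp
  qed
  moreover have "(\<lambda>n. real CARD('p) / sqrt (real n)) \<longlonglongrightarrow> 0"
    by (intro tendsto_divide_0[OF tendsto_const] filterlim_at_top_imp_at_infinity
        filterlim_compose[OF sqrt_at_top filterlim_real_sequentially])
  ultimately have "(\<lambda>n. \<integral>\<omega>. \<bar>Z n \<omega>\<bar> \<partial>M n) \<longlonglongrightarrow> 0"
    by (subst tendsto_cong[OF eventually_sequentiallyI[of 1]]) auto
  from whp_markov[OF iid_prob[OF iid] int this assms] show ?thesis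
  proof (rule whp_mono)
    fix n \<omega> assume "\<bar>Z n \<omega>\<bar> \<le> \<epsilon>"
    then have "Z n \<omega> \<le> \<epsilon>" by simp
    then show "sqrt (real n) * norm (sample_mean n (\<lambda>i. Y n i \<omega>)) ^ 2 \<le> \<epsilon>" by (simp only: Z_def)
  qed
qed

text \<open>The numerator is \<open>n\<close> times the squared norm of the projection of \<open>s\<close> on the orthogonal complement of
  \<open>\<theta>\<close>; the coordinates of this projection are the sums to which the central limit theorem applies.\<close>

lemma spherical_score_conv:
  fixes \<theta> :: "real^'p"
  assumes \<theta>: "norm \<theta> = 1" and p: "CARD('p) \<ge> 2"
  defines "s \<equiv> \<lambda>n \<omega>. (1 / real n) *\<^sub>R (\<Sum>i=1..n. (\<theta> \<bullet> Y n i \<omega>) *\<^sub>R Y n i \<omega>)"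
  defines "V \<equiv> \<lambda>n \<omega>. real n * (norm (s n \<omega>) ^ 2 - (\<theta> \<bullet> s n \<omega>)\<^sup>2) / kurtosis_factor N"
  shows "(\<lambda>n. measure (M n) {\<omega> \<in> space (M n). V n \<omega> \<le> x}) \<longlonglongrightarrow> cdf (chi_square (CARD('p) - 1)) x"
    and "\<And>n. n \<ge> 1 \<Longrightarrow> V n \<in> borel_measurable (M n)"
proof -
  define \<gamma> where "\<gamma> = kurtosis_factor N"
  have \<gamma>: "\<gamma> > 0" unfolding \<gamma>_def by (rule spherical_kurtosis_pos[OF N])
  define k where "k = CARD('p) - 1"
  obtain e :: "nat \<Rightarrow> real^'p" where e0: "e 0 = \<theta>"
    and e: "\<And>i j. i < CARD('p) \<Longrightarrow> j < CARD('p) \<Longrightarrow> e i \<bullet> e j = (if i = j then 1 else 0)"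
    using orthonormal_frame[OF \<theta>] by metis
  define b where "b = (\<lambda>j. e (Suc j))"
  have b: "b i \<bullet> b j = (if i = j then 1 else 0)" "b i \<bullet> \<theta> = 0" if "i < k" "j < k" for i j
    using e[of "Suc i" "Suc j"] e[of "Suc i" 0] that by (auto simp: b_def k_def e0)
  define Z where "Z = (\<lambda>n j \<omega>. (\<Sum>i=1..n. (b j \<bullet> Y n i \<omega>) * (\<theta> \<bullet> Y n i \<omega>) / sqrt \<gamma>) / sqrt (real n))"
  have VZ: "V n \<omega> = (\<Sum>j<k. (Z n j \<omega>)\<^sup>2)" if n: "n \<ge> 1" for n \<omega>
  proof -
    have "s n \<omega> \<bullet> s n \<omega> = (\<Sum>j<CARD('p). (e j \<bullet> s n \<omega>)\<^sup>2)"
      by (rule orthonormal_parseval[symmetric]) (auto simp: e)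
    also have "CARD('p) = Suc k" by (simp add: k_def)
    also have "(\<Sum>j<Suc k. (e j \<bullet> s n \<omega>)\<^sup>2) = (\<theta> \<bullet> s n \<omega>)\<^sup>2 + (\<Sum>j<k. (b j \<bullet> s n \<omega>)\<^sup>2)"
      by (subst sum.lessThan_Suc_shift) (simp add: e0 b_def)
    finally have "V n \<omega> = (\<Sum>j<k. real n / \<gamma> * (b j \<bullet> s n \<omega>)\<^sup>2)"
      by (simp add: V_def \<gamma>_def power2_norm_eq_inner sum_distrib_left sum_divide_distrib)
    also have "\<dots> = (\<Sum>j<k. (Z n j \<omega>)\<^sup>2)"
    proof (intro sum.cong refl)
      fix j
      have "Z n j \<omega> = (real n * (b j \<bullet> s n \<omega>)) / (sqrt \<gamma> * sqrt (real n))"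
        using n by (simp add: Z_def s_def inner_sum_right sum_divide_distrib[symmetric] mult.commute)
      then have "(Z n j \<omega>)\<^sup>2 = (real n * (b j \<bullet> s n \<omega>))\<^sup>2 / (\<gamma> * real n)"
        using \<gamma> by (simp add: power_divide power_mult_distrib)
      then show "real n / \<gamma> * (b j \<bullet> s n \<omega>)\<^sup>2 = (Z n j \<omega>)\<^sup>2"
        using n \<gamma> by (simp add: power2_eq_square field_simps)
    qed
    finally show ?thesis .
  qed
  have Zm: "Z n j \<in> borel_measurable (M n)" for n j
  proof -
    note [measurable] = iid_measurable[OF iid]
    show ?thesis unfolding Z_def by measurable
  qed
  show Vm: "V n \<in> borel_measurable (M n)" if "n \<ge> 1" for n
    by (subst measurable_cong[OF VZ[OF that]]) (intro borel_measurable_sum borel_measurable_power Zm)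
  have char: "(\<lambda>n. \<integral>\<omega>. iexp (\<Sum>j<k. c j * Z n j \<omega>) \<partial>M n) \<longlonglongrightarrow> complex_of_real (exp (- (\<Sum>j<k. (c j)\<^sup>2) / 2))" for c
  proof -
    \<comment> \<open>A linear combination of the coordinates is again a score, in the direction
      \<open>u\<close> orthogonal to \<theta>; its variance after division by \<gamma> is the
      squared norm of \<open>u\<close>, which is why the limiting covariance is the
      identity.\<close>
    define u where "u = (\<Sum>j<k. c j *\<^sub>R b j)"
    have uu: "(norm u)\<^sup>2 = (\<Sum>j<k. (c j)\<^sup>2)"
    proof -
      have "u \<bullet> u = (\<Sum>i<k. \<Sum>j<k. c i * (c j * (b j \<bullet> b i)))"
        by (simp add: u_def inner_sum_left inner_sum_right sum_distrib_left)
      also have "\<dots> = (\<Sum>i<k. \<Sum>j<k. if i = j then (c i)\<^sup>2 else 0)"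
        by (intro sum.cong refl) (auto simp: b power2_eq_square)
      finally show ?thesis by (simp add: power2_norm_eq_inner)
    qed
    have u\<theta>: "u \<bullet> \<theta> = 0" using b(2) by (auto simp: u_def inner_sum_left intro!: sum.neutral)
    define g where "g = (\<lambda>y. (u \<bullet> y) * (\<theta> \<bullet> y) / sqrt \<gamma>)"
    have [measurable]: "g \<in> borel_measurable borel" by (simp add: g_def)
    have gN: "g \<in> borel_measurable N" by (rule spherical_measurable[OF N]) simp
    have g2: "(g y)\<^sup>2 = (u \<bullet> y)\<^sup>2 * (\<theta> \<bullet> y)\<^sup>2 / \<gamma>" for y
      using \<gamma> by (simp add: g_def power_mult_distrib power_divide)
    have 1: "integrable (distr N borel g) (\<lambda>x. x\<^sup>2)"
      using spherical_integrable_mult_power[OF N, of 2 2 u \<theta>] gN by (simp add: integrable_distr_eq g2)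
    have 2: "(\<integral>x. x \<partial>distr N borel g) = 0"
      using spherical_cov[OF N, of u \<theta>] gN u\<theta> by (simp add: integral_distr g_def)
    have 3: "(\<integral>x. x\<^sup>2 \<partial>distr N borel g) = (norm u)\<^sup>2"
      using spherical_fourth[OF N u\<theta>] gN \<gamma> \<theta> by (simp add: integral_distr g2 \<gamma>_def)
    have "(\<lambda>n. char (distr (M n) borel (\<lambda>\<omega>. (\<Sum>i=1..n. g (Y n i \<omega>)) / sqrt (real n))) 1)
      \<longlonglongrightarrow> complex_of_real (exp (- ((norm u)\<^sup>2 * 1\<^sup>2) / 2))"
      using iid_char_clt[OF iid_compose[OF iid] 1 2, of 1] unfolding 3 by simp
    moreover have "char (distr (M n) borel (\<lambda>\<omega>. (\<Sum>i=1..n. g (Y n i \<omega>)) / sqrt (real n))) 1 = (\<integral>\<omega>. iexp (\<Sum>j<k. c j * Z n j \<omega>) \<partial>M n)" for n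
    proof -
      have "(\<Sum>i=1..n. g (Y n i \<omega>)) / sqrt (real n) = (\<Sum>j<k. c j * Z n j \<omega>)" for \<omega>
      proof -
        have "(\<Sum>i=1..n. g (Y n i \<omega>)) = (\<Sum>i=1..n. \<Sum>j<k. c j * ((b j \<bullet> Y n i \<omega>) * (\<theta> \<bullet> Y n i \<omega>) / sqrt \<gamma>))"
          by (simp add: g_def u_def inner_sum_left sum_distrib_left sum_distrib_right sum_divide_distrib mult_ac)
        also have "\<dots> = (\<Sum>j<k. c j * (\<Sum>i=1..n. (b j \<bullet> Y n i \<omega>) * (\<theta> \<bullet> Y n i \<omega>) / sqrt \<gamma>))"
          by (subst sum.swap) (simp add: sum_distrib_left)
        finally have eq: "(\<Sum>i=1..n. g (Y n i \<omega>)) = (\<Sum>j<k. c j * (\<Sum>i=1..n. (b j \<bullet> Y n i \<omega>) * (\<theta> \<bullet> Y n i \<omega>) / sqrt \<gamma>))" .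
        show ?thesis unfolding eq Z_def times_divide_eq_right[of _ _ "sqrt (real n)"] sum_divide_distrib[of _ "{..<k}"] ..
      qed
      moreover have "(\<lambda>\<omega>. \<Sum>j<k. c j * Z n j \<omega>) \<in> borel_measurable (M n)"
        by (intro borel_measurable_sum borel_measurable_times borel_measurable_const Zm)
      ultimately show ?thesis by (simp add: char_def integral_distr)
    qed
    ultimately show ?thesis by (simp add: uu)
  qed
  \<comment> \<open>The shift to \<open>Suc n\<close> avoids row 0, which need not be a probability
    space.\<close>
  have "weak_conv_m (\<lambda>n. distr (M (Suc n)) borel (\<lambda>\<omega>. \<Sum>j<k. (Z (Suc n) j \<omega>)\<^sup>2)) (chi_square k)"
    by (rule weak_conv_sum_squares[of "\<lambda>n. M (Suc n)" k "\<lambda>n. Z (Suc n)"])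
      (use iid_prob[OF iid] Zm LIMSEQ_Suc[OF char] in auto)
  moreover have "isCont (cdf (chi_square k)) x" using p by (intro isCont_cdf_chi_square) (simp add: k_def)
  ultimately have "(\<lambda>n. cdf (distr (M (Suc n)) borel (\<lambda>\<omega>. \<Sum>j<k. (Z (Suc n) j \<omega>)\<^sup>2)) x) \<longlonglongrightarrow> cdf (chi_square k) x"
    by (simp add: weak_conv_m_def weak_conv_def)
  moreover have "cdf (distr (M (Suc n)) borel (\<lambda>\<omega>. \<Sum>j<k. (Z (Suc n) j \<omega>)\<^sup>2)) x = measure (M (Suc n)) {\<omega> \<in> space (M (Suc n)). V (Suc n) \<omega> \<le> x}" for n
  proof -
    have "(\<lambda>\<omega>. \<Sum>j<k. (Z (Suc n) j \<omega>)\<^sup>2) \<in> borel_measurable (M (Suc n))"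
      by (intro borel_measurable_sum borel_measurable_power Zm)
    then show ?thesis by (simp add: cdf_def measure_distr VZ vimage_def Int_def conj_commute)
  qed
  ultimately show "(\<lambda>n. measure (M n) {\<omega> \<in> space (M n). V n \<omega> \<le> x}) \<longlonglongrightarrow> cdf (chi_square (CARD('p) - 1)) x"
    unfolding k_def[symmetric] by - (rule LIMSEQ_imp_Suc, simp)
qed

end

section \<open>Limit law of the test statistic\<close>

lemma
  fixes \<theta> :: "real^'p::finite" and X :: "nat \<Rightarrow> nat \<Rightarrow> 'a \<Rightarrow> real^'p"
  assumes model: "elliptical_model M X \<theta> r v f" and n: "n \<ge> 1"
  shows elliptical_model_prob: "prob_space (M n)"
    and elliptical_model_measurable: "i \<in> {1..n} \<Longrightarrow> X n i \<in> borel_measurable (M n)"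
    and elliptical_model_law: "i \<in> {1..n} \<Longrightarrow>
      distr (M n) borel (X n i) = density lborel (\<lambda>x. ennreal (elliptical_density (spiked_cov \<theta> (r n * v)) f x))"
proof -
  show "prob_space (M n)" using model n by (simp add: elliptical_model_def)
  assume i: "i \<in> {1..n}"
  have D: "distributed (M n) lborel (X n i) (\<lambda>x. ennreal (elliptical_density (spiked_cov \<theta> (r n * v)) f x))"
    using model n i by (simp add: elliptical_model_def)
  then show "X n i \<in> borel_measurable (M n)" by (simp add: distributed_def)
  have "distr (M n) borel (X n i) = distr (M n) lborel (X n i)" by (rule distr_cong) auto
  then show "distr (M n) borel (X n i) = density lborel (\<lambda>x. ennreal (elliptical_density (spiked_cov \<theta> (r n * v)) f x))"
    using D by (simp add: distributed_def)
qed

text \<open>The joint law of a row is a product of laws with densities, so null sets of polynomials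
  are almost surely avoided.\<close>

lemma elliptical_model_AE_cyclic:
  fixes \<theta> :: "real^'p::finite" and X :: "nat \<Rightarrow> nat \<Rightarrow> 'a \<Rightarrow> real^'p"
  assumes model: "elliptical_model M X \<theta> r v f" and \<theta>: "norm \<theta> = 1" and n: "n \<ge> 2 * CARD('p)"
  shows "AE \<omega> in M n. cyclic_vec (sample_cov n (\<lambda>i. X n i \<omega>)) \<theta>"
proof -
  have "CARD('p) > 0" by simp
  then have n1: "n \<ge> 1" using n by linarith
  interpret prob_space "M n" by (rule elliptical_model_prob[OF model n1])
  note X = elliptical_model_measurable[OF model n1] and law = elliptical_model_law[OF model n1]
  define L where "L = distr (M n) borel (X n 1)"
  have L: "L = density lborel (\<lambda>x. ennreal (elliptical_density (spiked_cov \<theta> (r n * v)) f x))"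
    unfolding L_def using n1 by (intro law) simp
  have probL: "prob_space L" unfolding L_def using n1 by (intro prob_space_distr X) simp
  have "indep_vars (\<lambda>_. borel) (X n) {1..n}" using model n1 by (simp add: elliptical_model_def)
  then have "distr (M n) (PiM {1..n} (\<lambda>_. borel)) (\<lambda>\<omega>. \<lambda>i\<in>{1..n}. X n i \<omega>) = PiM {1..n} (\<lambda>i. distr (M n) borel (X n i))"
    using n1 X by (subst (asm) indep_vars_iff_distr_eq_PiM') auto
  also have "\<dots> = PiM {1..n} (\<lambda>_. L)"
    by (intro PiM_cong refl) (simp add: law L)
  finally have D: "distr (M n) (PiM {1..n} (\<lambda>_. borel)) (\<lambda>\<omega>. \<lambda>i\<in>{1..n}. X n i \<omega>) = PiM {1..n} (\<lambda>_. L)" .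
  have dens: "(\<lambda>x. ennreal (elliptical_density (spiked_cov \<theta> (r n * v)) f x)) \<in> borel_measurable lborel"
  proof -
    have "distributed (M n) lborel (X n 1) (\<lambda>x. ennreal (elliptical_density (spiked_cov \<theta> (r n * v)) f x))"
      using model n1 by (simp add: elliptical_model_def)
    then show ?thesis by (simp add: distributed_def)
  qed
  have "AE x in PiM {1..n} (\<lambda>_. L). cyclic_vec (sample_cov n x) \<theta>"
  proof (rule AE_cyclic_vec_sample_cov[OF _ _ _ \<theta> n])
    show "sigma_finite_measure L" using probL by (rule prob_space_imp_sigma_finite)
    show "sets L = sets borel" by (simp add: L_def)
    show "absolutely_continuous lborel L" unfolding L by (rule absolutely_continuousI_density[OF dens])
  qed
  then have "AE \<omega> in M n. cyclic_vec (sample_cov n (\<lambda>i\<in>{1..n}. X n i \<omega>)) \<theta>"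
    unfolding D[symmetric] by (rule AE_distrD[rotated]) (intro measurable_restrict X)
  \<comment> \<open>The product law sees the row cut down to the indices 1 to \<open>n\<close>; the
    statistic reads no others.\<close>
  moreover have "sample_cov n (\<lambda>i\<in>{1..n}. x i) = sample_cov n x" for x :: "nat \<Rightarrow> real^'p"
  proof -
    have "(\<Sum>i=1..n. (\<lambda>i\<in>{1..n}. x i) i) = (\<Sum>i=1..n. x i)" by (rule sum.cong) auto
    then have m: "sample_mean n (\<lambda>i\<in>{1..n}. x i) = sample_mean n x" by (simp only: sample_mean_def)
    have "(\<Sum>i=1..n. outer_prod ((\<lambda>i\<in>{1..n}. x i) i - z) ((\<lambda>i\<in>{1..n}. x i) i - z))
      = (\<Sum>i=1..n. outer_prod (x i - z) (x i - z))" for z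
      by (rule sum.cong) auto
    then show ?thesis by (simp only: sample_cov_def m)
  qed
  ultimately show ?thesis by simp
qed

text \<open>The standardizing matrix varies with \<open>n\<close>, the resulting law does not; this
  makes arbitrary rates \<open>r n\<close> harmless.\<close>

lemma elliptical_model_iid_array:
  fixes \<theta> :: "real^'p::finite" and X :: "nat \<Rightarrow> nat \<Rightarrow> 'a \<Rightarrow> real^'p"
  assumes model: "elliptical_model M X \<theta> r v f" and \<theta>: "norm \<theta> = 1" and v: "v > 0" and r: "\<forall>n\<ge>1. r n > 0"
    and f: "f \<in> borel_measurable (restrict_space borel {0..})" "\<And>t. 0 \<le> t \<Longrightarrow> 0 \<le> f t"
    and c: "0 < elliptical_const TYPE('p) f"
  shows "iid_array M (\<lambda>n i \<omega>. spiked_iroot \<theta> (r n * v) *v X n i \<omega>) (radial_law f)"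
  unfolding iid_array_def
proof (intro allI impI conjI ballI)
  fix n :: nat assume n: "n \<ge> 1"
  interpret prob_space "M n" by (rule elliptical_model_prob[OF model n])
  show "prob_space (M n)" by (rule prob_space_axioms)
  have "indep_vars (\<lambda>_. borel) (X n) {1..n}" using model n by (simp add: elliptical_model_def)
  from indep_vars_compose2[OF this, of "\<lambda>_ x. spiked_iroot \<theta> (r n * v) *v x" "\<lambda>_. borel"]
  show "indep_vars (\<lambda>_. borel) (\<lambda>i \<omega>. spiked_iroot \<theta> (r n * v) *v X n i \<omega>) {1..n}" by simp
  fix i assume i: "i \<in> {1..n}"
  note X = elliptical_model_measurable[OF model n i]
  have "distr (M n) borel (\<lambda>\<omega>. spiked_iroot \<theta> (r n * v) *v X n i \<omega>)
    = distr (distr (M n) borel (X n i)) borel (\<lambda>x. spiked_iroot \<theta> (r n * v) *v x)"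
    using X by (simp add: distr_distr comp_def)
  also have "\<dots> = radial_law f"
    using r n v prob_space_distr[OF X]
    by (intro elliptical_standardized_law[OF \<theta> _ elliptical_model_law[OF model n i] _ f c]) auto
  finally show "distr (M n) borel (\<lambda>\<omega>. spiked_iroot \<theta> (r n * v) *v X n i \<omega>) = radial_law f" .
qed

section \<open>The statistic under a spherical standardized law, for the radial class and the
  Gaussian case alike\<close>

context
  fixes \<theta> :: "real^'p::finite" and v :: real and r :: "nat \<Rightarrow> real" and f :: "real \<Rightarrow> real"
    and M :: "nat \<Rightarrow> 'a measure" and X :: "nat \<Rightarrow> nat \<Rightarrow> 'a \<Rightarrow> real^'p"
    and lam :: "nat \<Rightarrow> nat \<Rightarrow> 'a \<Rightarrow> real" and th :: "nat \<Rightarrow> nat \<Rightarrow> 'a \<Rightarrow> real^'p"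
  assumes p: "CARD('p) \<ge> 2" and \<theta>: "norm \<theta> = 1" and v: "v > 0" and r: "\<forall>n\<ge>1. r n > 0"
    and est: "eigen_estimators M X lam th" and model: "elliptical_model M X \<theta> r v f"
    and f: "f \<in> borel_measurable (restrict_space borel {0..})" "\<And>t. 0 \<le> t \<Longrightarrow> 0 \<le> f t"
    and c: "0 < elliptical_const TYPE('p) f" and sph: "spherical_law (radial_law f :: (real^'p) measure)"
begin

private abbreviation Q where
  "Q n \<omega> \<equiv> Q_HPV \<theta> n (\<lambda>i. X n i \<omega>) (\<lambda>j. lam n j \<omega>) (\<lambda>j. th n j \<omega>)"

private abbreviation Qd where
  "Qd n \<omega> \<equiv> Q_HPV_dagger \<theta> n (\<lambda>i. X n i \<omega>) (\<lambda>j. lam n j \<omega>) (\<lambda>j. th n j \<omega>)"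

private abbreviation N :: "(real^'p) measure" where "N \<equiv> radial_law f"

definition standardized :: "nat \<Rightarrow> nat \<Rightarrow> 'a \<Rightarrow> real^'p" where
  "standardized n i \<omega> = spiked_iroot \<theta> (r n * v) *v X n i \<omega>"

text \<open>The uncentred counterpart of \<open>leading_term\<close>: its inner sum has i.i.d.
  summands, as the central limit theorem requires.\<close>

definition score_square :: "nat \<Rightarrow> 'a \<Rightarrow> real" where
  "score_square n \<omega> = (let s = (1 / real n) *\<^sub>R (\<Sum>i=1..n. (\<theta> \<bullet> standardized n i \<omega>) *\<^sub>R standardized n i \<omega>)
     in real n * (norm s ^ 2 - (\<theta> \<bullet> s)\<^sup>2))"

lemma standardized_iid: "iid_array M standardized (radial_law f)"
  using elliptical_model_iid_array[OF model \<theta> v r f c] by (simp add: standardized_def[abs_def])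

text \<open>On the intersection of finitely many events of high probability, all deterministic
  bounds hold with the same \<delta>.\<close>

lemma whp_Q_HPV_score:
  assumes "\<eta> > 0"
  shows "whp M (\<lambda>n \<omega>. \<bar>Qd n \<omega> - score_square n \<omega> / kurtosis_factor N\<bar> \<le> \<eta> * (1 + score_square n \<omega> / kurtosis_factor N) \<and>
    \<bar>Q n \<omega> - score_square n \<omega>\<bar> \<le> \<eta> * (1 + score_square n \<omega>))"
proof -
  note iid = standardized_iid
  define e where "e = real CARD('p) * (real CARD('p) + 2)"
  have e: "e \<ge> 1"
  proof -
    have "1 * 1 \<le> e" unfolding e_def using p by (intro mult_mono) auto
    then show ?thesis by simp
  qed
  have pos: "kurtosis_factor N > 0" by (rule spherical_kurtosis_pos[OF sph])
  \<comment> \<open>From \<open>62 * \<delta> * (1 + K)\<close> with \<open>K\<close> at most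
    \<open>kurtosis_factor N * e + 1\<close>, plus \<delta> for replacing \<open>K / e\<close> by
    its limit.\<close>
  define C where "C = 62 * (2 + kurtosis_factor N * e) + 1"
  have "0 < kurtosis_factor N * e" using pos e by simp
  then have C: "C > 0" by (simp add: C_def)
  from quotient_approximation[OF pos C assms] obtain \<delta> where \<delta>: "0 < \<delta>" "\<delta> \<le> 1 / 4"
    and approx: "\<And>Q W g V. 0 \<le> W \<Longrightarrow> 0 \<le> V \<Longrightarrow> \<bar>Q - W\<bar> \<le> 4 * \<delta> * W \<Longrightarrow> \<bar>g - kurtosis_factor N\<bar> \<le> C * \<delta> \<Longrightarrow> \<bar>W - V\<bar> \<le> 2 * \<delta> * (1 + V)
      \<Longrightarrow> \<bar>Q / g - V / kurtosis_factor N\<bar> \<le> \<eta> * (1 + V / kurtosis_factor N) \<and> \<bar>Q - V\<bar> \<le> \<eta> * (1 + V)" by metis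
  have d2: "\<delta> / 2 > 0" using \<delta> by simp
  have "whp M (\<lambda>n \<omega>. cyclic_vec (sample_cov n (\<lambda>i. X n i \<omega>)) \<theta>)"
    by (intro whp_AE eventually_sequentiallyI[of "2 * CARD('p)"] elliptical_model_AE_cyclic[OF model \<theta>])
  from whp_conj[OF this whp_conj[OF whp_conj[OF spherical_whp_mean[OF sph iid d2] spherical_whp_second_moment[OF sph iid d2]]
      whp_conj[OF spherical_whp_fourth_moment[OF sph iid \<delta>(1)] spherical_whp_sqrt_mean[OF sph iid \<delta>(1)]]]]
  show ?thesis
  proof (rule whp_mono_eventually, intro eventually_sequentiallyI[of 1] ballI impI)
    fix n :: nat and \<omega>
    assume n: "1 \<le> n" and \<omega>: "\<omega> \<in> space (M n)"
    let ?x = "\<lambda>i. X n i \<omega>" and ?y = "\<lambda>i. standardized n i \<omega>" and ?l = "\<lambda>j. lam n j \<omega>" and ?h = "\<lambda>j. th n j \<omega>"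
    let ?K = "(\<Sum>i=1..n. norm (?y i) ^ 4) / real n"
    assume "cyclic_vec (sample_cov n ?x) \<theta> \<and>
       (norm (sample_mean n ?y) \<le> \<delta> / 2 \<and> norm ((1 / real n) *\<^sub>R (\<Sum>i=1..n. outer_prod (?y i) (?y i)) - mat 1) \<le> \<delta> / 2) \<and>
       \<bar>?K - kurtosis_factor N * (real CARD('p) * (real CARD('p) + 2))\<bar> \<le> \<delta> \<and> sqrt (real n) * (norm (sample_mean n ?y))\<^sup>2 \<le> \<delta>"
    then have cyc: "cyclic_vec (sample_cov n ?x) \<theta>" and m: "norm (sample_mean n ?y) \<le> \<delta> / 2"
      and A: "norm ((1 / real n) *\<^sub>R (\<Sum>i=1..n. outer_prod (?y i) (?y i)) - mat 1) \<le> \<delta> / 2"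
      and K: "\<bar>?K - kurtosis_factor N * e\<bar> \<le> \<delta>" and m2: "sqrt (real n) * (norm (sample_mean n ?y))\<^sup>2 \<le> \<delta>"
      by (auto simp: e_def)
    have a: "r n * v > 0" using r n v by simp
    have xy: "?x i = spiked_root \<theta> (r n * v) *v ?y i" for i
      by (simp add: standardized_def matrix_vector_mul_assoc spiked_root_iroot[OF \<theta> a])
    have near: "norm (sample_cov n ?y *v z - z) \<le> \<delta> * norm z" for z
      using sample_cov_near_identity[OF n A m] \<delta> by simp
    have es: "eigen_system (sample_cov n ?x) ?l ?h" using est n \<omega> by (simp add: eigen_estimators_def)
    note lead = Q_HPV_leading_term[OF \<theta> a n xy less_imp_le[OF \<delta>(1)] \<delta>(2) near es cyc p]
    have m': "norm (sample_mean n ?y) \<le> \<delta>" using m \<delta> by simp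
    have kur: "\<bar>1 + kurtosis_est n ?x - ?K / e\<bar> \<le> 62 * \<delta> * (1 + ?K)"
      using kurtosis_est_near[OF \<theta> a n xy less_imp_le[OF \<delta>(1)] \<delta>(2) near m'] by (simp add: e_def)
    have "\<bar>?K / e - kurtosis_factor N\<bar> = \<bar>?K - kurtosis_factor N * e\<bar> / e"
    proof -
      have "z / e - k = (z - k * e) / e" for z k using e by (simp add: diff_divide_distrib)
      then show ?thesis using e by (simp only: abs_divide)
    qed
    also have "\<dots> \<le> \<delta> / 1" using K e by (intro frac_le) auto
    finally have "\<bar>?K / e - kurtosis_factor N\<bar> \<le> \<delta>" by simp
    moreover have "62 * \<delta> * (1 + ?K) \<le> 62 * \<delta> * (2 + kurtosis_factor N * e)"
      using K \<delta> by (intro mult_left_mono) auto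
    ultimately have "\<bar>1 + kurtosis_est n ?x - kurtosis_factor N\<bar> \<le> 62 * \<delta> * (2 + kurtosis_factor N * e) + \<delta>" using kur by linarith
    also have "\<dots> = C * \<delta>" by (simp add: C_def algebra_simps)
    finally have g: "\<bar>(1 + kurtosis_est n ?x) - kurtosis_factor N\<bar> \<le> C * \<delta>" .
    have sc: "score_square n \<omega> = real n * (norm ((1 / real n) *\<^sub>R (\<Sum>i=1..n. (\<theta> \<bullet> ?y i) *\<^sub>R ?y i)) ^ 2
        - (\<theta> \<bullet> ((1 / real n) *\<^sub>R (\<Sum>i=1..n. (\<theta> \<bullet> ?y i) *\<^sub>R ?y i)))\<^sup>2)"
      by (simp only: score_square_def Let_def)
    have \<delta>1: "\<delta> \<le> 1" using \<delta> by simp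
    note unc = leading_term_uncentered[OF \<theta> n m2 less_imp_le[OF \<delta>(1)] \<delta>1, folded sc]
    show "\<bar>Qd n \<omega> - score_square n \<omega> / kurtosis_factor N\<bar> \<le> \<eta> * (1 + score_square n \<omega> / kurtosis_factor N) \<and>
      \<bar>Q n \<omega> - score_square n \<omega>\<bar> \<le> \<eta> * (1 + score_square n \<omega>)"
      unfolding Q_HPV_dagger_def
      by (rule approx[OF lead(2) unc(2) lead(1) g unc(1)])
  qed
qed

lemma score_conv:
  "(\<lambda>n. measure (M n) {\<omega> \<in> space (M n). score_square n \<omega> / kurtosis_factor N \<le> x}) \<longlonglongrightarrow> cdf (chi_square (CARD('p) - 1)) x"
  "n \<ge> 1 \<Longrightarrow> (\<lambda>\<omega>. score_square n \<omega> / kurtosis_factor N) \<in> borel_measurable (M n)"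
  unfolding score_square_def Let_def
  by (rule spherical_score_conv[OF sph standardized_iid \<theta> p])+

lemma whp_Q_HPV_dagger: "\<eta> > 0 \<Longrightarrow> whp M (\<lambda>n \<omega>. \<bar>Qd n \<omega> - score_square n \<omega> / kurtosis_factor N\<bar> \<le> \<eta>)"
  by (rule whp_tight[OF iid_prob[OF standardized_iid] score_conv(2) real_distribution_chi_square score_conv(1)])
    (auto intro: whp_mono[OF whp_Q_HPV_score])

text \<open>When the factor is 1, the statistic without kurtosis correction is compared with the
  same limiting variable as the corrected one.\<close>

lemma whp_Q_HPV: "kurtosis_factor N = 1 \<Longrightarrow> \<eta> > 0 \<Longrightarrow> whp M (\<lambda>n \<omega>. \<bar>Q n \<omega> - score_square n \<omega> / kurtosis_factor N\<bar> \<le> \<eta>)"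
  by (rule whp_tight[OF iid_prob[OF standardized_iid] score_conv(2) real_distribution_chi_square score_conv(1)])
    (auto intro: whp_mono[OF whp_Q_HPV_score])

lemma measurable_Q_HPV_dagger:
  assumes n: "n \<ge> 1"
  shows "Qd n \<in> borel_measurable (M n)"
proof -
  note X = elliptical_model_measurable[OF model n]
  have "Q n \<in> borel_measurable (M n)"
    using est n by (intro measurable_Q_HPV[OF X]) (auto simp: eigen_estimators_def)
  then show ?thesis
    unfolding Q_HPV_dagger_def using measurable_kurtosis_est[OF X] by measurable
qed

lemma Q_HPV_dagger_conv: "(\<lambda>n. measure (M n) {\<omega> \<in> space (M n). Qd n \<omega> \<le> x}) \<longlonglongrightarrow> cdf (chi_square (CARD('p) - 1)) x"
  using p by (intro slutsky_cdf[OF iid_prob[OF standardized_iid] score_conv(2) measurable_Q_HPV_dagger score_conv(1)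
      isCont_cdf_chi_square whp_Q_HPV_dagger]) auto

lemma Q_HPV_dagger_weak_conv:
  "weak_conv_m (\<lambda>n. distr (M n) borel (\<lambda>\<omega>. Qd n \<omega>)) (chi_square (CARD('p) - 1))"
  unfolding weak_conv_m_def weak_conv_def
proof (intro allI impI)
  fix x
  have "\<forall>\<^sub>F n in sequentially. measure (M n) {\<omega> \<in> space (M n). Qd n \<omega> \<le> x} = cdf (distr (M n) borel (\<lambda>\<omega>. Qd n \<omega>)) x"
    using measurable_Q_HPV_dagger
    by (intro eventually_sequentiallyI[of 1]) (simp add: cdf_def measure_distr vimage_def Int_def conj_commute)
  with Q_HPV_dagger_conv show "(\<lambda>n. cdf (distr (M n) borel (\<lambda>\<omega>. Qd n \<omega>)) x) \<longlonglongrightarrow> cdf (chi_square (CARD('p) - 1)) x"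
    by (rule Lim_transform_eventually)
qed

lemma rejects_HPV_dagger_conv:
  assumes \<alpha>: "0 < \<alpha>" "\<alpha> < 1"
  shows "(\<lambda>n. measure (M n) {\<omega> \<in> space (M n).
    rejects_HPV_dagger \<alpha> \<theta> n (\<lambda>i. X n i \<omega>) (\<lambda>j. lam n j \<omega>) (\<lambda>j. th n j \<omega>)}) \<longlonglongrightarrow> \<alpha>"
proof -
  define q where "q = upper_quantile (chi_square (CARD('p) - 1)) \<alpha>"
  have Gq: "cdf (chi_square (CARD('p) - 1)) q = 1 - \<alpha>"
    unfolding q_def using p by (intro cdf_upper_quantile real_distribution_chi_square isCont_cdf_chi_square \<alpha>) simp
  have "(\<lambda>n. 1 - measure (M n) {\<omega> \<in> space (M n). Qd n \<omega> \<le> q}) \<longlonglongrightarrow> 1 - cdf (chi_square (CARD('p) - 1)) q"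
    by (intro tendsto_intros Q_HPV_dagger_conv)
  moreover have "\<forall>\<^sub>F n in sequentially. 1 - measure (M n) {\<omega> \<in> space (M n). Qd n \<omega> \<le> q} =
    measure (M n) {\<omega> \<in> space (M n). rejects_HPV_dagger \<alpha> \<theta> n (\<lambda>i. X n i \<omega>) (\<lambda>j. lam n j \<omega>) (\<lambda>j. th n j \<omega>)}"
  proof (intro eventually_sequentiallyI[of 1])
    fix n :: nat assume n: "1 \<le> n"
    interpret prob_space "M n" by (rule elliptical_model_prob[OF model n])
    note [measurable] = measurable_Q_HPV_dagger[OF n]
    have "prob {\<omega> \<in> space (M n). \<not> Qd n \<omega> \<le> q} = 1 - prob {\<omega> \<in> space (M n). Qd n \<omega> \<le> q}"
      by (rule prob_neg) measurable
    then show "1 - prob {\<omega> \<in> space (M n). Qd n \<omega> \<le> q} =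
      prob {\<omega> \<in> space (M n). rejects_HPV_dagger \<alpha> \<theta> n (\<lambda>i. X n i \<omega>) (\<lambda>j. lam n j \<omega>) (\<lambda>j. th n j \<omega>)}"
      by (simp add: rejects_HPV_dagger_def q_def not_le)
  qed
  ultimately have "(\<lambda>n. measure (M n) {\<omega> \<in> space (M n).
    rejects_HPV_dagger \<alpha> \<theta> n (\<lambda>i. X n i \<omega>) (\<lambda>j. lam n j \<omega>) (\<lambda>j. th n j \<omega>)}) \<longlonglongrightarrow> 1 - cdf (chi_square (CARD('p) - 1)) q"
    by (rule Lim_transform_eventually)
  then show ?thesis unfolding Gq by simp
qed

lemma Q_HPV_dagger_minus_Q_HPV:
  assumes "kurtosis_factor N = 1"
  shows "negligible_in_prob M (\<lambda>n \<omega>. Qd n \<omega> - Q n \<omega>)"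
  unfolding negligible_in_prob_def
proof (intro allI impI)
  fix \<epsilon> :: real assume "\<epsilon> > 0"
  then have "whp M (\<lambda>n \<omega>. \<bar>Qd n \<omega> - score_square n \<omega> / kurtosis_factor N\<bar> \<le> \<epsilon> / 2 \<and> \<bar>Q n \<omega> - score_square n \<omega> / kurtosis_factor N\<bar> \<le> \<epsilon> / 2)"
    by (intro whp_conj whp_Q_HPV_dagger whp_Q_HPV assms) auto
  then have "whp M (\<lambda>n \<omega>. \<bar>Qd n \<omega> - Q n \<omega>\<bar> \<le> \<epsilon>)"
  proof (rule whp_mono)
    fix n \<omega>
    assume "\<bar>Qd n \<omega> - score_square n \<omega> / kurtosis_factor N\<bar> \<le> \<epsilon> / 2 \<and> \<bar>Q n \<omega> - score_square n \<omega> / kurtosis_factor N\<bar> \<le> \<epsilon> / 2"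
    then show "\<bar>Qd n \<omega> - Q n \<omega>\<bar> \<le> \<epsilon>" by linarith
  qed
  from whp_measure_tendsto[OF this]
  show "(\<lambda>n. measure (M n) {\<omega> \<in> space (M n). \<bar>Qd n \<omega> - Q n \<omega>\<bar> > \<epsilon>}) \<longlonglongrightarrow> 0"
    by (simp add: not_le)
qed

end

theorem theorem5p1:
  fixes \<theta>0 :: "real^'p::finite" and v :: real and r :: "nat \<Rightarrow> real"
    and M :: "nat \<Rightarrow> 'a measure" and X :: "nat \<Rightarrow> nat \<Rightarrow> 'a \<Rightarrow> real^'p"
    and lam :: "nat \<Rightarrow> nat \<Rightarrow> 'a \<Rightarrow> real" and th :: "nat \<Rightarrow> nat \<Rightarrow> 'a \<Rightarrow> real^'p"
  assumes "CARD('p) \<ge> 2"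
    and "norm \<theta>0 = 1"
    and "v > 0"
    and "\<forall>n\<ge>1. r n > 0"
    and "bounded (range r)"
    and "eigen_estimators M X lam th"
  shows "(\<forall>f \<in> radial_class TYPE('p). elliptical_model M X \<theta>0 r v f \<longrightarrow>
           weak_conv_m
             (\<lambda>n. distr (M n) borel
                (\<lambda>\<omega>. Q_HPV_dagger \<theta>0 n (\<lambda>i. X n i \<omega>) (\<lambda>j. lam n j \<omega>) (\<lambda>j. th n j \<omega>)))
             (chi_square (CARD('p) - 1)) \<and>
           (HPV_regime r \<longrightarrow>
             (\<forall>\<alpha>. 0 < \<alpha> \<and> \<alpha> < 1 \<longrightarrow>
               (\<lambda>n. measure (M n) {\<omega> \<in> space (M n).
                   rejects_HPV_dagger \<alpha> \<theta>0 n (\<lambda>i. X n i \<omega>) (\<lambda>j. lam n j \<omega>) (\<lambda>j. th n j \<omega>)})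
                 \<longlonglongrightarrow> \<alpha>))) \<and>
         (elliptical_model M X \<theta>0 r v gaussian_radial \<longrightarrow>
           negligible_in_prob M
             (\<lambda>n \<omega>. Q_HPV_dagger \<theta>0 n (\<lambda>i. X n i \<omega>) (\<lambda>j. lam n j \<omega>) (\<lambda>j. th n j \<omega>)
                    - Q_HPV \<theta>0 n (\<lambda>i. X n i \<omega>) (\<lambda>j. lam n j \<omega>) (\<lambda>j. th n j \<omega>)))"
proof (intro conjI ballI impI allI)
  fix f assume f: "f \<in> radial_class TYPE('p)" and model: "elliptical_model M X \<theta>0 r v f"
  have fm: "f \<in> borel_measurable (restrict_space borel {0..})" and f0: "\<And>t. 0 \<le> t \<Longrightarrow> 0 \<le> f t"
    and c: "0 < elliptical_const TYPE('p) f"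
    using f unfolding radial_class_def radial_density_def by blast+
  \<comment> \<open>One observation is enough to see that the elliptical density has total mass one;
    the law \<open>radial_law f\<close> derived from it does not involve the row.\<close>
  interpret prob_space "M 1" using elliptical_model_prob[OF model, of 1] by simp
  have L: "distr (M 1) borel (X 1 1) = density lborel (\<lambda>x. ennreal (elliptical_density (spiked_cov \<theta>0 (r 1 * v)) f x))"
    by (rule elliptical_model_law[OF model]) simp_all
  have "X 1 1 \<in> borel_measurable (M 1)" by (rule elliptical_model_measurable[OF model]) simp_all
  then have "prob_space (distr (M 1) borel (X 1 1))" by (rule prob_space_distr)
  then have sph: "spherical_law (radial_law f :: (real^'p) measure)"
    using assms(4) by (intro radial_class_spherical_law[OF f assms(2) _ assms(3) L]) auto
  note facts = assms(1-4,6) model fm f0 c sph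
  show "weak_conv_m
      (\<lambda>n. distr (M n) borel (\<lambda>\<omega>. Q_HPV_dagger \<theta>0 n (\<lambda>i. X n i \<omega>) (\<lambda>j. lam n j \<omega>) (\<lambda>j. th n j \<omega>)))
      (chi_square (CARD('p) - 1))"
    by (rule Q_HPV_dagger_weak_conv[OF facts])
  fix \<alpha> :: real assume "0 < \<alpha> \<and> \<alpha> < 1"
  then show "(\<lambda>n. measure (M n) {\<omega> \<in> space (M n).
      rejects_HPV_dagger \<alpha> \<theta>0 n (\<lambda>i. X n i \<omega>) (\<lambda>j. lam n j \<omega>) (\<lambda>j. th n j \<omega>)}) \<longlonglongrightarrow> \<alpha>"
    by (intro rejects_HPV_dagger_conv[OF facts]) auto
next
  \<comment> \<open>For the Gaussian density sphericity is obtained from its explicit moments, not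
    from membership in \<open>radial_class\<close>.\<close>
  assume model: "elliptical_model M X \<theta>0 r v gaussian_radial"
  have "continuous_on UNIV gaussian_radial" unfolding gaussian_radial_def by (intro continuous_intros) auto
  then have fm: "gaussian_radial \<in> borel_measurable (restrict_space borel {0..})"
    by (intro measurable_restrict_space1 borel_measurable_continuous_onI)
  have f0: "0 \<le> gaussian_radial t" for t by (simp add: gaussian_radial_def)
  have c: "0 < elliptical_const TYPE('p) gaussian_radial" by (simp add: elliptical_const_gaussian)
  show "negligible_in_prob M
      (\<lambda>n \<omega>. Q_HPV_dagger \<theta>0 n (\<lambda>i. X n i \<omega>) (\<lambda>j. lam n j \<omega>) (\<lambda>j. th n j \<omega>)
        - Q_HPV \<theta>0 n (\<lambda>i. X n i \<omega>) (\<lambda>j. lam n j \<omega>) (\<lambda>j. th n j \<omega>))"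
    by (rule Q_HPV_dagger_minus_Q_HPV[OF assms(1-4,6) model fm f0 c
        gaussian_spherical_law[OF assms(1)] gaussian_kurtosis_factor[OF assms(1)]])
qed

end
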